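(* Let $(Q(t))_{t\ge0}$ be a regular HA-semigroup on $D$ and let $(\gamma(t))_{t\ge0}$ be a stochastically continuous SC-semigroup associated with $(Q(t))_{t\ge0}$. Then each $\gamma(t)$ is an infinitely divisible probability measure, so that $$\int_D\exp\{\langle u,\xi\rangle\}\gamma(t,d\xi)=\exp\{\phi(t,u)\},\qquad u\in U,$$ with $$\phi(t,u)=b_1(t)u_1+b_2(t)u_2+a(t)u_2^2+\int_D\big(e^{\langle u,\xi\rangle}-1-u_2\chi(\xi_2)\big)m(t,d\xi),$$ where $a(t)\in\mathbb{R}_+$, $(b_1(t),b_2(t))\in D$ and $m(t,d\xi)$ is a $\sigma$-finite measure on $D$ supported by $D\setminus\{0\}$ such that $\int_D[\chi(\xi_1)+\chi^2(\xi_2)]m(t,d\xi)<\infty$. Moreover, for any $r,t\ge0$, $$b_1(r+t)=b_1(r)\beta_{11}(t)+b_1(t),$$ $$b_2(r+t)=b_1(r)\beta_{12}(t)+b_2(r)\beta_{22}(t)+b_2(t)+\int_D[Q(t)\chi_2(\xi)-\beta_{22}(t)\chi(\xi_2)]\,m(r,d\xi),$$ $$a(r+t)=b_1(r)\alpha(t)+a(r)\beta_{22}^2(t)+a(t),$$ $$m(r+t,\cdot)=\int_D m(r,d\xi)Q(t,\xi,\cdot)+b_1(r)\mu(t,\cdot)+m(t,\cdot).$$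
   Context: $\mathbb{R}_+=[0,\infty)$, $D=\mathbb{R}_+\times\mathbb{R}$, $U=\mathbb{C}_-\times(i\mathbb{R})$, where $\mathbb{C}_-=\{a+ib: a\le 0,\ b\in\mathbb{R}\}$ and $i\mathbb{R}=\{ib:b\in\mathbb{R}\}$; $\langle u,\xi\rangle=u_1\xi_1+u_2\xi_2$ (bilinear). $\chi(x)=x$ for $x\in[-1,1]$, $\chi(x)=1$ for $x>1$, $\chi(x)=-1$ for $x<-1$. HA-semigroup: a transition semigroup $(Q(t))_{t\ge0}$ with state space $D$ such that for each $t\ge0$ there is a continuous two-dimensional complex-valued function $\psi(t,\cdot)=(\psi_1(t,\cdot),\psi_2(t,\cdot))$ on $U$ with $\int_D \exp\{\langle u,\xi\rangle\}Q(t,x,d\xi)=\exp\{\langle x,\psi(t,u)\rangle\}$ for all $x\in D$, $u\in U$. It is stochastically continuous if $t\mapsto Q(t,x,\cdot)$ is weakly continuous on $[0,\infty)$ for each $x\in D$. It is regular if it is stochastically continuous and the derivative $\psi'_t(0,u)$ exists for all $u\in U$ and is continuous at $u=0$. For any HA-semigroup one has $\psi_2(t,u)=\beta_{22}(t)u_2$ with $\beta_{22}(t)\in\mathbb{R}$, and $$\psi_1(t,u)=\beta_{11}(t)u_1+\beta_{12}(t)u_2+\alpha(t)u_2^2+\int_D(e^{\langle u,\xi\rangle}-1-u_2\chi(\xi_2))\mu(t,d\xi),$$ with $\alpha(t)\in\mathbb{R}_+$, $(\beta_{11}(t),\beta_{12}(t))\in D$ and $\mu(t,d\xi)$ a $\sigma$-finite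 measure on $D$ supported by $D\setminus\{0\}$ such that $\int_D[\chi(\xi_1)+\chi^2(\xi_2)]\mu(t,d\xi)<\infty$; these define $\beta_{11},\beta_{12},\beta_{22},\alpha,\mu$. Also $Q(t)\chi_2(\xi)=\int_D\chi(\eta_2)Q(t,\xi,d\eta)$. SC-semigroup associated with $(Q(t))_{t\ge0}$: a family of probability measures $(\gamma(t))_{t\ge0}$ on $D$ with $\gamma(r+t)=(\gamma(r)Q(t))*\gamma(t)$ for all $r,t\ge0$, where $*$ is convolution and $\gamma(r)Q(t)(B)=\int_D Q(t,\xi,B)\gamma(r,d\xi)$ for Borel $B\subseteq D$. It is stochastically continuous if $t\mapsto\gamma(t)$ is weakly continuous on $[0,\infty)$.
   Formalization: The identity for m(r+t,·) is stated as an identity of measures on D∖{0} (Borel sets not containing 0), since Q(t,ξ,·) may charge the origin (e.g. extinction of a Feller diffusion), where the literal identity on D fails. *)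

theory Defs
  imports "HOL-Probability.Probability"
begin

definition state_D :: "(real \<times> real) set" where
  "state_D = {0..} \<times> UNIV"

abbreviation borel_D :: "(real \<times> real) measure" where
  "borel_D \<equiv> restrict_space borel state_D"

definition dom_U :: "(complex \<times> complex) set" where
  "dom_U = {u. Re (fst u) \<le> 0} \<inter> {u. Re (snd u) = 0}"

text \<open>Bilinear (not sesquilinear) pairing, with the complex vector first.\<close>

definition pairing :: "complex \<times> complex \<Rightarrow> real \<times> real \<Rightarrow> complex" where
  "pairing u x = fst u * complex_of_real (fst x) + snd u * complex_of_real (snd x)"

definition chi :: "real \<Rightarrow> real" where
  "chi x = (if x > 1 then 1 else if x < - 1 then - 1 else x)"

text \<open>Families indexed by time have index type \<^typ>\<open>real\<close>; only indices \<open>t \<ge> 0\<close> matter, and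
  kernels \<open>Q t x\<close> matter only for \<open>x\<close> in \<^const>\<open>state_D\<close>.\<close>

definition weakly_continuous :: "(real \<Rightarrow> (real \<times> real) measure) \<Rightarrow> bool" where
  "weakly_continuous M \<longleftrightarrow>
     (\<forall>f :: real \<times> real \<Rightarrow> real. continuous_on state_D f \<and> bounded (f ` state_D) \<longrightarrow>
        continuous_on {0..} (\<lambda>t. \<integral>x. f x \<partial>M t))"

definition transition_semigroup ::
    "(real \<Rightarrow> real \<times> real \<Rightarrow> (real \<times> real) measure) \<Rightarrow> bool" where
  "transition_semigroup Q \<longleftrightarrow>
     (\<forall>t\<ge>0. Q t \<in> borel_D \<rightarrow>\<^sub>M prob_algebra borel_D) \<and>
     (\<forall>x\<in>state_D. Q 0 x = return borel_D x) \<and>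
     (\<forall>r\<ge>0. \<forall>t\<ge>0. \<forall>x\<in>state_D. Q (r + t) x = bind (Q r x) (Q t))"

text \<open>The exponent \<open>\<psi>\<close> is carried explicitly; on \<^const>\<open>dom_U\<close> it is determined by \<open>Q\<close>.\<close>

definition HA_semigroup ::
    "(real \<Rightarrow> real \<times> real \<Rightarrow> (real \<times> real) measure) \<Rightarrow>
     (real \<Rightarrow> complex \<times> complex \<Rightarrow> complex \<times> complex) \<Rightarrow> bool" where
  "HA_semigroup Q \<psi> \<longleftrightarrow>
     transition_semigroup Q \<and>
     (\<forall>t\<ge>0. continuous_on dom_U (\<psi> t) \<and>
        (\<forall>x\<in>state_D. \<forall>u\<in>dom_U.
           (\<integral>\<xi>. exp (pairing u \<xi>) \<partial>Q t x) = exp (pairing (\<psi> t u) x)))"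

definition regular_HA_semigroup ::
    "(real \<Rightarrow> real \<times> real \<Rightarrow> (real \<times> real) measure) \<Rightarrow>
     (real \<Rightarrow> complex \<times> complex \<Rightarrow> complex \<times> complex) \<Rightarrow> bool" where
  "regular_HA_semigroup Q \<psi> \<longleftrightarrow>
     HA_semigroup Q \<psi> \<and>
     (\<forall>x\<in>state_D. weakly_continuous (\<lambda>t. Q t x)) \<and>
     (\<exists>\<psi>'. (\<forall>u\<in>dom_U. ((\<lambda>t. \<psi> t u) has_vector_derivative \<psi>' u) (at 0 within {0..})) \<and>
           continuous (at 0 within dom_U) \<psi>')"

text \<open>The triple \<open>((b1, b2), a, m)\<close> ranges over \<open>D \<times> [0, \<infinity>)\<close> and the measures on \<open>D \<setminus> {0}\<close>,
  the latter encoded as measures on \<open>D\<close> without mass at \<open>0\<close>. Since \<open>Q t \<xi>\<close> may charge the origin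
  even for \<open>\<xi> \<noteq> 0\<close>, identities between such measures that involve \<open>\<integral>\<^sup>+\<xi>. emeasure (Q t \<xi>) B \<partial>m\<close> are
  identities on \<open>D \<setminus> {0}\<close>, i.e. for Borel sets \<open>B\<close> with \<open>0 \<notin> B\<close>.\<close>

definition LK_triple :: "real \<Rightarrow> real \<Rightarrow> real \<Rightarrow> (real \<times> real) measure \<Rightarrow> bool" where
  "LK_triple b1 b2 a m \<longleftrightarrow>
     (b1, b2) \<in> state_D \<and> 0 \<le> a \<and>
     sets m = sets borel_D \<and> sigma_finite_measure m \<and> emeasure m {0} = 0 \<and>
     (\<integral>\<^sup>+\<xi>. ennreal (chi (fst \<xi>) + (chi (snd \<xi>))\<^sup>2) \<partial>m) < \<infinity>"

definition LK_exponent ::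
    "real \<Rightarrow> real \<Rightarrow> real \<Rightarrow> (real \<times> real) measure \<Rightarrow> complex \<times> complex \<Rightarrow> complex" where
  "LK_exponent b1 b2 a m u =
     of_real b1 * fst u + of_real b2 * snd u + of_real a * (snd u)\<^sup>2 +
     (\<integral>\<xi>. (exp (pairing u \<xi>) - 1 - snd u * of_real (chi (snd \<xi>))) \<partial>m)"

definition HA_parameters ::
    "(real \<Rightarrow> complex \<times> complex \<Rightarrow> complex \<times> complex) \<Rightarrow>
     (real \<Rightarrow> real) \<Rightarrow> (real \<Rightarrow> real) \<Rightarrow> (real \<Rightarrow> real) \<Rightarrow> (real \<Rightarrow> real) \<Rightarrow>
     (real \<Rightarrow> (real \<times> real) measure) \<Rightarrow> bool" where
  "HA_parameters \<psi> \<beta>11 \<beta>12 \<beta>22 \<alpha> \<mu> \<longleftrightarrow>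
     (\<forall>t\<ge>0. LK_triple (\<beta>11 t) (\<beta>12 t) (\<alpha> t) (\<mu> t) \<and>
        (\<forall>u\<in>dom_U. fst (\<psi> t u) = LK_exponent (\<beta>11 t) (\<beta>12 t) (\<alpha> t) (\<mu> t) u \<and>
                    snd (\<psi> t u) = of_real (\<beta>22 t) * snd u))"

text \<open>The library's \<^const>\<open>convolution\<close> lives on the Borel sets of the whole plane; this version
  stays on \<open>D\<close>, which is closed under addition.\<close>

definition conv_D :: "(real \<times> real) measure \<Rightarrow> (real \<times> real) measure \<Rightarrow> (real \<times> real) measure" where
  "conv_D M N = distr (M \<Otimes>\<^sub>M N) borel_D (\<lambda>(x, y). x + y)"

definition infinitely_divisible_D :: "(real \<times> real) measure \<Rightarrow> bool" where
  "infinitely_divisible_D M \<longleftrightarrow>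
     M \<in> space (prob_algebra borel_D) \<and>
     (\<forall>n\<ge>1. \<exists>N \<in> space (prob_algebra borel_D). M = (conv_D N ^^ n) (return borel_D 0))"

definition SC_semigroup ::
    "(real \<Rightarrow> real \<times> real \<Rightarrow> (real \<times> real) measure) \<Rightarrow> (real \<Rightarrow> (real \<times> real) measure) \<Rightarrow> bool" where
  "SC_semigroup Q \<gamma> \<longleftrightarrow>
     (\<forall>t\<ge>0. \<gamma> t \<in> space (prob_algebra borel_D)) \<and>
     (\<forall>r\<ge>0. \<forall>t\<ge>0. \<gamma> (r + t) = conv_D (bind (\<gamma> r) (Q t)) (\<gamma> t))"

definition SC_parameters ::
    "(real \<Rightarrow> (real \<times> real) measure) \<Rightarrow>
     (real \<Rightarrow> real) \<Rightarrow> (real \<Rightarrow> real) \<Rightarrow> (real \<Rightarrow> real) \<Rightarrow> (real \<Rightarrow> (real \<times> real) measure) \<Rightarrow> bool" where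
  "SC_parameters \<gamma> b1 b2 a m \<longleftrightarrow>
     (\<forall>t\<ge>0. LK_triple (b1 t) (b2 t) (a t) (m t) \<and>
        (\<forall>u\<in>dom_U. (\<integral>\<xi>. exp (pairing u \<xi>) \<partial>\<gamma> t) = exp (LK_exponent (b1 t) (b2 t) (a t) (m t) u)))"

definition Q_chi2 ::
    "(real \<Rightarrow> real \<times> real \<Rightarrow> (real \<times> real) measure) \<Rightarrow> real \<Rightarrow> real \<times> real \<Rightarrow> real" where
  "Q_chi2 Q t \<xi> = (\<integral>\<eta>. chi (snd \<eta>) \<partial>Q t \<xi>)"

end

theory Submission
  imports Defs
begin

text \<open>Write \<open>L(t, u)\<close> for the transform of \<open>\<gamma>(t)\<close>, so that \<open>L(r + t, u) = L(r, \<psi>(t, u)) L(t, u)\<close>. For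
  infinite divisibility cut \<open>[0, t]\<close> into short intervals and collect the contributions to \<open>\<gamma>(t)\<close> of every \<open>m\<close>-th
  interval; the \<open>m\<close> laws obtained in this way convolve to \<open>\<gamma>(t)\<close>, and they differ from each other only by the
  action of \<open>Q(s)\<close> with \<open>s\<close> small, so they have a common weak limit, an \<open>m\<close>-th convolution root of \<open>\<gamma>(t)\<close>.
  The Levy-Khintchine triple is the limit of the normalized roots. The semigroup relation turns into
  \<open>\<phi>(r + t, u) = \<phi>(r, \<psi>(t, u)) + \<phi>(t, u)\<close>; truncated moments of \<open>Q(t, \<xi>, \<cdot>)\<close> are bounded by those of the point
  mass at \<open>\<xi>\<close>, so the right-hand side is again of Levy-Khintchine form, and the identities follow from
  the uniqueness of that representation.\<close>

section \<open>Transforms of measures on the half-plane\<close>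

text \<open>The family \<open>\<gamma>\<close> is not a convolution semigroup:
  \<open>\<gamma> (t / m)\<close> is no root of \<open>\<gamma> t\<close>, because
  \<open>\<psi>\<close> moves the argument of every factor. Interleaved intervals, rather than
  \<open>m\<close> consecutive blocks, are what makes the \<open>m\<close> partial laws
  asymptotically equal. The second delicate point is the choice of logarithms, since relations
  between transforms determine exponents only up to multiples of 2 pi i. The transform of
  \<open>\<gamma> t\<close> has no zeros, and \<open>dom_U\<close> is convex, hence contractible and
  connected. So there is a continuous logarithm with value 0 at the origin, and continuity alone
  singles out the root \<open>exp (\<phi> u / n)\<close> as well as the additive relation between
  exponents. That substituting \<open>\<psi> t u\<close> preserves the Levy-Khintchine form rests on
  \<open>snd (\<psi> t u)\<close> being a real multiple of \<open>snd u\<close>: the Gaussian term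
  is only rescaled, and the change of the compensator is linear in \<open>snd u\<close>.\<close>

definition transform :: "(real \<times> real) measure \<Rightarrow> complex \<times> complex \<Rightarrow> complex" where
  "transform M u = (\<integral>\<xi>. exp (pairing u \<xi>) \<partial>M)"

lemma space_of_sets_borel_D: "sets M = sets borel_D \<Longrightarrow> space M = state_D"
  using sets_eq_imp_space_eq[of M borel_D] by (simp add: space_restrict_space)

lemma closed_state_D: "closed state_D"
  unfolding state_D_def by (intro closed_Times) auto

lemma state_D_borel: "state_D \<in> sets borel"
  using closed_state_D by (rule borel_closed)

lemma borel_measurable_on_D:
  assumes "sets M = sets borel_D" "f \<in> borel_measurable borel"
  shows "f \<in> borel_measurable M"
  using assms(2) measurable_cong_sets[OF assms(1) refl] measurable_restrict_space1 by blast

lemma continuous_on_D_measurable: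
  fixes f :: "real \<times> real \<Rightarrow> 'b::topological_space"
  assumes "sets M = sets borel_D" "continuous_on state_D f"
  shows "f \<in> borel_measurable M"
  using borel_measurable_continuous_on_restrict[OF assms(2)] measurable_cong_sets[OF assms(1) refl] by blast

lemma sets_borel_D_iff: "A \<in> sets borel_D \<longleftrightarrow> A \<in> sets borel \<and> A \<subseteq> state_D"
  using state_D_borel by (subst sets_restrict_space_iff) auto

lemma zero_in_state_D: "0 \<in> state_D" "(0, 0) \<in> state_D"
  by (auto simp: state_D_def zero_prod_def)

lemma zero_sets_borel_D: "{0} \<in> sets borel_D"
  using zero_in_state_D by (simp add: sets_borel_D_iff)

lemma continuous_on_pairing [continuous_intros]:
  assumes "continuous_on A f" "continuous_on A g"
  shows "continuous_on A (\<lambda>x. pairing (f x) (g x))"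
  unfolding pairing_def by (intro continuous_intros assms)

lemma tendsto_pairing [tendsto_intros]:
  assumes "(f \<longlongrightarrow> a) F" "(g \<longlongrightarrow> b) F"
  shows "((\<lambda>x. pairing (f x) (g x)) \<longlongrightarrow> pairing a b) F"
  unfolding pairing_def by (intro tendsto_intros assms)

lemma pairing_0_right [simp]: "pairing u 0 = 0"
  and pairing_0_left [simp]: "pairing 0 \<xi> = 0"
  by (auto simp: pairing_def)

lemma pairing_add_right: "pairing u (x + y) = pairing u x + pairing u y"
  by (simp add: pairing_def algebra_simps)

lemma dom_UI: "Re a \<le> 0 \<Longrightarrow> Re b = 0 \<Longrightarrow> (a, b) \<in> dom_U"
  by (simp add: dom_U_def)

lemma zero_in_dom_U [simp]: "0 \<in> dom_U" "(0, 0) \<in> dom_U"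
  by (auto simp: dom_U_def)

lemma dom_UD: "u \<in> dom_U \<Longrightarrow> Re (fst u) \<le> 0" "u \<in> dom_U \<Longrightarrow> Re (snd u) = 0"
  by (auto simp: dom_U_def)

lemma convex_dom_U: "convex dom_U"
  unfolding dom_U_def convex_def
  by (auto simp: add_nonpos_nonpos mult_nonneg_nonpos)

lemma connected_dom_U: "connected dom_U"
  using convex_dom_U by (rule convex_connected)

lemma Re_pairing_nonpos:
  assumes "u \<in> dom_U" "\<xi> \<in> state_D"
  shows "Re (pairing u \<xi>) \<le> 0"
  using dom_UD[OF assms(1)] assms(2) by (auto simp: pairing_def state_D_def mult_nonpos_nonneg)

lemma norm_exp_pairing_le:
  assumes "u \<in> dom_U" "\<xi> \<in> state_D"
  shows "norm (exp (pairing u \<xi>)) \<le> 1"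
  using Re_pairing_nonpos[OF assms] by simp

lemma exp_pairing_measurable [measurable]: "(\<lambda>\<xi>. exp (pairing u \<xi>)) \<in> borel_measurable borel"
  by (intro borel_measurable_continuous_onI continuous_intros)

lemma integrable_bounded_on_D:
  fixes f :: "real \<times> real \<Rightarrow> 'b::{banach, second_countable_topology}"
  assumes "finite_measure M" "sets M = sets borel_D" "f \<in> borel_measurable M"
    and "\<And>x. x \<in> state_D \<Longrightarrow> norm (f x) \<le> B"
  shows "integrable M f"
  using assms space_of_sets_borel_D[OF assms(2)]
  by (intro finite_measure.integrable_const_bound[where B=B] AE_I2) auto

lemma integrable_exp_pairing:
  assumes "finite_measure M" "sets M = sets borel_D" "u \<in> dom_U"
  shows "integrable M (\<lambda>\<xi>. exp (pairing u \<xi>))"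
  using assms norm_exp_pairing_le
  by (intro integrable_bounded_on_D[where B=1] borel_measurable_on_D[OF assms(2)]) auto

lemma prob_algebra_D:
  assumes "M \<in> space (prob_algebra borel_D)"
  shows "prob_space M" "sets M = sets borel_D" "finite_measure M"
  using assms by (auto simp: space_prob_algebra intro: prob_space.finite_measure)

lemma norm_transform_le_1:
  assumes "M \<in> space (prob_algebra borel_D)" "u \<in> dom_U"
  shows "norm (transform M u) \<le> 1"
proof -
  interpret prob_space M using prob_algebra_D[OF assms(1)] by simp
  have "norm (transform M u) \<le> (\<integral>\<xi>. norm (exp (pairing u \<xi>)) \<partial>M)"
    unfolding transform_def by (rule integral_norm_bound)
  also have "\<dots> \<le> (\<integral>\<xi>. 1 \<partial>M)"
    using integrable_norm[OF integrable_exp_pairing[OF finite_measure_axioms prob_algebra_D(2)[OF assms(1)] assms(2)]]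
      norm_exp_pairing_le[OF assms(2)] space_of_sets_borel_D[OF prob_algebra_D(2)[OF assms(1)]]
    by (intro integral_mono) (auto simp del: norm_exp_eq_Re)
  finally show ?thesis by (simp add: prob_space)
qed

lemma transform_0:
  assumes "M \<in> space (prob_algebra borel_D)"
  shows "transform M 0 = 1"
  using prob_space.prob_space[OF prob_algebra_D(1)[OF assms]] by (simp add: transform_def)

lemma continuous_on_transform:
  assumes "finite_measure M" "sets M = sets borel_D"
  shows "continuous_on dom_U (transform M)"
  unfolding continuous_on_sequentially comp_def
proof (intro allI ballI impI)
  fix x a assume a: "a \<in> dom_U" and x: "(\<forall>n. x n \<in> dom_U) \<and> x \<longlonglongrightarrow> a"
  interpret finite_measure M by fact
  show "(\<lambda>n. transform M (x n)) \<longlonglongrightarrow> transform M a"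
    unfolding transform_def
  proof (rule integral_dominated_convergence[where w="\<lambda>_. 1"])
    show "AE \<xi> in M. (\<lambda>n. exp (pairing (x n) \<xi>)) \<longlonglongrightarrow> exp (pairing a \<xi>)"
      using x by (intro AE_I2 tendsto_intros) auto
    show "AE \<xi> in M. norm (exp (pairing (x n) \<xi>)) \<le> 1" for n
      using x norm_exp_pairing_le space_of_sets_borel_D[OF assms(2)] by (intro AE_I2) auto
  qed (auto intro!: borel_measurable_on_D[OF assms(2)])
qed

lemma Times_borel: "A \<in> sets borel \<Longrightarrow> B \<in> sets borel \<Longrightarrow> A \<times> B \<in> sets (borel :: (real \<times> real) measure)"
  unfolding borel_prod[symmetric] by (rule pair_measureI)

lemma finite_measure_density_le:
  assumes "finite_measure M" and h: "h \<in> borel_measurable M" and le: "\<And>x. x \<in> space M \<Longrightarrow> h x \<le> ennreal B"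
  shows "finite_measure (density M h)"
proof (rule finite_measureI)
  interpret finite_measure M by fact
  have "emeasure (density M h) (space M) = (\<integral>\<^sup>+x. h x \<partial>M)"
    using h by (simp add: emeasure_density cong: nn_integral_cong)
  also have "\<dots> \<le> (\<integral>\<^sup>+x. ennreal B \<partial>M)"
    by (intro nn_integral_mono le)
  also have "\<dots> < \<infinity>"
    by (simp add: ennreal_mult_eq_top_iff less_top[symmetric])
  finally show "emeasure (density M h) (space (density M h)) \<noteq> \<infinity>"
    by simp
qed

text \<open>At 0 the characteristic function is the total mass. The two masses therefore agree, and
  normalizing by the common value reduces the claim to uniqueness for probability laws.\<close>

lemma finite_measure_real_eqI:
  fixes M N :: "real measure"
  assumes M: "finite_measure M" "sets M = sets borel" and N: "finite_measure N" "sets N = sets borel"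
    and eq: "\<And>t. char M t = char N t"
  shows "M = N"
proof -
  interpret M: finite_measure M by fact
  interpret N: finite_measure N by fact
  have sp: "space M = UNIV" "space N = UNIV"
    using sets_eq_imp_space_eq[OF M(2)] sets_eq_imp_space_eq[OF N(2)] by auto
  have "complex_of_real (measure M UNIV) = measure N UNIV"
    using eq[of 0] sp by (simp add: char_def)
  then have mass: "measure M UNIV = measure N UNIV" by simp
  define c where "c = measure M UNIV"
  show ?thesis
  proof (cases "c = 0")
    case True
    have "emeasure M A = 0" "emeasure N A = 0" for A
      using True mass M.bounded_measure[of A] N.bounded_measure[of A] sp
      by (auto simp: M.emeasure_eq_measure N.emeasure_eq_measure c_def order_antisym)
    then show ?thesis by (intro measure_eqI) (auto simp: M N)
  next
    case False
    then have c: "c > 0" by (simp add: c_def order_less_le)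
    define S where "S L = density L (\<lambda>_. ennreal (1 / c))" for L :: "real measure"
    have S: "real_distribution (S L)" if "finite_measure L" "sets L = sets borel" "measure L UNIV = c" for L
    proof -
      interpret L: finite_measure L by fact
      have "space L = UNIV" using sets_eq_imp_space_eq[OF that(2)] by simp
      then have "emeasure (S L) (space (S L)) = 1"
        using c that(3) by (simp add: S_def emeasure_density_const that(2) L.emeasure_eq_measure
            ennreal_mult[symmetric])
      then show ?thesis
        by (intro real_distribution.intro prob_spaceI real_distribution_axioms.intro) (auto simp: S_def that)
    qed
    have ch: "char (S L) t = char L t / c" if "sets L = sets borel" for L t
      using c that unfolding S_def char_def
      by (subst integral_density) (auto simp: scaleR_conv_of_real cong: measurable_cong_sets)
    have "S M = S N"
      using mass by (intro Levy_uniqueness S M N ext) (auto simp: ch M N eq c_def)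
    then have "density (S M) (\<lambda>_. ennreal c) = density (S N) (\<lambda>_. ennreal c)" by simp
    moreover have "density (S L) (\<lambda>_. ennreal c) = L" for L
      using c by (auto simp: S_def density_density_eq ennreal_mult[symmetric] density_1 one_ennreal_def[symmetric])
    ultimately show ?thesis by simp
  qed
qed

text \<open>One-dimensional uniqueness is applied in each variable in turn. In the first variable the complex
  measure \<open>e\<^sup>i\<^sup>t\<^sup>y M(dx, dy)\<close> is recovered from the nonnegative measures with densities \<open>1 + cos (t y)\<close>
  and \<open>1 + sin (t y)\<close>.\<close>

lemma finite_measure_D_eqI:
  assumes M: "finite_measure M" "sets M = sets borel_D" and N: "finite_measure N" "sets N = sets borel_D"
    and eq: "\<And>u. u \<in> dom_U \<Longrightarrow> transform M u = transform N u"
  shows "M = N"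
proof -
  let ?D = "\<lambda>L. finite_measure L \<and> sets L = sets borel_D"
  have meas: "f \<in> borel_measurable L" if "?D L" "f \<in> borel_measurable borel" for L and f :: "real \<times> real \<Rightarrow> 'c::topological_space"
    using that borel_measurable_on_D by blast
  have fst_m: "fst \<in> L \<rightarrow>\<^sub>M borel" "snd \<in> L \<rightarrow>\<^sub>M borel" if "?D L" for L :: "(real \<times> real) measure"
    using that by (auto intro!: meas borel_measurable_continuous_onI continuous_intros)
  have iexp: "iexp x = cos x + \<i> * sin x" for x :: real
    by (simp add: cis_conv_exp[symmetric] complex_eq_iff)
  \<comment> \<open>Arguments with two imaginary components lie in \<open>dom_U\<close>, so the
    Fourier transforms of the two measures agree.\<close>
  have tr: "(\<integral>\<xi>. iexp (s * fst \<xi>) * iexp (t * snd \<xi>) \<partial>M) = (\<integral>\<xi>. iexp (s * fst \<xi>) * iexp (t * snd \<xi>) \<partial>N)" for s t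
    using eq[of "(\<i> * s, \<i> * t)"]
    by (simp add: transform_def pairing_def dom_UI exp_add[symmetric] algebra_simps)
  \<comment> \<open>The added 1 makes the densities nonnegative; every index other than 0 and 1, in
    practice 2, stands for the constant density 1, which is subtracted again in
    \<open>charJ\<close>.\<close>
  define h :: "nat \<Rightarrow> real \<Rightarrow> real \<Rightarrow> real"
    where "h k t y = (if k = 0 then 1 + cos (t * y) else if k = 1 then 1 + sin (t * y) else 1)" for k t y
  have h_nn: "0 \<le> h k t y" and h_le: "h k t y \<le> 2" for k t y
    by (auto simp: h_def) (smt (verit) cos_ge_minus_one sin_ge_minus_one)+
  have h_meas: "(\<lambda>\<xi>::real\<times>real. h k t (snd \<xi>)) \<in> borel_measurable borel" for k t
    unfolding h_def by (intro borel_measurable_continuous_onI; cases "k = 0"; cases "k = 1") (auto intro!: continuous_intros)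
  have h_exp: "complex_of_real (h k t y) = (if k = 0 then 1 + (iexp (t * y) + iexp (- t * y)) / 2
      else if k = 1 then 1 + (iexp (t * y) - iexp (- t * y)) / (2 * \<i>) else 1)" for k t y
  proof -
    have "iexp (- t * y) = cos (t * y) - \<i> * sin (t * y)"
      using iexp[of "- t * y"] by simp
    then show ?thesis using iexp[of "t * y"] by (simp add: h_def field_simps)
  qed
  define K where "K k t L = distr (density L (\<lambda>\<xi>. ennreal (h k t (snd \<xi>)))) borel fst" for k t and L :: "(real \<times> real) measure"
  have K_fin: "finite_measure (K k t L)" if L: "?D L" for k t L
  proof -
    have "finite_measure (density L (\<lambda>\<xi>. ennreal (h k t (snd \<xi>))))"
      using L measurable_compose[OF meas[OF L h_meas] measurable_ennreal] h_le
      by (intro finite_measure_density_le[where B=2]) (auto simp del: ennreal_numeral intro!: ennreal_leI)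
    then show ?thesis
      unfolding K_def using fst_m[OF L] by (intro finite_measure.finite_measure_distr) auto
  qed
  have int: "integrable L (\<lambda>\<xi>. iexp (s * fst \<xi>) * iexp (t * snd \<xi>))" if L: "?D L" for L s t
    using integrable_exp_pairing[of L "(\<i> * s, \<i> * t)"] that
    by (simp add: pairing_def dom_UI exp_add[symmetric] algebra_simps)
  have charK: "char (K k t L) s = (if k = 0 then (\<integral>\<xi>. iexp (s * fst \<xi>) * iexp (0 * snd \<xi>) \<partial>L) +
        ((\<integral>\<xi>. iexp (s * fst \<xi>) * iexp (t * snd \<xi>) \<partial>L) + (\<integral>\<xi>. iexp (s * fst \<xi>) * iexp ((-t) * snd \<xi>) \<partial>L)) / 2
      else if k = 1 then (\<integral>\<xi>. iexp (s * fst \<xi>) * iexp (0 * snd \<xi>) \<partial>L) +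
        ((\<integral>\<xi>. iexp (s * fst \<xi>) * iexp (t * snd \<xi>) \<partial>L) - (\<integral>\<xi>. iexp (s * fst \<xi>) * iexp ((-t) * snd \<xi>) \<partial>L)) / (2 * \<i>)
      else (\<integral>\<xi>. iexp (s * fst \<xi>) * iexp (0 * snd \<xi>) \<partial>L))" if L: "?D L" for k t L s
  proof -
    have "char (K k t L) s = (\<integral>\<xi>. h k t (snd \<xi>) *\<^sub>R iexp (s * fst \<xi>) \<partial>L)"
      unfolding K_def char_def using fst_m[OF L]
      by (subst integral_distr) (auto simp: integral_density h_nn meas[OF L] h_meas)
    also have "\<dots> = (\<integral>\<xi>. (if k = 0 then iexp (s * fst \<xi>) * iexp (0 * snd \<xi>) +
        (iexp (s * fst \<xi>) * iexp (t * snd \<xi>) + iexp (s * fst \<xi>) * iexp ((-t) * snd \<xi>)) / 2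
      else if k = 1 then iexp (s * fst \<xi>) * iexp (0 * snd \<xi>) +
        (iexp (s * fst \<xi>) * iexp (t * snd \<xi>) - iexp (s * fst \<xi>) * iexp ((-t) * snd \<xi>)) / (2 * \<i>)
      else iexp (s * fst \<xi>) * iexp (0 * snd \<xi>)) \<partial>L)"
      by (intro Bochner_Integration.integral_cong refl) (simp add: scaleR_conv_of_real h_exp algebra_simps add_divide_distrib diff_divide_distrib)
    finally show ?thesis
      using int[OF L, of s 0] int[OF L, of s t] int[OF L, of s "-t"] by auto
  qed
  have K_eq: "K k t M = K k t N" for k t
  proof (rule finite_measure_real_eqI)
    show "char (K k t M) s = char (K k t N) s" for s
      using M N by (simp only: charK tr)
  qed (use M N K_fin in \<open>auto simp: K_def\<close>)
  have inth: "(\<integral>\<xi>. indicator A (fst \<xi>) * h k t (snd \<xi>) \<partial>L) = measure (K k t L) A" if L: "?D L" and A: "A \<in> sets borel" for A k t L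
  proof -
    interpret K: finite_measure "K k t L" using K_fin[OF L] .
    have "measure (K k t L) A = (\<integral>x. indicator A x \<partial>K k t L)"
      using A by (simp add: K_def)
    also have "\<dots> = (\<integral>\<xi>. h k t (snd \<xi>) *\<^sub>R indicator A (fst \<xi>) \<partial>L)"
      unfolding K_def using fst_m[OF L] A
      by (subst integral_distr) (auto simp: integral_density h_nn meas[OF L] h_meas intro!: integral_density)
    finally show ?thesis by (simp add: mult.commute)
  qed
  have h_eq: "(\<integral>\<xi>. indicator A (fst \<xi>) * h k t (snd \<xi>) \<partial>M) = (\<integral>\<xi>. indicator A (fst \<xi>) * h k t (snd \<xi>) \<partial>N)"
    if "A \<in> sets borel" for A k t
    using M N that by (simp add: inth K_eq)
  \<comment> \<open>With the set \<open>A\<close> for the first coordinate fixed, this is the second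
    marginal of \<open>L\<close> restricted to that set. Its characteristic function involves only
    integrals that \<open>h_eq\<close> has shown to agree.\<close>
  define J where "J A L = distr (density L (\<lambda>\<xi>. indicator A (fst \<xi>))) borel snd" for A and L :: "(real \<times> real) measure"
  have indA: "(\<lambda>\<xi>. indicator A (fst \<xi>) :: 'c :: {zero_neq_one, topological_space}) \<in> borel_measurable L" if L: "?D L" and A: "A \<in> sets borel" for A L
    using A fst_m[OF L] by (simp add: measurable_compose[OF _ borel_measurable_indicator])
  have J_fin: "finite_measure (J A L)" if L: "?D L" and A: "A \<in> sets borel" for A L
  proof -
    have "finite_measure (density L (\<lambda>\<xi>. indicator A (fst \<xi>)))"
      using L by (intro finite_measure_density_le[where B=1]) (auto simp: indA[OF L A] split: split_indicator)
    then show ?thesis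
      unfolding J_def using fst_m[OF L] by (intro finite_measure.finite_measure_distr) auto
  qed
  have charJ: "char (J A L) t = (complex_of_real (\<integral>\<xi>. indicator A (fst \<xi>) * h 0 t (snd \<xi>) \<partial>L) - of_real (\<integral>\<xi>. indicator A (fst \<xi>) * h 2 t (snd \<xi>) \<partial>L))
      + \<i> * (of_real (\<integral>\<xi>. indicator A (fst \<xi>) * h 1 t (snd \<xi>) \<partial>L) - of_real (\<integral>\<xi>. indicator A (fst \<xi>) * h 2 t (snd \<xi>) \<partial>L))"
    if L: "?D L" and A: "A \<in> sets borel" for A L t
  proof -
    have "integrable L (\<lambda>\<xi>. indicator A (fst \<xi>) * h k t (snd \<xi>))" for k
      using L h_nn h_le A
      by (intro integrable_bounded_on_D[where B=2] borel_measurable_times indA[OF L A] meas[OF L h_meas])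
        (auto simp: abs_mult split: split_indicator)
    then have i: "integrable L (\<lambda>\<xi>. complex_of_real (indicator A (fst \<xi>) * h k t (snd \<xi>)))" for k
      by (rule integrable_of_real)
    have "char (J A L) t = (\<integral>\<xi>. indicator A (fst \<xi>) *\<^sub>R iexp (t * snd \<xi>) \<partial>L)"
      unfolding J_def char_def using fst_m[OF L] A
      by (subst integral_distr) (auto simp: ennreal_indicator[symmetric] integral_density meas[OF L] indA[OF L A] intro!: integral_density)
    also have "\<dots> = (\<integral>\<xi>. (complex_of_real (indicator A (fst \<xi>) * h 0 t (snd \<xi>)) - complex_of_real (indicator A (fst \<xi>) * h 2 t (snd \<xi>)))
        + \<i> * (complex_of_real (indicator A (fst \<xi>) * h 1 t (snd \<xi>)) - complex_of_real (indicator A (fst \<xi>) * h 2 t (snd \<xi>))) \<partial>L)"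
      by (intro Bochner_Integration.integral_cong refl) (auto simp: iexp h_def scaleR_conv_of_real simp del: of_real_mult split: split_indicator)
    finally show ?thesis
      using i[of 0] i[of 1] i[of 2] by (simp del: of_real_mult)
  qed
  have J_eq: "J A M = J A N" if "A \<in> sets borel" for A
  proof (rule finite_measure_real_eqI)
    show "char (J A M) s = char (J A N) s" for s
      using M N that by (simp only: charJ h_eq)
  qed (use M N that J_fin in \<open>auto simp: J_def\<close>)
  have rect: "emeasure L ((A \<times> B) \<inter> state_D) = emeasure (J A L) B" if L: "?D L" and A: "A \<in> sets borel" and B: "B \<in> sets borel" for A B L
  proof -
    have sp: "space L = state_D" using L space_of_sets_borel_D by blast
    have AB: "(A \<times> B) \<inter> state_D \<in> sets L"
      using Times_borel[OF A B] L state_D_borel sets_borel_D_iff by blast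
    have "emeasure (J A L) B = (\<integral>\<^sup>+\<xi>. indicator A (fst \<xi>) * indicator (snd -` B \<inter> space L) \<xi> \<partial>L)"
      unfolding J_def using fst_m[OF L] A B
      by (subst emeasure_distr) (auto simp: emeasure_density indA[OF L A])
    also have "\<dots> = (\<integral>\<^sup>+\<xi>. indicator ((A \<times> B) \<inter> state_D) \<xi> \<partial>L)"
      by (intro nn_integral_cong) (auto simp: sp split: split_indicator)
    finally show ?thesis using AB by simp
  qed
  \<comment> \<open>Transport to the whole plane, where the rectangles are a generator stable under
    intersection.\<close>
  define E where "E L = distr L (borel \<Otimes>\<^sub>M borel) (\<lambda>x. x)" for L :: "(real \<times> real) measure"
  have idm: "(\<lambda>x. x) \<in> L \<rightarrow>\<^sub>M (borel \<Otimes>\<^sub>M borel)" if "?D L" for L :: "(real \<times> real) measure"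
    unfolding borel_prod by (rule meas[OF that measurable_ident, unfolded id_def])
  have Eem: "emeasure (E L) C = emeasure L (C \<inter> state_D)" if "?D L" "C \<in> sets borel" for C L
    using that(2) space_of_sets_borel_D[of L] that(1) emeasure_distr[OF idm[OF that(1)], of C]
    unfolding E_def borel_prod by simp
  have "E M = E N"
  proof (rule measure_eqI_generator_eq[where E="{A \<times> B | A B. A \<in> sets borel \<and> B \<in> sets (borel :: real measure)}" and \<Omega>=UNIV and A="\<lambda>_. UNIV"])
    show "Int_stable {A \<times> B | A B. A \<in> sets (borel :: real measure) \<and> B \<in> sets (borel :: real measure)}"
      by (rule Int_stable_pair_measure_generator)
    have "sets (borel \<Otimes>\<^sub>M borel :: (real \<times> real) measure) = sigma_sets UNIV {A \<times> B | A B. A \<in> sets borel \<and> B \<in> sets borel}"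
      by (subst sets_pair_measure) (simp only: space_borel UNIV_Times_UNIV)
    then show "sets (E M) = sigma_sets UNIV {A \<times> B | A B. A \<in> sets (borel :: real measure) \<and> B \<in> sets (borel :: real measure)}"
      "sets (E N) = sigma_sets UNIV {A \<times> B | A B. A \<in> sets (borel :: real measure) \<and> B \<in> sets (borel :: real measure)}"
      unfolding E_def sets_distr by blast+
    show "range (\<lambda>_. UNIV) \<subseteq> {A \<times> B | A B. A \<in> sets (borel :: real measure) \<and> B \<in> sets (borel :: real measure)}"
      using space_in_borel[where 'a=real] UNIV_Times_UNIV[where 'a=real and 'b=real] by (intro image_subsetI CollectI exI conjI) (rule sym)
    show "emeasure (E M) UNIV \<noteq> \<infinity>"
      using M finite_measure.emeasure_finite[of M] by (simp add: Eem)
    fix X assume "X \<in> {A \<times> B | A B. A \<in> sets (borel :: real measure) \<and> B \<in> sets (borel :: real measure)}"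
    then obtain A B where X: "X = A \<times> B" "A \<in> sets borel" "B \<in> sets borel" by auto
    then have "X \<in> sets borel" using Times_borel by blast
    then show "emeasure (E M) X = emeasure (E N) X"
      using M N X by (simp add: Eem rect J_eq)
  qed auto
  show ?thesis
  proof (rule measure_eqI)
    fix A assume "A \<in> sets M"
    then have "A \<in> sets borel" "A \<inter> state_D = A" using M sets_borel_D_iff by auto
    then show "emeasure M A = emeasure N A"
      using Eem[of M A] Eem[of N A] M N \<open>E M = E N\<close> by simp
  qed (simp add: M N)
qed

section \<open>Sums of measures\<close>

text \<open>Space and sets come from the first summand; the second is meant to live on the same
  sigma-algebra. The sum serves to add an atom to a finite measure and to assemble the Levy measure
  at time \<open>r + t\<close>.\<close>

definition add_measure :: "'a measure \<Rightarrow> 'a measure \<Rightarrow> 'a measure" where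
  "add_measure M N = measure_of (space M) (sets M) (\<lambda>A. emeasure M A + emeasure N A)"

lemma sets_add_measure [simp, measurable_cong]: "sets (add_measure M N) = sets M"
  and space_add_measure [simp]: "space (add_measure M N) = space M"
  by (auto simp: add_measure_def)

lemma emeasure_add_measure:
  assumes "sets N = sets M" "A \<in> sets M"
  shows "emeasure (add_measure M N) A = emeasure M A + emeasure N A"
  unfolding add_measure_def
proof (rule emeasure_measure_of_sigma)
  show "countably_additive (sets M) (\<lambda>A. emeasure M A + emeasure N A)"
    using assms(1) by (intro countably_additiveI) (auto simp: suminf_add[symmetric] suminf_emeasure)
qed (use assms in \<open>auto simp: positive_def sets.sigma_algebra_axioms\<close>)

lemma nn_integral_add_measure:
  assumes N: "sets N = sets M" and f: "f \<in> borel_measurable M"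
  shows "(\<integral>\<^sup>+x. f x \<partial>add_measure M N) = (\<integral>\<^sup>+x. f x \<partial>M) + (\<integral>\<^sup>+x. f x \<partial>N)"
  using f
proof induct
  case (cong f g)
  moreover have sp: "space N = space M" using N by (rule sets_eq_imp_space_eq)
  moreover have "(\<integral>\<^sup>+x. f x \<partial>L) = (\<integral>\<^sup>+x. g x \<partial>L)" if "space L = space M" for L
    using cong that by (intro nn_integral_cong) auto
  ultimately show ?case by simp
next
  case (set A)
  with N show ?case by (simp add: emeasure_add_measure)
next
  case (mult u c)
  then have [measurable]: "u \<in> borel_measurable N" using N by (simp cong: measurable_cong_sets)
  from mult show ?case by (simp add: nn_integral_cmult distrib_left)
next
  case (add u v)
  then have [measurable]: "u \<in> borel_measurable N" "v \<in> borel_measurable N" using N by (simp_all cong: measurable_cong_sets)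
  from add show ?case by (simp add: nn_integral_add ac_simps)
next
  case (seq U)
  then have [measurable]: "\<And>i. U i \<in> borel_measurable N" using N by (simp cong: measurable_cong_sets)
  have "(\<integral>\<^sup>+x. (SUP i. U i) x \<partial>L) = (SUP i. \<integral>\<^sup>+x. U i x \<partial>L)" if "\<And>i. U i \<in> borel_measurable L" for L
    using that seq by (simp add: nn_integral_monotone_convergence_SUP image_comp)
  moreover have "(SUP i. (\<integral>\<^sup>+x. U i x \<partial>M) + (\<integral>\<^sup>+x. U i x \<partial>N)) = (SUP i. \<integral>\<^sup>+x. U i x \<partial>M) + (SUP i. \<integral>\<^sup>+x. U i x \<partial>N)"
    using seq by (intro ennreal_SUP_add incseq_nn_integral) auto
  ultimately show ?case using seq by (simp cong: measurable_cong_sets)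
qed

lemma finite_measure_add_measure:
  assumes "finite_measure M" "finite_measure N" "sets N = sets M"
  shows "finite_measure (add_measure M N)"
  using assms finite_measure.emeasure_finite
  by (intro finite_measureI) (auto simp: emeasure_add_measure)

lemma integrable_add_measure_iff:
  fixes f :: "'a \<Rightarrow> 'b::{banach, second_countable_topology}"
  assumes N: "sets N = sets M"
  shows "integrable (add_measure M N) f \<longleftrightarrow> integrable M f \<and> integrable N f"
proof (cases "f \<in> borel_measurable M")
  case True
  moreover from True have "f \<in> borel_measurable N" "f \<in> borel_measurable (add_measure M N)" 
    using N by (simp_all cong: measurable_cong_sets)
  ultimately show ?thesis
    by (simp add: integrable_iff_bounded nn_integral_add_measure[OF N])
next
  case False
  then show ?thesis by (auto cong: measurable_cong_sets dest: borel_measurable_integrable)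
qed

lemma integral_add_measure_real:
  fixes f :: "'a \<Rightarrow> real"
  assumes N: "sets N = sets M" and f: "integrable M f" "integrable N f"
  shows "(\<integral>x. f x \<partial>add_measure M N) = (\<integral>x. f x \<partial>M) + (\<integral>x. f x \<partial>N)"
proof -
  have fin: "(\<integral>\<^sup>+x. ennreal (f x) \<partial>L) < \<infinity>" "(\<integral>\<^sup>+x. ennreal (- f x) \<partial>L) < \<infinity>" if "integrable L f" for L
    using that by (auto simp: real_integrable_def less_top[symmetric])
  have m: "f \<in> borel_measurable M" using f by auto
  show ?thesis
    using f fin[OF f(1)] fin[OF f(2)] m integrable_add_measure_iff[OF N, of f]
    by (simp add: real_lebesgue_integral_def nn_integral_add_measure[OF N] enn2real_plus)
qed

lemma integral_add_measure:
  fixes f :: "'a \<Rightarrow> complex"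
  assumes N: "sets N = sets M" and f: "integrable M f" "integrable N f"
  shows "(\<integral>x. f x \<partial>add_measure M N) = (\<integral>x. f x \<partial>M) + (\<integral>x. f x \<partial>N)"
proof -
  have "integrable (add_measure M N) f" using f integrable_add_measure_iff[OF N] by blast
  then show ?thesis
    using f integral_add_measure_real[OF N, of "\<lambda>x. Re (f x)"] integral_add_measure_real[OF N, of "\<lambda>x. Im (f x)"]
    by (simp add: complex_eq_iff integral_Re[symmetric] integral_Im[symmetric] del: integral_Re integral_Im)
qed

section \<open>Weak compactness\<close>

text \<open>Tight sequences of measures on the half-plane are coded as measures on the line, where Helly's theorem
  applies. The binary digits of both coordinates are merged into base-8 digits that are at most \<open>3\<close>, and
  the integer parts into the (unbounded) leading digit. Expansions with digits at most \<open>3\<close> are separated by gaps,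
  so decoding is uniformly continuous on the range of the code and extends to a continuous function on
  the line.\<close>

lemma digits_eq_of_close:
  fixes d d' :: "nat \<Rightarrow> nat"
  assumes d: "\<And>k. 1 \<le> k \<Longrightarrow> d k \<le> 3" and d': "\<And>k. 1 \<le> k \<Longrightarrow> d' k \<le> 3"
    and close: "\<bar>(\<Sum>k. real (d k) * (1/8)^k) - (\<Sum>k. real (d' k) * (1/8)^k)\<bar> < (1/8)^K / 2"
    and "k \<le> K"
  shows "d k = d' k"
proof (rule ccontr)
  assume "d k \<noteq> d' k"
  \<comment> \<open>At the first index \<open>j\<close> where the digits differ the term has modulus
    at least \<open>(1/8)^j\<close>, and all later terms together have at most
    \<open>3/7 * (1/8)^j\<close>. The remaining \<open>4/7\<close> exceeds the \<open>1/2\<close> of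
    the hypothesis.\<close>
  define j where "j = (LEAST j. d j \<noteq> d' j)"
  have dj: "d j \<noteq> d' j" unfolding j_def by (rule LeastI) fact
  have "j \<le> k" unfolding j_def by (rule Least_le) fact
  with \<open>k \<le> K\<close> have "j \<le> K" by simp
  have lt: "d i = d' i" if "i < j" for i using not_less_Least that unfolding j_def by blast
  have geo: "summable (\<lambda>k. 3 * (1/8)^(k+j+1) :: real)"
    by (intro summable_mult summable_ignore_initial_segment[of "\<lambda>k. (1/8)^(k+1)" j] summable_geometric)
       (simp add: summable_geometric summable_mult)
  have sm: "summable (\<lambda>k. real (e k) * (1/8)^k)" if e: "\<And>k. 1 \<le> k \<Longrightarrow> e k \<le> 3" for e :: "nat \<Rightarrow> nat"
  proof -
    have "summable (\<lambda>k. 3 * (1/8)^k :: real)" by (auto intro!: summable_mult summable_geometric)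
    then show ?thesis
    proof (rule summable_comparison_test[rotated], intro exI allI impI)
      fix n :: nat assume "1 \<le> n"
      then have "real (e n) \<le> 3" using e by fastforce
      then show "norm (real (e n) * (1 / 8) ^ n) \<le> 3 * (1 / 8) ^ n"
        by (simp add: divide_right_mono)
    qed
  qed
  define e where "e k = (real (d k) - real (d' k)) * (1/8)^k" for k
  have "summable e" unfolding e_def left_diff_distrib by (intro summable_diff sm d d')
  have "(\<Sum>k. real (d k) * (1/8)^k) - (\<Sum>k. real (d' k) * (1/8)^k) = (\<Sum>k. e k)"
    unfolding e_def left_diff_distrib by (intro suminf_diff sm d d')
  also have "\<dots> = (\<Sum>k. e (k + (j+1))) + (\<Sum>k<j+1. e k)"
    using \<open>summable e\<close> by (rule suminf_split_initial_segment)
  also have "(\<Sum>k<j+1. e k) = e j"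
    using lt by (simp add: e_def)
  finally have eq: "(\<Sum>k. real (d k) * (1/8)^k) - (\<Sum>k. real (d' k) * (1/8)^k) = (\<Sum>k. e (k + (j+1))) + e j" .
  have "\<bar>\<Sum>k. e (k + (j+1))\<bar> \<le> (\<Sum>k. 3 * (1/8)^(k+j+1))"
  proof (rule norm_suminf_le[of "\<lambda>k. e (k + (j+1))", unfolded real_norm_def, OF _ geo])
    fix n
    have "d (n+(j+1)) \<le> 3" "d' (n+(j+1)) \<le> 3" using d d' by auto
    then have "\<bar>real (d (n+(j+1))) - real (d' (n+(j+1)))\<bar> \<le> 3" by linarith
    then have "\<bar>real (d (n+(j+1))) - real (d' (n+(j+1)))\<bar> * (1/8)^(n+(j+1)) \<le> 3 * (1/8)^(n+(j+1))"
      by (intro mult_right_mono) auto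
    then show "\<bar>e (n + (j+1))\<bar> \<le> 3 * (1/8)^(n+j+1)"
      by (simp add: e_def abs_mult power_abs)
  qed
  also have "\<dots> = 3 / 7 * (1/8)^j"
  proof -
    have "(\<Sum>k. 3 * (1/8)^(k+j+1) :: real) = (\<Sum>k. (3 * (1/8)^(j+1)) * (1/8)^k)"
      by (simp add: power_add algebra_simps)
    also have "\<dots> = (3 * (1/8)^(j+1)) * (1 / (1 - 1/8))"
      by (subst suminf_mult) (auto simp: suminf_geometric summable_geometric)
    finally show ?thesis by (simp add: field_simps)
  qed
  finally have tail: "\<bar>\<Sum>k. e (k + (j+1))\<bar> \<le> 3 / 7 * (1/8)^j" .
  have "1 \<le> \<bar>real (d j) - real (d' j)\<bar>" using dj by linarith
  then have "1 * (1/8)^j \<le> \<bar>real (d j) - real (d' j)\<bar> * (1/8)^j"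
    by (intro mult_right_mono) auto
  then have "(1/8)^j \<le> \<bar>e j\<bar>" by (simp add: e_def abs_mult power_abs)
  then have "4/7 * (1/8)^j \<le> \<bar>(\<Sum>k. e (k + (j+1))) + e j\<bar>"
    using tail by linarith
  moreover have "(1/8::real)^K \<le> (1/8)^j" using \<open>j \<le> K\<close> by (intro power_decreasing) auto
  moreover have "(0::real) < (1/8)^j" by simp
  ultimately show False using close unfolding eq by linarith
qed

text \<open>Rounding is downwards, so negative coordinates also split into an integer part and a
  fractional part in \<open>[0, 1)\<close> with ordinary binary digits.\<close>

definition digit :: "nat \<Rightarrow> real \<times> real \<Rightarrow> nat" where
  "digit k p = (if k = 0 then prod_encode (int_encode \<lfloor>fst p\<rfloor>, int_encode \<lfloor>snd p\<rfloor>)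
     else nat (\<lfloor>2^k * fst p\<rfloor> mod 2) + 2 * nat (\<lfloor>2^k * snd p\<rfloor> mod 2))"

definition code :: "real \<times> real \<Rightarrow> real" where
  "code p = (\<Sum>k. real (digit k p) * (1/8)^k)"

lemma digit_le: "1 \<le> k \<Longrightarrow> digit k p \<le> 3"
proof -
  assume "1 \<le> k"
  have "nat (i mod 2) + 2 * nat (j mod 2) \<le> 3" for i j :: int by auto
  with \<open>1 \<le> k\<close> show ?thesis unfolding digit_def by (simp only: not_one_le_zero if_False split: if_split) auto
qed

text \<open>Passing from \<open>K\<close> to \<open>Suc K\<close> doubles the floor and adds one
  bit; a digit determines the bits of both coordinates because each of them is at most 1.\<close>

lemma floor_eq_of_digits:
  assumes "\<And>k. k \<le> K \<Longrightarrow> digit k p = digit k q"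
  shows "\<lfloor>2^K * fst p\<rfloor> = \<lfloor>2^K * fst q\<rfloor> \<and> \<lfloor>2^K * snd p\<rfloor> = \<lfloor>2^K * snd q\<rfloor>"
  using assms
proof (induction K)
  case 0
  have "(int_encode \<lfloor>fst p\<rfloor>, int_encode \<lfloor>snd p\<rfloor>) = (int_encode \<lfloor>fst q\<rfloor>, int_encode \<lfloor>snd q\<rfloor>)"
    using 0[of 0] inj_prod_encode[of UNIV] unfolding digit_def by (simp add: inj_def)
  then show ?case using inj_int_encode[of UNIV] by (auto simp: inj_def)
next
  case (Suc K)
  have half: "\<lfloor>2^Suc K * x\<rfloor> div 2 = \<lfloor>2^K * x\<rfloor>" for x :: real
  proof -
    have "2^Suc K * x / real_of_int 2 = 2^K * x" by simp
    then show ?thesis by (metis floor_divide_real_eq_div zero_le_numeral)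
  qed
  have split: "\<lfloor>2^Suc K * x\<rfloor> = 2 * \<lfloor>2^K * x\<rfloor> + \<lfloor>2^Suc K * x\<rfloor> mod 2" for x :: real
    using mult_div_mod_eq[of 2 "\<lfloor>2^Suc K * x\<rfloor>"] unfolding half by (rule sym)
  define b where "b x = nat (\<lfloor>2^Suc K * x\<rfloor> mod 2)" for x :: real
  have bl: "b x \<le> 1" and bi: "\<lfloor>2^Suc K * x\<rfloor> mod 2 = int (b x)" for x
  proof -
    have "nat (i mod 2) \<le> 1" "i mod 2 = int (nat (i mod 2))" for i :: int by auto
    then show "b x \<le> 1" "\<lfloor>2^Suc K * x\<rfloor> mod 2 = int (b x)" unfolding b_def by blast+
  qed
  have "b (fst p) + 2 * b (snd p) = b (fst q) + 2 * b (snd q)"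
    using Suc.prems[OF order_refl] unfolding b_def by (simp only: digit_def nat.distinct(2) if_False)
  moreover have "a = c \<and> b = d" if "a \<le> 1" "b \<le> 1" "c \<le> 1" "d \<le> 1" "a + 2 * b = c + 2 * d" for a b c d :: nat
    using that by arith
  ultimately have b: "b (fst p) = b (fst q)" "b (snd p) = b (snd q)"
    using bl by blast+
  have split: "\<lfloor>2^Suc K * x\<rfloor> = 2 * \<lfloor>2^K * x\<rfloor> + int (b x)" for x
    using split[of x] unfolding bi[of x] .
  have "\<lfloor>2^K * fst p\<rfloor> = \<lfloor>2^K * fst q\<rfloor>" "\<lfloor>2^K * snd p\<rfloor> = \<lfloor>2^K * snd q\<rfloor>"
    using Suc.IH Suc.prems by auto
  then show ?case by (simp only: split b)
qed

text \<open>This is the modulus of continuity of the decoder. The factor 2 adds the errors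
  \<open>(1/2)^K\<close> of the two coordinates.\<close>

lemma dist_le_of_code_close:
  assumes "\<bar>code p - code q\<bar> < (1/8)^K / 2"
  shows "dist p q \<le> 2 * (1/2)^K"
proof -
  have "digit k p = digit k q" if "k \<le> K" for k
    using digits_eq_of_close[of "\<lambda>k. digit k p" "\<lambda>k. digit k q" K k] assms that digit_le
    unfolding code_def by auto
  then have fl: "\<lfloor>2^K * fst p\<rfloor> = \<lfloor>2^K * fst q\<rfloor>" "\<lfloor>2^K * snd p\<rfloor> = \<lfloor>2^K * snd q\<rfloor>"
    using floor_eq_of_digits[of K p q] by auto
  have *: "\<bar>x - y\<bar> \<le> (1/2)^K" if "\<lfloor>2^K * x\<rfloor> = \<lfloor>2^K * y\<rfloor>" for x y :: real
  proof -
    have "\<bar>2^K * x - 2^K * y\<bar> \<le> 1" using that by linarith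
    then have "2^K * \<bar>x - y\<bar> \<le> 1" by (simp add: abs_mult right_diff_distrib[symmetric])
    then show ?thesis by (simp add: field_simps power_one_over)
  qed
  have "dist p q \<le> dist (fst p) (fst q) + dist (snd p) (snd q)"
    using sqrt_sum_squares_le_sum[of "dist (fst p) (fst q)" "dist (snd p) (snd q)"] by (simp add: dist_prod_def)
  then show ?thesis using *[OF fl(1)] *[OF fl(2)] by (simp add: dist_real_def)
qed

lemma summable_code: "summable (\<lambda>k. real (digit k p) * (1/8)^k)"
proof (rule summable_comparison_test[of _ "\<lambda>k. 3 * (1/8)^k"], intro exI allI impI)
  fix n :: nat assume "1 \<le> n"
  then have "real (digit n p) \<le> 3" using digit_le by fastforce
  then show "norm (real (digit n p) * (1 / 8) ^ n) \<le> 3 * (1 / 8) ^ n"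
    by (simp add: divide_right_mono)
qed (auto intro!: summable_mult summable_geometric)

lemma code_nonneg: "0 \<le> code p"
  unfolding code_def by (intro suminf_nonneg summable_code) auto

text \<open>The fractional digits contribute at most \<open>3/7\<close>, so the leading digit alone
  decides how large a code is.\<close>

lemma code_le: "code p \<le> real (digit 0 p) + 1"
proof -
  have "code p = (\<Sum>k. real (digit (k+1) p) * (1/8)^(k+1)) + real (digit 0 p)"
    unfolding code_def using suminf_split_initial_segment[OF summable_code, of p 1] by simp
  also have "(\<Sum>k. real (digit (k+1) p) * (1/8)^(k+1)) \<le> (\<Sum>k. 3/8 * (1/8)^k)"
  proof (rule suminf_le)
    fix n
    have "real (digit (n+1) p) \<le> 3" using digit_le[of "n+1" p] by linarith
    then show "real (digit (n+1) p) * (1/8)^(n+1) \<le> 3/8 * (1/8)^n" by (simp add: divide_right_mono)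
  next
    show "summable (\<lambda>k. real (digit (k+1) p) * (1/8)^(k+1))"
      using summable_code[of p] summable_Suc_iff[of "\<lambda>k. real (digit k p) * (1/8)^k"] by simp
  qed (intro summable_mult summable_geometric, simp)
  also have "(\<Sum>k. 3/8 * (1/8)^k :: real) = 3/8 * (1 / (1 - 1/8))"
    by (subst suminf_mult) (auto simp: suminf_geometric summable_geometric)
  finally show ?thesis by simp
qed

text \<open>Needed to carry tightness over to the line. The integer parts of the points of a box
  take finitely many values, which bounds the leading digit.\<close>

lemma code_bounded_on_box: "\<exists>B. \<forall>p. \<bar>fst p\<bar> \<le> R \<and> \<bar>snd p\<bar> \<le> R \<longrightarrow> code p \<le> B"
proof -
  let ?I = "{-\<lceil>R\<rceil>-1..\<lceil>R\<rceil>}"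
  let ?S = "(\<lambda>(i,j). prod_encode (int_encode i, int_encode j)) ` (?I \<times> ?I)"
  have "code p \<le> real (Max ?S) + 1" if "\<bar>fst p\<bar> \<le> R" "\<bar>snd p\<bar> \<le> R" for p
  proof -
    have "\<lfloor>fst p\<rfloor> \<in> ?I" "\<lfloor>snd p\<rfloor> \<in> ?I" using that by (auto; linarith)+
    then have "digit 0 p \<in> ?S" unfolding digit_def by (auto intro!: image_eqI[of _ _ "(\<lfloor>fst p\<rfloor>, \<lfloor>snd p\<rfloor>)"])
    then have "digit 0 p \<le> Max ?S" by (intro Max_ge) auto
    then show ?thesis using code_le[of p] by linarith
  qed
  then show ?thesis by blast
qed

lemma code_measurable [measurable]: "code \<in> borel_measurable borel"
proof -
  have [measurable]: "fst \<in> borel_measurable (borel :: (real\<times>real) measure)" "snd \<in> borel_measurable (borel :: (real\<times>real) measure)"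
    by (auto intro!: borel_measurable_continuous_onI continuous_intros)
  have "(\<lambda>p. real (digit k p)) \<in> borel_measurable borel" for k
    unfolding digit_def by measurable
  then show ?thesis unfolding code_def by measurable
qed

lemma continuous_decoder:
  obtains g :: "real \<Rightarrow> real \<times> real" where "continuous_on UNIV g" "\<And>p. g (code p) = p"
proof -
  have inj: "inj code"
  proof (rule injI)
    fix p q assume "code p = code q"
    then have "dist p q \<le> 2 * (1/2)^K" for K by (intro dist_le_of_code_close) simp
    moreover have "(\<lambda>K. 2 * (1/2)^K :: real) \<longlonglongrightarrow> 2 * 0" by (intro tendsto_intros LIMSEQ_power_zero) simp
    ultimately have "dist p q \<le> 0" by (intro LIMSEQ_le_const[of "\<lambda>K. 2 * (1/2)^K :: real"]) auto
    then show "p = q" by simp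
  qed
  have uc: "uniformly_continuous_on (range code) (inv code)"
    unfolding uniformly_continuous_on_def
  proof (intro allI impI)
    fix e :: real assume "e > 0"
    then obtain K where K: "(1/2::real)^K < e / 2" using real_arch_pow_inv[of "e/2" "1/2"] by auto
    show "\<exists>d>0. \<forall>x\<in>range code. \<forall>x'\<in>range code. dist x' x < d \<longrightarrow> dist (inv code x') (inv code x) < e"
    proof (intro exI conjI ballI impI)
      show "(0::real) < (1/8)^K / 2" by simp
      fix x x' assume "x \<in> range code" "x' \<in> range code" and d: "dist x' x < (1/8)^K / 2"
      then obtain p p' where p: "x = code p" "x' = code p'" by auto
      have "dist p' p \<le> 2 * (1/2)^K" using d p by (intro dist_le_of_code_close) (simp add: dist_real_def)
      with K show "dist (inv code x') (inv code x) < e" using inj p by simp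
    qed
  qed
  \<comment> \<open>Uniform continuity extends the decoder to the closure of the range, and the
    Tietze theorem extends it from this closed set to the line.\<close>
  obtain h where h: "uniformly_continuous_on (closure (range code)) h" "\<And>x. x \<in> range code \<Longrightarrow> inv code x = h x"
    by (rule uniformly_continuous_on_extension_on_closure[OF uc]) (rule that)
  obtain g where g: "continuous_on UNIV g" "\<And>x. x \<in> closure (range code) \<Longrightarrow> g x = h x"
    using Tietze_unbounded[of "closure (range code)" h UNIV] uniformly_continuous_imp_continuous[OF h(1)] by auto
  have "g (code p) = p" for p
    using g(2)[of "code p"] h(2)[of "code p"] closure_subset[of "range code"] inj by auto
  with g(1) that show thesis by blast
qed

text \<open>A bound from some index on is enough: each of the finitely many remaining laws is tight
  by itself, and all intervals can be enlarged to a common one.\<close>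

lemma tightI_eventually:
  assumes rd: "\<And>n. real_distribution (\<mu> n)"
    and ev: "\<And>\<epsilon>::real. \<epsilon> > 0 \<Longrightarrow> \<exists>k. \<forall>\<^sub>F n in sequentially. measure (\<mu> n) {-k<..k} > 1 - \<epsilon>"
  shows "tight \<mu>"
  unfolding tight_def
proof (intro conjI allI impI rd)
  fix \<epsilon> :: real assume "\<epsilon> > 0"
  then obtain k0 n0 where k0: "\<And>n. n \<ge> n0 \<Longrightarrow> measure (\<mu> n) {-k0<..k0} > 1 - \<epsilon>"
    using ev unfolding eventually_sequentially by blast
  have "\<exists>k::nat. measure (\<mu> n) {-real k<..real k} > 1 - \<epsilon>" for n
  proof -
    interpret real_distribution "\<mu> n" by (rule rd)
    have "(\<lambda>k. measure (\<mu> n) {-real k<..real k}) \<longlonglongrightarrow> measure (\<mu> n) (\<Union>k. {-real k<..real k})"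
      by (intro finite_Lim_measure_incseq) (auto simp: incseq_def)
    also have "(\<Union>k. {-real k<..real k}) = UNIV"
    proof -
      have "\<exists>k. -real k < x \<and> x \<le> real k" for x
        using reals_Archimedean2[of "\<bar>x\<bar>"] by (metis abs_less_iff less_eq_real_def minus_less_iff)
      then show ?thesis by auto
    qed
    finally have "(\<lambda>k. measure (\<mu> n) {-real k<..real k}) \<longlonglongrightarrow> 1" using prob_space by simp
    from order_tendstoD(1)[OF this, of "1 - \<epsilon>"] \<open>\<epsilon> > 0\<close> show ?thesis
      by (auto simp: eventually_sequentially)
  qed
  then obtain K :: "nat \<Rightarrow> nat" where K: "\<And>n. measure (\<mu> n) {-real (K n)<..real (K n)} > 1 - \<epsilon>" by metis
  \<comment> \<open>The lower bound 1 keeps the interval nondegenerate, as \<open>tight\<close>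
    demands.\<close>
  define b where "b = max 1 (max k0 (real (Max (K ` {..n0}))))"
  have "measure (\<mu> n) {-b<..b} > 1 - \<epsilon>" for n
  proof -
    interpret real_distribution "\<mu> n" by (rule rd)
    have "\<exists>k\<le>b. measure (\<mu> n) {-k<..k} > 1 - \<epsilon>"
    proof (cases "n \<le> n0")
      case True
      then have "K n \<le> Max (K ` {..n0})" by (intro Max_ge) auto
      then have "real (K n) \<le> b" unfolding b_def by (simp add: max.coboundedI2)
      with K show ?thesis by blast
    next
      case False
      then show ?thesis using k0[of n] unfolding b_def by (intro exI[of _ k0]) auto
    qed
    then obtain k where k: "k \<le> b" "measure (\<mu> n) {-k<..k} > 1 - \<epsilon>" by blast
    have "measure (\<mu> n) {-k<..k} \<le> measure (\<mu> n) {-b<..b}"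
      using k(1) by (intro finite_measure_mono) auto
    with k(2) show ?thesis by simp
  qed
  moreover have "-b < b" unfolding b_def by auto
  ultimately show "\<exists>a b. a < b \<and> (\<forall>n. 1 - \<epsilon> < measure (\<mu> n) {a<..b})" by blast
qed

text \<open>The deficit of mass is parked at the point \<open>-1\<close>, outside the range of \<^const>\<open>code\<close>, so that Helly's
  theorem for probability measures on the line applies; the weight \<open>h\<close> removes it again.\<close>

lemma tight_subsequence:
  fixes M :: "nat \<Rightarrow> (real \<times> real) measure"
  assumes fin: "\<And>n. finite_measure (M n)" and sets: "\<And>n. sets (M n) = sets borel_D"
    and mass: "\<And>n. measure (M n) state_D \<le> C"
    and tail: "\<And>\<epsilon>. \<epsilon> > 0 \<Longrightarrow>
      \<exists>R. \<forall>\<^sub>F n in sequentially. measure (M n) {\<xi>\<in>state_D. R < fst \<xi> \<or> R < \<bar>snd \<xi>\<bar>} \<le> \<epsilon>"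
  obtains r N where "strict_mono (r :: nat \<Rightarrow> nat)" "finite_measure N" "sets N = sets borel_D"
    "\<And>f :: real \<times> real \<Rightarrow> complex. continuous_on state_D f \<Longrightarrow> bounded (f ` state_D) \<Longrightarrow>
       (\<lambda>n. \<integral>\<xi>. f \<xi> \<partial>M (r n)) \<longlonglongrightarrow> (\<integral>\<xi>. f \<xi> \<partial>N)"
proof -
  obtain g :: "real \<Rightarrow> real \<times> real" where g: "continuous_on UNIV g" "\<And>p. g (code p) = p"
    using continuous_decoder by blast
  \<comment> \<open>The common total mass after padding; the maximum with 1 keeps it positive for
    every \<open>C\<close>.\<close>
  define c where "c = max C 1"
  have c: "c > 0" and mass_c: "measure (M n) state_D \<le> c" for n
    using mass[of n] by (auto simp: c_def)
  define \<alpha> where "\<alpha> n = c - measure (M n) state_D" for n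
  have \<alpha>: "0 \<le> \<alpha> n" for n using mass_c[of n] by (simp add: \<alpha>_def)
  define X where "X n = distr (M n) borel code" for n
  define Y where "Y n = density (return borel (-1::real)) (\<lambda>_. ennreal (\<alpha> n))" for n
  define \<nu> where "\<nu> n = density (add_measure (X n) (Y n)) (\<lambda>_. ennreal (1 / c))" for n
  have sp: "space (M n) = state_D" for n using sets space_of_sets_borel_D by blast
  have cm: "code \<in> M n \<rightarrow>\<^sub>M borel" for n by (rule borel_measurable_on_D[OF sets code_measurable])
  have setsXY: "sets (X n) = sets borel" "sets (Y n) = sets borel" "sets (Y n) = sets (X n)" "sets (\<nu> n) = sets borel" for n
    by (simp_all add: X_def Y_def \<nu>_def)
  have em\<nu>: "emeasure (\<nu> n) A = ennreal (1 / c) * (emeasure (M n) (code -` A \<inter> state_D) + ennreal (\<alpha> n) * indicator A (-1))"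
    if A: "A \<in> sets borel" for n A
  proof -
    have "emeasure (Y n) A = ennreal (\<alpha> n) * indicator A (-1)"
      unfolding Y_def using A by (subst emeasure_density_const) auto
    moreover have "emeasure (X n) A = emeasure (M n) (code -` A \<inter> state_D)"
      unfolding X_def using A by (subst emeasure_distr[OF cm]) (auto simp: sp)
    ultimately show ?thesis
      unfolding \<nu>_def using A setsXY
      by (subst emeasure_density_const) (auto simp: emeasure_add_measure)
  qed
  have rd: "real_distribution (\<nu> n)" for n
  proof -
    interpret finite_measure "M n" by (rule fin)
    have "space (\<nu> n) = UNIV" using sets_eq_imp_space_eq[OF setsXY(4)] by simp
    moreover have "emeasure (\<nu> n) UNIV = 1"
      using c \<alpha>[of n] by (simp add: em\<nu> emeasure_eq_measure ennreal_plus[symmetric] ennreal_mult[symmetric] del: ennreal_plus)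
        (simp add: \<alpha>_def)
    ultimately show ?thesis
      by (intro real_distribution.intro prob_spaceI real_distribution_axioms.intro setsXY) auto
  qed
  have "tight \<nu>"
  proof (rule tightI_eventually[OF rd])
    fix \<epsilon> :: real assume "\<epsilon> > 0"
    then obtain R where R: "\<forall>\<^sub>F n in sequentially. measure (M n) {\<xi>\<in>state_D. R < fst \<xi> \<or> R < \<bar>snd \<xi>\<bar>} \<le> \<epsilon> * c / 2"
      using tail[of "\<epsilon> * c / 2"] c by auto
    obtain B where B: "\<And>p. \<bar>fst p\<bar> \<le> R \<Longrightarrow> \<bar>snd p\<bar> \<le> R \<Longrightarrow> code p \<le> B"
      using code_bounded_on_box[of R] by blast
    define k where "k = max B 2"
    show "\<exists>k. \<forall>\<^sub>F n in sequentially. measure (\<nu> n) {-k<..k} > 1 - \<epsilon>"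
    proof (intro exI[of _ k] eventually_mono[OF R])
      fix n assume le: "measure (M n) {\<xi>\<in>state_D. R < fst \<xi> \<or> R < \<bar>snd \<xi>\<bar>} \<le> \<epsilon> * c / 2"
      interpret finite_measure "M n" by (rule fin)
      interpret \<nu>: real_distribution "\<nu> n" by (rule rd)
      have S: "{\<xi>\<in>state_D. R < fst \<xi> \<or> R < \<bar>snd \<xi>\<bar>} \<in> sets (M n)"
      proof -
        have "{\<xi>::real\<times>real. R < fst \<xi> \<or> R < \<bar>snd \<xi>\<bar>} \<in> sets borel"
          by (intro borel_open open_Collect_disj open_Collect_less continuous_intros)
        moreover have "{\<xi>\<in>state_D. R < fst \<xi> \<or> R < \<bar>snd \<xi>\<bar>} = {\<xi>::real\<times>real. R < fst \<xi> \<or> R < \<bar>snd \<xi>\<bar>} \<inter> state_D" by auto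
        ultimately show ?thesis using state_D_borel by (simp add: sets sets_borel_D_iff)
      qed
      have sub: "code -` (-{-k<..k}) \<inter> state_D \<subseteq> {\<xi>\<in>state_D. R < fst \<xi> \<or> R < \<bar>snd \<xi>\<bar>}"
      proof safe
        fix x y assume xy: "(x, y) \<in> state_D" "code (x, y) \<notin> {-k<..k}" "\<not> R < \<bar>snd (x, y)\<bar>"
        have "code (x, y) > k" using xy(2) code_nonneg[of "(x,y)"] by (auto simp: k_def)
        then have "\<not> (\<bar>x\<bar> \<le> R \<and> \<bar>y\<bar> \<le> R)" using B[of "(x,y)"] by (auto simp: k_def)
        then show "R < fst (x, y)" using xy by (auto simp: state_D_def)
      qed
      have "emeasure (\<nu> n) (-{-k<..k}) = ennreal (1 / c) * emeasure (M n) (code -` (-{-k<..k}) \<inter> state_D)"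
        by (subst em\<nu>) (auto simp: k_def split: split_indicator)
      also have "\<dots> \<le> ennreal (1 / c) * ennreal (\<epsilon> * c / 2)"
        by (intro mult_left_mono order_trans[OF emeasure_mono[OF sub S]]) (auto simp: emeasure_eq_measure intro!: ennreal_leI le)
      also have "\<dots> = ennreal (\<epsilon> / 2)" using c \<open>\<epsilon> > 0\<close> by (simp add: ennreal_mult[symmetric])
      finally have "measure (\<nu> n) (-{-k<..k}) \<le> \<epsilon> / 2"
        using \<open>\<epsilon> > 0\<close> by (simp add: \<nu>.emeasure_eq_measure)
      moreover have "measure (\<nu> n) (-{-k<..k}) = 1 - measure (\<nu> n) {-k<..k}"
        using \<nu>.prob_compl[of "{-k<..k}"] by (simp add: Compl_eq_Diff_UNIV)
      ultimately show "measure (\<nu> n) {-k<..k} > 1 - \<epsilon>" using \<open>\<epsilon> > 0\<close> by linarith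
    qed
  qed
  from tight_imp_convergent_subsubsequence[OF this, of id]
  obtain r \<nu>' where r: "strict_mono (r :: nat \<Rightarrow> nat)" and \<nu>': "real_distribution \<nu>'" "weak_conv_m (\<nu> \<circ> id \<circ> r) \<nu>'"
    by (auto simp: strict_mono_id)
  interpret \<nu>': real_distribution \<nu>' by fact
  define h where "h x = max 0 (min 1 (x + 1))" for x :: real
  define q where "q x = (max 0 (fst (g x)), snd (g x))" for x
  have q_cont: "continuous_on UNIV q" unfolding q_def by (intro continuous_intros g)
  have qD: "q x \<in> state_D" for x by (simp add: q_def state_D_def)
  have q_code: "q (code p) = p" if "p \<in> state_D" for p
    using that by (auto simp: q_def g state_D_def)
  have h_cont: "continuous_on UNIV h" unfolding h_def by (intro continuous_intros)
  have h_nn: "0 \<le> h x" "h x \<le> 1" for x by (auto simp: h_def)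
  have h_code: "h (code p) = 1" for p using code_nonneg[of p] by (simp add: h_def)
  have h_meas: "h \<in> borel_measurable borel" using h_cont by (rule borel_measurable_continuous_onI)
  have q_meas: "q \<in> borel \<rightarrow>\<^sub>M borel_D"
    using qD by (intro measurable_restrict_space2 borel_measurable_continuous_onI q_cont) auto
  define V where "V = density \<nu>' (\<lambda>x. ennreal (c * h x))"
  have setsV: "sets V = sets borel" by (simp add: V_def \<nu>'.events_eq_borel)
  have "finite_measure V"
    unfolding V_def using c h_nn h_meas mult_left_mono[of _ 1 c]
    by (intro finite_measure_density_le[where B=c] \<nu>'.finite_measure_axioms) (auto intro!: ennreal_leI)
  define N where "N = distr V borel_D q"
  have qV: "q \<in> V \<rightarrow>\<^sub>M borel_D" using q_meas measurable_cong_sets[OF setsV refl] by blast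
  have finN: "finite_measure N"
    unfolding N_def by (rule finite_measure.finite_measure_distr[OF \<open>finite_measure V\<close> qV])
  have setsN: "sets N = sets borel_D" by (simp add: N_def)
  show thesis
  proof (rule that[OF r finN setsN])
    fix f :: "real \<times> real \<Rightarrow> complex" assume f: "continuous_on state_D f" "bounded (f ` state_D)"
    obtain B where B: "\<And>\<xi>. \<xi> \<in> state_D \<Longrightarrow> norm (f \<xi>) \<le> B" using f(2) by (auto simp: bounded_iff)
    define F where "F x = (c * h x) *\<^sub>R f (q x)" for x
    have fq: "continuous_on UNIV (\<lambda>x. f (q x))"
      using continuous_on_compose2[OF f(1) q_cont] qD by auto
    have F_cont: "continuous_on UNIV F" unfolding F_def by (intro continuous_intros h_cont fq)
    have F_bd: "norm (F x) \<le> c * B" for x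
    proof -
      have "c * h x * norm (f (q x)) \<le> c * 1 * B"
        using c h_nn[of x] B[OF qD, of x] by (intro mult_mono) auto
      then show ?thesis using c h_nn[of x] by (simp add: F_def abs_mult)
    qed
    have F_meas: "F \<in> borel_measurable borel" using F_cont by (rule borel_measurable_continuous_onI)
    have f_meas: "f \<in> borel_measurable borel_D" using f(1) by (rule borel_measurable_continuous_on_restrict)
    have "(\<lambda>n. \<integral>x. F x \<partial>(\<nu> \<circ> id \<circ> r) n) \<longlonglongrightarrow> (\<integral>x. F x \<partial>\<nu>')"
      using F_cont F_bd by (intro weak_conv_imp_integral_bdd_continuous_conv[OF _ \<nu>'(1) \<nu>'(2), where B="c * B"])
        (auto simp: rd continuous_on_eq_continuous_at)
    moreover have "(\<integral>x. F x \<partial>\<nu>') = (\<integral>\<xi>. f \<xi> \<partial>N)"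
    proof -
      have "(\<integral>\<xi>. f \<xi> \<partial>N) = (\<integral>x. f (q x) \<partial>V)"
        unfolding N_def by (rule integral_distr[OF qV f_meas])
      also have "\<dots> = (\<integral>x. F x \<partial>\<nu>')"
        unfolding V_def F_def using c h_nn h_meas borel_measurable_continuous_onI[OF fq]
        by (subst integral_density) auto
      finally show ?thesis by simp
    qed
    moreover have "(\<integral>x. F x \<partial>\<nu> n) = (\<integral>\<xi>. f \<xi> \<partial>M n)" for n
    proof -
      interpret finite_measure "M n" by (rule fin)
      have FX: "integrable (X n) F"
        using finite_measure_distr[OF cm] F_bd F_meas unfolding X_def
        by (intro finite_measure.integrable_const_bound[where B="c * B"]) auto
      have FY: "has_bochner_integral (Y n) F 0"
      proof -
        have "F (-1) = 0" by (simp add: F_def h_def)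
        have "finite_measure (Y n)"
          unfolding Y_def using prob_space.finite_measure[OF prob_space_return, of "-1" borel]
          by (intro finite_measure_density_le[where B="\<alpha> n"]) auto
        then have "integrable (Y n) F"
          using F_bd F_meas by (intro finite_measure.integrable_const_bound[where B="c * B"]) (auto simp: Y_def)
        moreover have "(\<integral>x. F x \<partial>Y n) = 0"
          unfolding Y_def using F_meas \<alpha>[of n] \<open>F (-1) = 0\<close>
          by (subst integral_density) (auto simp: integral_return)
        ultimately have "integrable (Y n) F" "(\<integral>x. F x \<partial>Y n) = 0" by auto
        then show ?thesis by (simp add: has_bochner_integral_iff)
      qed
      have "(\<integral>x. F x \<partial>\<nu> n) = (\<integral>x. (1 / c) *\<^sub>R F x \<partial>add_measure (X n) (Y n))"
        unfolding \<nu>_def using c F_meas setsXY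
        by (subst integral_density) (auto cong: measurable_cong_sets)
      also have "\<dots> = (1 / c) *\<^sub>R (\<integral>x. F x \<partial>X n)"
        using integral_add_measure[OF setsXY(3) FX] FY by (auto simp: has_bochner_integral_iff)
      also have "(\<integral>x. F x \<partial>X n) = (\<integral>\<xi>. c *\<^sub>R f \<xi> \<partial>M n)"
        unfolding X_def
        by (subst integral_distr[OF cm F_meas], intro Bochner_Integration.integral_cong)
          (auto simp: F_def h_code q_code sp)
      finally show ?thesis using c by simp
    qed
    ultimately show "(\<lambda>n. \<integral>\<xi>. f \<xi> \<partial>M (r n)) \<longlonglongrightarrow> (\<integral>\<xi>. f \<xi> \<partial>N)"
      by (simp add: comp_def)
  qed
qed

section \<open>Mixtures and convolutions\<close>

text \<open>\<open>M\<close> may have infinite mass, as Levy measures do. Integrability against the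
  mixture is therefore assumed, while the bound \<open>B\<close> takes care of the inner integrals.
  The nonnegative case applies to the positive and the negative part.\<close>

lemma
  fixes f :: "'a \<Rightarrow> real"
  assumes \<kappa>: "\<kappa> \<in> M \<rightarrow>\<^sub>M subprob_algebra N" and f: "f \<in> borel_measurable N"
    and bd: "\<And>x. x \<in> space N \<Longrightarrow> \<bar>f x\<bar> \<le> B" and int: "integrable (bind M \<kappa>) f"
  shows integrable_bind_real: "integrable M (\<lambda>x. \<integral>y. f y \<partial>\<kappa> x)"
    and integral_bind_real: "(\<integral>y. f y \<partial>bind M \<kappa>) = (\<integral>x. \<integral>y. f y \<partial>\<kappa> x \<partial>M)"
proof -
  have inner: "integrable (\<kappa> x) g" if "x \<in> space M" "g \<in> borel_measurable N" "\<And>y. y \<in> space N \<Longrightarrow> \<bar>g y\<bar> \<le> B" for x and g :: "'a \<Rightarrow> real"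
  proof -
    interpret subprob_space "\<kappa> x" using \<kappa> that(1) by (rule subprob_space_kernel)
    have "sets (\<kappa> x) = sets N" using \<kappa> that(1) by (rule sets_kernel)
    then show ?thesis
      using that(2,3) sets_eq_imp_space_eq[of "\<kappa> x" N]
      by (intro integrable_const_bound[where B=B]) (auto cong: measurable_cong_sets)
  qed
  have pos: "integrable M (\<lambda>x. \<integral>y. g y \<partial>\<kappa> x) \<and> (\<integral>y. g y \<partial>bind M \<kappa>) = (\<integral>x. \<integral>y. g y \<partial>\<kappa> x \<partial>M)"
    if g: "g \<in> borel_measurable N" "\<And>y. y \<in> space N \<Longrightarrow> \<bar>g y\<bar> \<le> B" "\<And>y. 0 \<le> g y" "integrable (bind M \<kappa>) g" for g :: "'a \<Rightarrow> real"
  proof -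
    have m: "(\<lambda>x. \<integral>y. g y \<partial>\<kappa> x) \<in> borel_measurable M"
      using measurable_compose[OF \<kappa> integral_measurable_subprob_algebra[OF g(1)]] .
    have nn: "(\<integral>\<^sup>+y. ennreal (g y) \<partial>bind M \<kappa>) = (\<integral>\<^sup>+x. ennreal (\<integral>y. g y \<partial>\<kappa> x) \<partial>M)"
    proof -
      have "(\<lambda>y. ennreal (g y)) \<in> borel_measurable N" using g(1) by measurable
      then have "(\<integral>\<^sup>+y. ennreal (g y) \<partial>bind M \<kappa>) = (\<integral>\<^sup>+x. \<integral>\<^sup>+y. ennreal (g y) \<partial>\<kappa> x \<partial>M)"
        by (rule nn_integral_bind[OF _ \<kappa>])
      also have "\<dots> = (\<integral>\<^sup>+x. ennreal (\<integral>y. g y \<partial>\<kappa> x) \<partial>M)"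
        using g by (intro nn_integral_cong nn_integral_eq_integral inner AE_I2) blast+
      finally show ?thesis .
    qed
    have fin: "(\<integral>\<^sup>+y. ennreal (g y) \<partial>bind M \<kappa>) < \<infinity>"
      using g(3,4) by (simp add: integrable_iff_bounded)
    have int: "integrable M (\<lambda>x. \<integral>y. g y \<partial>\<kappa> x)"
      using m fin nn g(3) by (simp add: integrable_iff_bounded)
    moreover have "(\<integral>y. g y \<partial>bind M \<kappa>) = (\<integral>x. \<integral>y. g y \<partial>\<kappa> x \<partial>M)"
    proof -
      have "(\<integral>y. g y \<partial>bind M \<kappa>) = enn2real (\<integral>\<^sup>+y. ennreal (g y) \<partial>bind M \<kappa>)"
        using g(3,4) by (intro integral_eq_nn_integral) auto
      also have "\<dots> = (\<integral>x. \<integral>y. g y \<partial>\<kappa> x \<partial>M)"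
        unfolding nn using m g(3) by (intro integral_eq_nn_integral[symmetric]) auto
      finally show ?thesis .
    qed
    ultimately show ?thesis by simp
  qed
  have bdmax: "\<bar>max 0 (f y)\<bar> \<le> B" "\<bar>max 0 (- f y)\<bar> \<le> B" if "y \<in> space N" for y
    using bd[OF that] by (auto simp: max_def abs_if split: if_splits)
  have 1: "integrable M (\<lambda>x. \<integral>y. max 0 (f y) \<partial>\<kappa> x) \<and> (\<integral>y. max 0 (f y) \<partial>bind M \<kappa>) = (\<integral>x. \<integral>y. max 0 (f y) \<partial>\<kappa> x \<partial>M)"
    using f bd int by (intro pos bdmax) auto
  have 2: "integrable M (\<lambda>x. \<integral>y. max 0 (- f y) \<partial>\<kappa> x) \<and> (\<integral>y. max 0 (- f y) \<partial>bind M \<kappa>) = (\<integral>x. \<integral>y. max 0 (- f y) \<partial>\<kappa> x \<partial>M)"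
    using f bd int by (intro pos bdmax) auto
  have split: "f y = max 0 (f y) - max 0 (- f y)" for y by auto
  have *: "(\<integral>y. f y \<partial>\<kappa> x) = (\<integral>y. max 0 (f y) \<partial>\<kappa> x) - (\<integral>y. max 0 (- f y) \<partial>\<kappa> x)" if "x \<in> space M" for x
  proof -
    have "(\<integral>y. f y \<partial>\<kappa> x) = (\<integral>y. max 0 (f y) - max 0 (- f y) \<partial>\<kappa> x)"
      by (intro Bochner_Integration.integral_cong refl split)
    also have "\<dots> = (\<integral>y. max 0 (f y) \<partial>\<kappa> x) - (\<integral>y. max 0 (- f y) \<partial>\<kappa> x)"
      by (intro Bochner_Integration.integral_diff inner[OF that] bdmax; (use f in measurable)?)
    finally show ?thesis .
  qed
  show "integrable M (\<lambda>x. \<integral>y. f y \<partial>\<kappa> x)"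
    using 1 2 by (subst Bochner_Integration.integrable_cong[OF refl *]) auto
  have "(\<integral>y. f y \<partial>bind M \<kappa>) = (\<integral>y. max 0 (f y) \<partial>bind M \<kappa>) - (\<integral>y. max 0 (- f y) \<partial>bind M \<kappa>)"
  proof -
    have "(\<integral>y. f y \<partial>bind M \<kappa>) = (\<integral>y. max 0 (f y) - max 0 (- f y) \<partial>bind M \<kappa>)"
      by (intro Bochner_Integration.integral_cong refl split)
    also have "\<dots> = (\<integral>y. max 0 (f y) \<partial>bind M \<kappa>) - (\<integral>y. max 0 (- f y) \<partial>bind M \<kappa>)"
      using int by (intro Bochner_Integration.integral_diff) auto
    finally show ?thesis .
  qed
  also have "\<dots> = (\<integral>x. \<integral>y. f y \<partial>\<kappa> x \<partial>M)"
    using 1 2 by (subst Bochner_Integration.integral_cong[OF refl *]) auto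
  finally show "(\<integral>y. f y \<partial>bind M \<kappa>) = (\<integral>x. \<integral>y. f y \<partial>\<kappa> x \<partial>M)" .
qed

lemma integral_bind_complex:
  fixes f :: "'a \<Rightarrow> complex"
  assumes \<kappa>: "\<kappa> \<in> M \<rightarrow>\<^sub>M subprob_algebra N" and f: "f \<in> borel_measurable N"
    and bd: "\<And>x. x \<in> space N \<Longrightarrow> norm (f x) \<le> B" and int: "integrable (bind M \<kappa>) f"
  shows "(\<integral>y. f y \<partial>bind M \<kappa>) = (\<integral>x. \<integral>y. f y \<partial>\<kappa> x \<partial>M)"
proof -
  have inner: "integrable (\<kappa> x) f" if "x \<in> space M" for x
  proof -
    interpret subprob_space "\<kappa> x" using \<kappa> that(1) by (rule subprob_space_kernel)
    have "sets (\<kappa> x) = sets N" using \<kappa> that(1) by (rule sets_kernel)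
    then show ?thesis
      using f bd sets_eq_imp_space_eq[of "\<kappa> x" N]
      by (intro integrable_const_bound[where B=B]) (auto cong: measurable_cong_sets)
  qed
  have bR: "\<bar>Re (f x)\<bar> \<le> B" "\<bar>Im (f x)\<bar> \<le> B" if "x \<in> space N" for x
    using bd[OF that] abs_Re_le_cmod[of "f x"] abs_Im_le_cmod[of "f x"] by linarith+
  have R: "integrable M (\<lambda>x. \<integral>y. Re (f y) \<partial>\<kappa> x)" "(\<integral>y. Re (f y) \<partial>bind M \<kappa>) = (\<integral>x. \<integral>y. Re (f y) \<partial>\<kappa> x \<partial>M)"
    using integrable_bind_real[OF \<kappa>, of "\<lambda>x. Re (f x)" B] integral_bind_real[OF \<kappa>, of "\<lambda>x. Re (f x)" B] f bR int by simp_all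
  have I: "integrable M (\<lambda>x. \<integral>y. Im (f y) \<partial>\<kappa> x)" "(\<integral>y. Im (f y) \<partial>bind M \<kappa>) = (\<integral>x. \<integral>y. Im (f y) \<partial>\<kappa> x \<partial>M)"
    using integrable_bind_real[OF \<kappa>, of "\<lambda>x. Im (f x)" B] integral_bind_real[OF \<kappa>, of "\<lambda>x. Im (f x)" B] f bR int by simp_all
  have *: "(\<integral>y. f y \<partial>\<kappa> x) = complex_of_real (\<integral>y. Re (f y) \<partial>\<kappa> x) + \<i> * complex_of_real (\<integral>y. Im (f y) \<partial>\<kappa> x)" if "x \<in> space M" for x
    using inner[OF that] by (simp add: complex_eq_iff)
  have "(\<integral>y. f y \<partial>bind M \<kappa>) = complex_of_real (\<integral>y. Re (f y) \<partial>bind M \<kappa>) + \<i> * complex_of_real (\<integral>y. Im (f y) \<partial>bind M \<kappa>)"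
    using int by (simp add: complex_eq_iff)
  also have "\<dots> = (\<integral>x. complex_of_real (\<integral>y. Re (f y) \<partial>\<kappa> x) + \<i> * complex_of_real (\<integral>y. Im (f y) \<partial>\<kappa> x) \<partial>M)"
    using R I by simp
  also have "\<dots> = (\<integral>x. \<integral>y. f y \<partial>\<kappa> x \<partial>M)"
    by (intro Bochner_Integration.integral_cong refl *[symmetric])
  finally show "(\<integral>y. f y \<partial>bind M \<kappa>) = (\<integral>x. \<integral>y. f y \<partial>\<kappa> x \<partial>M)" .
qed

lemma bind_in_prob_algebra:
  assumes "M \<in> space (prob_algebra borel_D)" "\<kappa> \<in> borel_D \<rightarrow>\<^sub>M prob_algebra borel_D"
  shows "bind M \<kappa> \<in> space (prob_algebra borel_D)"
  using prob_space_bind'[OF assms] sets_bind'[OF assms] by (simp add: space_prob_algebra)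

lemma kernel_subprob:
  assumes "sets M = sets borel_D" "\<kappa> \<in> borel_D \<rightarrow>\<^sub>M prob_algebra borel_D"
  shows "\<kappa> \<in> M \<rightarrow>\<^sub>M subprob_algebra borel_D"
  using measurable_prob_algebraD[OF assms(2)] assms(1) by (simp cong: measurable_cong_sets)

lemma transform_bind:
  assumes M: "M \<in> space (prob_algebra borel_D)" and \<kappa>: "\<kappa> \<in> borel_D \<rightarrow>\<^sub>M prob_algebra borel_D" and u: "u \<in> dom_U"
  shows "transform (bind M \<kappa>) u = (\<integral>x. transform (\<kappa> x) u \<partial>M)"
  unfolding transform_def
proof (rule integral_bind_complex)
  show "integrable (M \<bind> \<kappa>) (\<lambda>y. exp (pairing u y))"
    using bind_in_prob_algebra[OF M \<kappa>] u by (intro integrable_exp_pairing) (auto dest: prob_algebra_D)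
  show "\<kappa> \<in> M \<rightarrow>\<^sub>M subprob_algebra borel_D"
    by (rule kernel_subprob[OF prob_algebra_D(2)[OF M] \<kappa>])
  show "(\<lambda>y. exp (pairing u y)) \<in> borel_measurable borel_D"
    by (rule borel_measurable_on_D[OF refl exp_pairing_measurable])
  show "norm (exp (pairing u y)) \<le> 1" if "y \<in> space borel_D" for y
    using norm_exp_pairing_le[OF u, of y] that by (simp add: space_restrict_space)
qed

lemma return_in_prob_algebra: "x \<in> state_D \<Longrightarrow> return borel_D x \<in> space (prob_algebra borel_D)"
  by (simp add: space_prob_algebra prob_space_return space_restrict_space)

lemma transform_return: "x \<in> state_D \<Longrightarrow> transform (return borel_D x) u = exp (pairing u x)"
  unfolding transform_def
  by (rule integral_return[OF _ borel_measurable_on_D[OF refl exp_pairing_measurable]]) (simp add: space_restrict_space)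

lemma add_measurable_D:
  assumes "sets M = sets borel_D" "sets N = sets borel_D"
  shows "(\<lambda>(x, y). x + y) \<in> M \<Otimes>\<^sub>M N \<rightarrow>\<^sub>M borel_D"
proof (rule measurable_restrict_space2)
  have [measurable]: "(\<lambda>x. x) \<in> M \<rightarrow>\<^sub>M borel" "(\<lambda>x. x) \<in> N \<rightarrow>\<^sub>M borel"
    using borel_measurable_on_D[OF assms(1) measurable_ident] borel_measurable_on_D[OF assms(2) measurable_ident]
    by (simp_all add: id_def)
  show "(\<lambda>(x, y). x + y) \<in> space (M \<Otimes>\<^sub>M N) \<rightarrow> state_D"
    using assms by (auto simp: space_pair_measure space_of_sets_borel_D state_D_def)
  have "(\<lambda>p. fst p + snd p) \<in> borel_measurable (M \<Otimes>\<^sub>M N)"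
    by (intro borel_measurable_add) (rule measurable_compose[OF measurable_fst], simp, rule measurable_compose[OF measurable_snd], simp)
  then show "(\<lambda>(x, y). x + y) \<in> borel_measurable (M \<Otimes>\<^sub>M N)" by (simp add: case_prod_beta')
qed

lemma conv_D_in_prob_algebra:
  assumes "M \<in> space (prob_algebra borel_D)" "N \<in> space (prob_algebra borel_D)"
  shows "conv_D M N \<in> space (prob_algebra borel_D)"
proof -
  interpret M: prob_space M using assms by (auto dest: prob_algebra_D)
  interpret N: prob_space N using assms by (auto dest: prob_algebra_D)
  interpret pair_prob_space M N ..
  have "prob_space (conv_D M N)"
    unfolding conv_D_def using assms by (intro prob_space_distr add_measurable_D) (auto dest: prob_algebra_D)
  then show ?thesis by (simp add: space_prob_algebra conv_D_def)
qed

lemma transform_conv_D: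
  assumes M: "M \<in> space (prob_algebra borel_D)" and N: "N \<in> space (prob_algebra borel_D)" and u: "u \<in> dom_U"
  shows "transform (conv_D M N) u = transform M u * transform N u"
proof -
  interpret M: prob_space M using M by (auto dest: prob_algebra_D)
  interpret N: prob_space N using N by (auto dest: prob_algebra_D)
  interpret pair_prob_space M N ..
  note add_m = add_measurable_D[OF prob_algebra_D(2)[OF M] prob_algebra_D(2)[OF N]]
  have em: "(\<lambda>\<xi>. exp (pairing u \<xi>)) \<in> borel_measurable borel_D" by (rule borel_measurable_on_D[OF refl exp_pairing_measurable])
  have int: "integrable (M \<Otimes>\<^sub>M N) (\<lambda>p. exp (pairing u (case p of (x, y) \<Rightarrow> x + y)))"
  proof (rule P.integrable_const_bound[where B=1])
    show "AE p in M \<Otimes>\<^sub>M N. norm (exp (pairing u (case p of (x, y) \<Rightarrow> x + y))) \<le> 1"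
      using measurable_space[OF add_m] norm_exp_pairing_le[OF u] by (intro AE_I2) (auto simp: space_restrict_space simp del: norm_exp_eq_Re)
    show "(\<lambda>p. exp (pairing u (case p of (x, y) \<Rightarrow> x + y))) \<in> borel_measurable (M \<Otimes>\<^sub>M N)"
      using measurable_compose[OF add_m em] .
  qed
  have "transform (conv_D M N) u = (\<integral>p. exp (pairing u (case p of (x, y) \<Rightarrow> x + y)) \<partial>(M \<Otimes>\<^sub>M N))"
    unfolding transform_def conv_D_def by (rule integral_distr[OF add_m em])
  also have "\<dots> = (\<integral>x. \<integral>y. exp (pairing u x) * exp (pairing u y) \<partial>N \<partial>M)"
    by (subst integral_fst'[OF int, symmetric]) (simp add: pairing_add_right exp_add)
  finally show ?thesis by (simp add: transform_def)
qed

lemma conv_D_power: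
  assumes N: "N \<in> space (prob_algebra borel_D)"
  shows "(conv_D N ^^ n) (return borel_D 0) \<in> space (prob_algebra borel_D)"
    and "u \<in> dom_U \<Longrightarrow> transform ((conv_D N ^^ n) (return borel_D 0)) u = transform N u ^ n"
proof -
  have *: "(conv_D N ^^ n) (return borel_D 0) \<in> space (prob_algebra borel_D)" for n
    by (induction n) (auto intro: N conv_D_in_prob_algebra return_in_prob_algebra zero_in_state_D)
  show "(conv_D N ^^ n) (return borel_D 0) \<in> space (prob_algebra borel_D)" by (rule *)
  show "transform ((conv_D N ^^ n) (return borel_D 0)) u = transform N u ^ n" if "u \<in> dom_U"
    by (induction n) (auto simp: that transform_conv_D[OF N *] transform_return zero_in_state_D)
qed

lemma prob_algebra_D_eqI:
  assumes "M \<in> space (prob_algebra borel_D)" "N \<in> space (prob_algebra borel_D)"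
    and "\<And>u. u \<in> dom_U \<Longrightarrow> transform M u = transform N u"
  shows "M = N"
  using assms by (intro finite_measure_D_eqI) (auto dest: prob_algebra_D)

lemma transform_prod_exists:
  assumes "\<And>k. k < (n::nat) \<Longrightarrow> \<rho> k \<in> space (prob_algebra borel_D)"
  shows "\<exists>P \<in> space (prob_algebra borel_D). \<forall>u\<in>dom_U. transform P u = (\<Prod>k<n. transform (\<rho> k) u)"
  using assms
proof (induction n)
  case 0
  then show ?case
    by (intro bexI[of _ "return borel_D 0"]) (auto intro: return_in_prob_algebra simp: transform_return zero_in_state_D)
next
  case (Suc n)
  then obtain P where P: "P \<in> space (prob_algebra borel_D)" "\<And>u. u \<in> dom_U \<Longrightarrow> transform P u = (\<Prod>k<n. transform (\<rho> k) u)"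
    by auto
  then show ?case using Suc.prems[of n]
    by (intro bexI[of _ "conv_D P (\<rho> n)"]) (auto simp: transform_conv_D intro: conv_D_in_prob_algebra)
qed

section \<open>Elementary estimates\<close>

text \<open>On the convex left half-plane the derivative of \<open>exp\<close> has modulus at most
  1, so the mean value inequality applies.\<close>

lemma norm_exp_diff_le:
  fixes z w :: complex
  assumes "Re z \<le> 0" "Re w \<le> 0"
  shows "norm (exp z - exp w) \<le> norm (z - w)" "norm (exp z - exp w) \<le> 2"
proof -
  have "norm (exp z - exp w) \<le> 1 * norm (z - w)"
  proof (rule field_differentiable_bound)
    show "convex {z. Re z \<le> 0}" by (rule convex_halfspace_Re_le)
  qed (use assms in \<open>auto intro!: derivative_eq_intros\<close>)
  then show "norm (exp z - exp w) \<le> norm (z - w)" by simp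
  have "norm (exp z - exp w) \<le> norm (exp z) + norm (exp w)" by (rule norm_triangle_ineq4)
  also have "\<dots> \<le> 1 + 1" using assms by (intro add_mono) auto
  finally show "norm (exp z - exp w) \<le> 2" by simp
qed

text \<open>Both sides are compared with \<open>2 * y / (1 + y)\<close>, using
  \<open>exp y \<ge> 1 + y\<close>.\<close>

lemma min_1_le_exp: "0 \<le> y \<Longrightarrow> min 1 y \<le> 2 * (1 - exp (- y))" for y :: real
proof -
  assume y: "0 \<le> y"
  have "exp (-y) \<le> 1 / (1 + y)"
    using exp_ge_add_one_self[of y] y by (simp add: exp_minus field_simps)
  then have "2 * (1 - exp (-y)) \<ge> 2 * y / (1 + y)" using y by (simp add: field_simps)
  moreover have "2 * y / (1 + y) \<ge> min 1 y"
    using y by (cases "y \<le> 1") (auto simp: field_simps min_def mult_left_le)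
  ultimately show ?thesis by linarith
qed

text \<open>The Laplace transform of the first marginal. The quantity \<open>1 - lap M d\<close>
  controls the tail of the first coordinate as well as the dependence of the transform on
  \<open>fst u\<close>.\<close>

definition lap :: "(real \<times> real) measure \<Rightarrow> real \<Rightarrow> real" where
  "lap M d = (\<integral>\<xi>. exp (- d * fst \<xi>) \<partial>M)"

lemma fst_snd_measurable_D:
  assumes "sets M = sets borel_D"
  shows "fst \<in> borel_measurable M" "snd \<in> borel_measurable M"
  by (rule borel_measurable_on_D[OF assms borel_measurable_continuous_onI], intro continuous_intros)+

lemma transform_eq_lap: "transform M (complex_of_real (- d), 0) = complex_of_real (lap M d)"
  unfolding transform_def lap_def
  by (subst integral_complex_of_real[symmetric], rule Bochner_Integration.integral_cong)
    (simp_all add: pairing_def exp_of_real[symmetric])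

lemma integrable_lap:
  assumes M: "finite_measure M" "sets M = sets borel_D" and d: "0 \<le> d"
  shows "integrable M (\<lambda>\<xi>. exp (- d * fst \<xi>))"
proof -
  note [measurable] = fst_snd_measurable_D[OF M(2)]
  show ?thesis using d by (intro integrable_bounded_on_D[OF M, where B=1]) (auto simp: state_D_def)
qed

lemma integral_one_minus_exp:
  assumes M: "M \<in> space (prob_algebra borel_D)" and d: "0 \<le> d"
  shows "(\<integral>\<xi>. 1 - exp (- d * fst \<xi>) \<partial>M) = 1 - lap M d" "integrable M (\<lambda>\<xi>. 1 - exp (- d * fst \<xi>))"
proof -
  interpret prob_space M using M by (auto dest: prob_algebra_D)
  show "(\<integral>\<xi>. 1 - exp (- d * fst \<xi>) \<partial>M) = 1 - lap M d" "integrable M (\<lambda>\<xi>. 1 - exp (- d * fst \<xi>))"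
    using integrable_lap[OF finite_measure_axioms prob_algebra_D(2)[OF M] d] prob_space
    by (auto simp: lap_def)
qed

text \<open>Where \<open>fst \<xi> > R\<close>, the bound \<open>min_1_le_exp\<close> at
  \<open>y = fst \<xi> / R\<close> reads \<open>1 \<le> 2 * (1 - exp (- y))\<close>.\<close>

lemma measure_fst_tail_le:
  assumes M: "M \<in> space (prob_algebra borel_D)" and R: "0 < R"
  shows "measure M {\<xi>\<in>state_D. R < fst \<xi>} \<le> 2 * (1 - lap M (1 / R))"
proof -
  interpret prob_space M using M by (auto dest: prob_algebra_D)
  note sM = prob_algebra_D(2)[OF M]
  note [measurable] = fst_snd_measurable_D[OF sM]
  have sp: "space M = state_D" using space_of_sets_borel_D[OF sM] .
  have S: "{\<xi>\<in>state_D. R < fst \<xi>} \<in> sets M"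
    unfolding sp[symmetric] by measurable
  have "measure M {\<xi>\<in>state_D. R < fst \<xi>} = (\<integral>\<xi>. indicator {\<xi>\<in>state_D. R < fst \<xi>} \<xi> \<partial>M)"
    using S by simp
  also have "\<dots> \<le> (\<integral>\<xi>. 2 * (1 - exp (- (1 / R) * fst \<xi>)) \<partial>M)"
  proof (rule integral_mono)
    show "integrable M (indicat_real {\<xi>\<in>state_D. R < fst \<xi>})" using S by (simp add: less_top[symmetric])
    show "integrable M (\<lambda>\<xi>. 2 * (1 - exp (- (1 / R) * fst \<xi>)))"
      using R by (intro integrable_mult_right integral_one_minus_exp[OF M]) simp
    fix \<xi> assume "\<xi> \<in> space M"
    then have "0 \<le> fst \<xi>" by (auto simp: sp state_D_def)
    then show "indicat_real {\<xi>\<in>state_D. R < fst \<xi>} \<xi> \<le> 2 * (1 - exp (- (1 / R) * fst \<xi>))"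
      using R min_1_le_exp[of "(1 / R) * fst \<xi>"] by (auto split: split_indicator simp: min_def field_simps split: if_splits)
  qed
  also have "\<dots> = 2 * (1 - lap M (1 / R))"
    using R by (simp only: integral_mult_right_zero integral_one_minus_exp(1)[OF M] zero_le_divide_1_iff less_imp_le)
  finally show ?thesis .
qed

text \<open>A modulus of continuity that sees the law only through \<open>lap\<close>, hence is
  uniform over the laws \<open>P n\<close> of \<open>root_exists\<close>. The constant 4 comes from
  \<open>min (d x) 2 \<le> 2 * min 1 (d x) \<le> 4 * (1 - exp (- d x))\<close>.\<close>

lemma norm_transform_diff_le_lap:
  assumes M: "M \<in> space (prob_algebra borel_D)"
    and v: "Re v \<le> 0" "norm v \<le> d" and w: "Re w = 0"
  shows "norm (transform M (v, w) - transform M (0, w)) \<le> 4 * (1 - lap M d)"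
proof -
  interpret prob_space M using M by (auto dest: prob_algebra_D)
  note sM = prob_algebra_D(2)[OF M]
  have d: "0 \<le> d" using v(2) norm_ge_zero order_trans by blast
  have sp: "space M = state_D" using space_of_sets_borel_D[OF sM] .
  have U: "(v, w) \<in> dom_U" "(0, w) \<in> dom_U" using v w by (auto intro: dom_UI)
  note int = integrable_exp_pairing[OF finite_measure_axioms sM U(1)] integrable_exp_pairing[OF finite_measure_axioms sM U(2)]
  have "norm (transform M (v, w) - transform M (0, w)) = norm (\<integral>\<xi>. exp (pairing (v, w) \<xi>) - exp (pairing (0, w) \<xi>) \<partial>M)"
    unfolding transform_def using int by simp
  also have "\<dots> \<le> (\<integral>\<xi>. norm (exp (pairing (v, w) \<xi>) - exp (pairing (0, w) \<xi>)) \<partial>M)" by (rule integral_norm_bound)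
  also have "\<dots> \<le> (\<integral>\<xi>. 4 * (1 - exp (- d * fst \<xi>)) \<partial>M)"
  proof (rule integral_mono)
    show "integrable M (\<lambda>\<xi>. norm (exp (pairing (v, w) \<xi>) - exp (pairing (0, w) \<xi>)))" using int by (intro integrable_norm Bochner_Integration.integrable_diff)
    show "integrable M (\<lambda>\<xi>. 4 * (1 - exp (- d * fst \<xi>)))"
      using d by (intro integrable_mult_right integral_one_minus_exp[OF M])
    fix \<xi> assume \<xi>: "\<xi> \<in> space M"
    then have x: "0 \<le> fst \<xi>" "\<xi> \<in> state_D" by (auto simp: sp state_D_def)
    have "norm (exp (pairing (v, w) \<xi>) - exp (pairing (0, w) \<xi>)) \<le> min (norm (pairing (v, w) \<xi> - pairing (0, w) \<xi>)) 2"
      using norm_exp_diff_le[OF Re_pairing_nonpos[OF U(1) x(2)] Re_pairing_nonpos[OF U(2) x(2)]] by simp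
    also have "norm (pairing (v, w) \<xi> - pairing (0, w) \<xi>) = norm v * fst \<xi>"
      using x by (simp add: pairing_def norm_mult)
    also have "min (norm v * fst \<xi>) 2 \<le> 2 * min 1 (d * fst \<xi>)"
      using mult_right_mono[OF v(2) x(1)] mult_nonneg_nonneg[OF d x(1)] by (auto simp: min_def)
    also have "\<dots> \<le> 2 * (2 * (1 - exp (- (d * fst \<xi>))))"
      using d x by (intro mult_left_mono min_1_le_exp) auto
    finally show "norm (exp (pairing (v, w) \<xi>) - exp (pairing (0, w) \<xi>)) \<le> 4 * (1 - exp (- d * fst \<xi>))" by simp
  qed
  also have "\<dots> = 4 * (1 - lap M d)"
    by (simp only: integral_mult_right_zero integral_one_minus_exp(1)[OF M d])
  finally show ?thesis .
qed

lemma transform_near_1: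
  assumes M: "M \<in> space (prob_algebra borel_D)" and "\<epsilon> > 0"
  obtains d where "d > 0" "1 - norm (transform M (complex_of_real (- d), 0)) < \<epsilon>"
proof -
  have "continuous_on dom_U (transform M)"
    using M by (intro continuous_on_transform) (auto dest: prob_algebra_D)
  then obtain \<delta> where \<delta>: "\<delta> > 0" "\<And>u. u \<in> dom_U \<Longrightarrow> dist u 0 < \<delta> \<Longrightarrow> dist (transform M u) (transform M 0) < \<epsilon>"
    using \<open>\<epsilon> > 0\<close> unfolding continuous_on_iff by (metis zero_in_dom_U(1))
  define d where "d = \<delta> / 2"
  have "dist (transform M (complex_of_real (- d), 0)) 1 < \<epsilon>"
    using \<delta>(2)[of "(complex_of_real (- d), 0)"] \<delta>(1) by (simp add: dom_UI d_def dist_norm norm_Pair transform_0[OF M])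
  then have "1 - norm (transform M (complex_of_real (- d), 0)) < \<epsilon>"
    using norm_triangle_ineq2[of 1 "transform M (complex_of_real (- d), 0)"] by (simp add: dist_norm norm_minus_commute)
  with \<delta>(1) show thesis by (intro that[of d]) (auto simp: d_def)
qed

lemma tendsto_integral_min_0:
  fixes f :: "'a \<Rightarrow> real"
  assumes "finite_measure M" and [measurable]: "f \<in> borel_measurable M" and f: "\<And>x. 0 \<le> f x"
  shows "(\<lambda>k. \<integral>x. min 2 (f x / real (Suc k)) \<partial>M) \<longlonglongrightarrow> 0"
proof -
  interpret finite_measure M by fact
  have "(\<lambda>k. \<integral>x. min 2 (f x / real (Suc k)) \<partial>M) \<longlonglongrightarrow> (\<integral>x. 0 \<partial>M)"
  proof (rule integral_dominated_convergence[where w="\<lambda>_. 2"])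
    show "AE x in M. (\<lambda>k. min 2 (f x / real (Suc k))) \<longlonglongrightarrow> 0"
    proof (intro AE_I2)
      fix x
      have "(\<lambda>k. f x / real (Suc k)) \<longlonglongrightarrow> 0"
        by (intro LIMSEQ_Suc lim_const_over_n)
      then have "(\<lambda>k. min 2 (f x / real (Suc k))) \<longlonglongrightarrow> min 2 0" by (intro tendsto_intros)
      then show "(\<lambda>k. min 2 (f x / real (Suc k))) \<longlonglongrightarrow> 0" by simp
    qed
  qed (auto simp: f)
  then show ?thesis by simp
qed

lemma bounded_exp_pairing: "u \<in> dom_U \<Longrightarrow> bounded ((\<lambda>\<xi>. exp (pairing u \<xi>)) ` state_D)"
  using norm_exp_pairing_le by (intro boundedI[of _ 1]) blast

text \<open>Weak convergence handles the fixed argument \<open>u\<close>. Once \<open>v n\<close> is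
  within \<open>1 / Suc k\<close> of \<open>u\<close>, the error is at most the integral of a fixed
  bounded continuous function \<open>h\<close>; this integral is small under the limit, hence
  eventually under \<open>P n\<close>.\<close>

lemma transform_tendsto_moving:
  fixes P :: "nat \<Rightarrow> (real \<times> real) measure"
  assumes P: "\<And>n. finite_measure (P n)" "\<And>n. sets (P n) = sets borel_D"
    and N: "finite_measure N" "sets N = sets borel_D"
    and conv: "\<And>f :: real \<times> real \<Rightarrow> complex. continuous_on state_D f \<Longrightarrow> bounded (f ` state_D) \<Longrightarrow>
       (\<lambda>n. \<integral>\<xi>. f \<xi> \<partial>P n) \<longlonglongrightarrow> (\<integral>\<xi>. f \<xi> \<partial>N)"
    and v: "\<And>n. v n \<in> dom_U" "v \<longlonglongrightarrow> u" and u: "u \<in> dom_U"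
  shows "(\<lambda>n. transform (P n) (v n)) \<longlonglongrightarrow> transform N u"
proof -
  have fixed: "(\<lambda>n. transform (P n) u) \<longlonglongrightarrow> transform N u"
    unfolding transform_def by (intro conv continuous_intros bounded_exp_pairing u)
  define f where "f \<xi> = \<bar>fst \<xi>\<bar> + \<bar>snd \<xi>\<bar>" for \<xi> :: "real \<times> real"
  have f_nn: "0 \<le> f \<xi>" for \<xi> by (simp add: f_def)
  have f_cont: "continuous_on state_D f" unfolding f_def by (intro continuous_intros)
  have "(\<lambda>n. transform (P n) (v n) - transform (P n) u) \<longlonglongrightarrow> 0"
  proof (rule tendstoI)
    fix \<epsilon> :: real assume "\<epsilon> > 0"
    have "(\<lambda>k. \<integral>\<xi>. min 2 (f \<xi> / real (Suc k)) \<partial>N) \<longlonglongrightarrow> 0"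
      by (intro tendsto_integral_min_0 N continuous_on_D_measurable f_cont f_nn)
    then obtain k where k: "(\<integral>\<xi>. min 2 (f \<xi> / real (Suc k)) \<partial>N) < \<epsilon>"
      using order_tendstoD(2)[of _ 0 sequentially \<epsilon>] \<open>\<epsilon> > 0\<close> by (meson eventually_happens trivial_limit_sequentially)
    define h where "h \<xi> = min 2 (f \<xi> / real (Suc k))" for \<xi>
    have h_cont: "continuous_on state_D h" unfolding h_def by (intro continuous_intros f_cont) auto
    have h_bd: "norm (h \<xi>) \<le> 2" for \<xi> using f_nn[of \<xi>] by (simp add: h_def)
    have "(\<lambda>n. \<integral>\<xi>. complex_of_real (h \<xi>) \<partial>P n) \<longlonglongrightarrow> (\<integral>\<xi>. complex_of_real (h \<xi>) \<partial>N)"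
      using h_bd by (intro conv continuous_intros h_cont boundedI[of _ 2]) auto
    then have "(\<lambda>n. \<integral>\<xi>. h \<xi> \<partial>P n) \<longlonglongrightarrow> (\<integral>\<xi>. h \<xi> \<partial>N)" by (simp add: tendsto_of_real_iff)
    then have ev1: "\<forall>\<^sub>F n in sequentially. (\<integral>\<xi>. h \<xi> \<partial>P n) < \<epsilon>"
      using k unfolding h_def[symmetric] by (rule order_tendstoD)
    have ev2: "\<forall>\<^sub>F n in sequentially. dist (v n) u < 1 / real (Suc k)"
      using v(2) by (rule tendstoD) simp
    show "\<forall>\<^sub>F n in sequentially. dist (transform (P n) (v n) - transform (P n) u) 0 < \<epsilon>"
      using ev1 ev2
    proof eventually_elim
      case (elim n)
      interpret finite_measure "P n" by (rule P)
      have sp: "space (P n) = state_D" using space_of_sets_borel_D[OF P(2)] .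
      note int = integrable_exp_pairing[OF finite_measure_axioms P(2) v(1)] integrable_exp_pairing[OF finite_measure_axioms P(2) u]
      have "norm (transform (P n) (v n) - transform (P n) u) = norm (\<integral>\<xi>. exp (pairing (v n) \<xi>) - exp (pairing u \<xi>) \<partial>P n)"
        unfolding transform_def using int by simp
      also have "\<dots> \<le> (\<integral>\<xi>. norm (exp (pairing (v n) \<xi>) - exp (pairing u \<xi>)) \<partial>P n)" by (rule integral_norm_bound)
      also have "\<dots> \<le> (\<integral>\<xi>. h \<xi> \<partial>P n)"
      proof (rule integral_mono)
        show "integrable (P n) (\<lambda>\<xi>. norm (exp (pairing (v n) \<xi>) - exp (pairing u \<xi>)))"
          using int by (intro integrable_norm Bochner_Integration.integrable_diff)
        show "integrable (P n) h"
          using h_bd by (intro integrable_bounded_on_D[OF finite_measure_axioms P(2), where B=2] continuous_on_D_measurable[OF P(2)] h_cont)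
        fix \<xi> assume "\<xi> \<in> space (P n)"
        then have \<xi>: "\<xi> \<in> state_D" by (simp add: sp)
        have "norm (fst (v n) - fst u) \<le> 1 / real (Suc k)" "norm (snd (v n) - snd u) \<le> 1 / real (Suc k)"
          using dist_fst_le[of "v n" u] dist_snd_le[of "v n" u] elim(2) unfolding dist_norm by linarith+
        then have "norm (fst (v n) - fst u) * \<bar>fst \<xi>\<bar> + norm (snd (v n) - snd u) * \<bar>snd \<xi>\<bar> \<le> 1 / real (Suc k) * \<bar>fst \<xi>\<bar> + 1 / real (Suc k) * \<bar>snd \<xi>\<bar>"
          by (intro add_mono mult_right_mono) auto
        moreover have "norm (pairing (v n) \<xi> - pairing u \<xi>) \<le> norm (fst (v n) - fst u) * \<bar>fst \<xi>\<bar> + norm (snd (v n) - snd u) * \<bar>snd \<xi>\<bar>"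
        proof -
          have "pairing (v n) \<xi> - pairing u \<xi> = (fst (v n) - fst u) * of_real (fst \<xi>) + (snd (v n) - snd u) * of_real (snd \<xi>)"
            by (simp add: pairing_def algebra_simps)
          then show ?thesis using norm_triangle_ineq[of "(fst (v n) - fst u) * of_real (fst \<xi>)" "(snd (v n) - snd u) * of_real (snd \<xi>)"]
            by (simp add: norm_mult)
        qed
        ultimately have "norm (pairing (v n) \<xi> - pairing u \<xi>) \<le> f \<xi> / real (Suc k)"
          by (simp add: f_def add_divide_distrib)
        then show "norm (exp (pairing (v n) \<xi>) - exp (pairing u \<xi>)) \<le> h \<xi>"
          using norm_exp_diff_le[OF Re_pairing_nonpos[OF v(1) \<xi>] Re_pairing_nonpos[OF u \<xi>]] unfolding h_def
          by (meson min.boundedI order_trans)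
      qed
      finally show ?case using elim(1) by simp
    qed
  qed
  from tendsto_add[OF this fixed] show ?thesis by simp
qed

text \<open>If all independent summands are at least \<open>K\<close>, their sum is at least
  \<open>m K\<close>, so a tail of the sum bounds the product of the tails of the summands. In
  \<open>root_exists\<close> this gives tightness of a single summand.\<close>

lemma sum_distribution_exists:
  assumes "\<And>i. i < (m::nat) \<Longrightarrow> real_distribution (\<nu> i)"
  shows "\<exists>W. real_distribution W \<and> (\<forall>\<theta>. char W \<theta> = (\<Prod>i<m. char (\<nu> i) \<theta>)) \<and>
    (\<forall>K. (\<Prod>i<m. measure (\<nu> i) {K..}) \<le> measure W {real m * K..} \<and>
         (\<Prod>i<m. measure (\<nu> i) {..-K}) \<le> measure W {..-(real m * K)})"
  using assms
proof (induction m)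
  case 0
  interpret prob_space "return borel (0::real)" by (simp add: prob_space_return)
  have "real_distribution (return borel 0)" 
    by (intro real_distribution.intro real_distribution_axioms.intro prob_space_axioms) auto
  then show ?case
    by (intro exI[of _ "return borel 0"]) (auto simp: char_def integral_return measure_return)
next
  case (Suc m)
  then obtain W where W: "real_distribution W" "\<And>\<theta>. char W \<theta> = (\<Prod>i<m. char (\<nu> i) \<theta>)"
    "\<And>K. (\<Prod>i<m. measure (\<nu> i) {K..}) \<le> measure W {real m * K..}"
    "\<And>K. (\<Prod>i<m. measure (\<nu> i) {..-K}) \<le> measure W {..-(real m * K)}"
    by (auto simp: less_Suc_eq)
  interpret W: real_distribution W by fact
  interpret V: real_distribution "\<nu> m" using Suc.prems by simp
  interpret pair_prob_space W "\<nu> m" ..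
  define S where "S = distr (W \<Otimes>\<^sub>M \<nu> m) borel (\<lambda>(x, y). x + y)"
  have [measurable]: "(\<lambda>(x, y). x + y) \<in> W \<Otimes>\<^sub>M \<nu> m \<rightarrow>\<^sub>M borel" by measurable
  have "prob_space S" unfolding S_def by (rule prob_space_distr) measurable
  then have rS: "real_distribution S"
    by (intro real_distribution.intro real_distribution_axioms.intro) (auto simp: S_def)
  have chS: "char S \<theta> = char W \<theta> * char (\<nu> m) \<theta>" for \<theta>
  proof -
    have int: "integrable (W \<Otimes>\<^sub>M \<nu> m) (\<lambda>p. iexp (\<theta> * (case p of (x, y) \<Rightarrow> x + y)))"
      by (rule P.integrable_const_bound[where B=1]) auto
    have "char S \<theta> = (\<integral>p. iexp (\<theta> * (case p of (x, y) \<Rightarrow> x + y)) \<partial>(W \<Otimes>\<^sub>M \<nu> m))"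
      unfolding S_def char_def by (rule integral_distr) measurable
    also have "\<dots> = (\<integral>x. \<integral>y. iexp (\<theta> * x) * iexp (\<theta> * y) \<partial>\<nu> m \<partial>W)"
      by (subst integral_fst'[OF int, symmetric]) (simp add: distrib_left exp_add)
    finally show ?thesis by (simp add: char_def)
  qed
  have rect: "measure W A * measure (\<nu> m) B \<le> measure S C"
    if [measurable]: "A \<in> sets borel" "B \<in> sets borel" "C \<in> sets borel" and sub: "\<And>x y. x \<in> A \<Longrightarrow> y \<in> B \<Longrightarrow> x + y \<in> C" for A B C
  proof -
    have "measure W A * measure (\<nu> m) B = measure (W \<Otimes>\<^sub>M \<nu> m) (A \<times> B)"
      by (simp add: measure_def V.emeasure_pair_measure_Times enn2real_mult)
    also have "\<dots> \<le> measure (W \<Otimes>\<^sub>M \<nu> m) ((\<lambda>(x, y). x + y) -` C \<inter> space (W \<Otimes>\<^sub>M \<nu> m))"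
      using sub by (intro P.finite_measure_mono measurable_sets[where A=borel]) (auto simp: space_pair_measure)
    also have "\<dots> = measure S C"
      unfolding S_def by (subst measure_distr) auto
    finally show ?thesis .
  qed
  show ?case
  proof (intro exI[of _ S] conjI allI rS)
    show "char S \<theta> = (\<Prod>i<Suc m. char (\<nu> i) \<theta>)" for \<theta> by (simp add: chS W)
    fix K :: real
    have "(\<Prod>i<Suc m. measure (\<nu> i) {K..}) \<le> measure W {real m * K..} * measure (\<nu> m) {K..}"
      using W(3)[of K] by (simp add: mult_right_mono)
    also have "\<dots> \<le> measure S {real (Suc m) * K..}"
      by (rule rect) (auto simp: algebra_simps)
    finally show "(\<Prod>i<Suc m. measure (\<nu> i) {K..}) \<le> measure S {real (Suc m) * K..}" .
    have "(\<Prod>i<Suc m. measure (\<nu> i) {..-K}) \<le> measure W {..-(real m * K)} * measure (\<nu> m) {..-K}"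
      using W(4)[of K] by (simp add: mult_right_mono)
    also have "\<dots> \<le> measure S {..-(real (Suc m) * K)}"
      by (rule rect) (auto simp: algebra_simps)
    finally show "(\<Prod>i<Suc m. measure (\<nu> i) {..-K}) \<le> measure S {..-(real (Suc m) * K)}" .
  qed
qed

text \<open>The continuous function \<open>f k\<close> vanishes on \<open>[-k, k]\<close> and
  dominates the indicator of \<open>\<bar>x\<bar> \<ge> k + 1\<close>. Its integral under the limit
  law tends to 0 as \<open>k\<close> grows, and weak convergence transfers the bound to
  \<open>W n\<close>.\<close>

lemma weak_conv_tail:
  assumes W: "\<And>n. real_distribution (W n)" and G: "real_distribution G" and conv: "weak_conv_m W G" and "\<epsilon> > 0"
  obtains k where "k > 0" "\<forall>\<^sub>F n in sequentially. measure (W n) {k..} \<le> \<epsilon> \<and> measure (W n) {..-k} \<le> \<epsilon>"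
proof -
  interpret G: real_distribution G by fact
  define f where "f k x = min 1 (max 0 (\<bar>x\<bar> - real k))" for k x
  have f_cont: "continuous_on UNIV (f k)" for k unfolding f_def by (intro continuous_intros)
  have f_meas: "f k \<in> borel_measurable borel" for k using f_cont by (rule borel_measurable_continuous_onI)
  have f_bd: "norm (f k x) \<le> 1" and f_nn: "0 \<le> f k x" for k x by (auto simp: f_def)
  have "(\<lambda>k. \<integral>x. f k x \<partial>G) \<longlonglongrightarrow> (\<integral>x. 0 \<partial>G)"
  proof (rule integral_dominated_convergence[where w="\<lambda>_. 1"])
    show "AE x in G. (\<lambda>k. f k x) \<longlonglongrightarrow> 0"
    proof (intro AE_I2 tendsto_eventually)
      fix x
      have "\<forall>\<^sub>F k in sequentially. \<bar>x\<bar> \<le> real k"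
        using eventually_ge_at_top[of "nat \<lceil>\<bar>x\<bar>\<rceil>"] by eventually_elim linarith
      then show "\<forall>\<^sub>F k in sequentially. f k x = 0"
        by eventually_elim (simp add: f_def)
    qed
  qed (use f_bd f_meas in auto)
  then have "\<forall>\<^sub>F k in sequentially. (\<integral>x. f k x \<partial>G) < \<epsilon>"
    using \<open>\<epsilon> > 0\<close> by (intro order_tendstoD) auto
  then obtain k where k: "(\<integral>x. f k x \<partial>G) < \<epsilon>" using eventually_happens by force
  have "(\<lambda>n. \<integral>x. f k x \<partial>W n) \<longlonglongrightarrow> (\<integral>x. f k x \<partial>G)"
    using f_cont f_bd by (intro weak_conv_imp_integral_bdd_continuous_conv[OF W G conv, where B=1])
      (auto simp: continuous_on_eq_continuous_at)
  then have ev: "\<forall>\<^sub>F n in sequentially. (\<integral>x. f k x \<partial>W n) < \<epsilon>" using k by (rule order_tendstoD)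
  show thesis
  proof (rule that[of "real k + 1"])
    show "\<forall>\<^sub>F n in sequentially. measure (W n) {real k + 1..} \<le> \<epsilon> \<and> measure (W n) {..-(real k + 1)} \<le> \<epsilon>"
      using ev
    proof eventually_elim
      case (elim n)
      interpret real_distribution "W n" by (rule W)
      have *: "measure (W n) A \<le> \<epsilon>" if A: "A \<in> sets borel" "\<And>x. x \<in> A \<Longrightarrow> real k + 1 \<le> \<bar>x\<bar>" for A
      proof -
        have "measure (W n) A = (\<integral>x. indicator A x \<partial>W n)" using A by simp
        also have "\<dots> \<le> (\<integral>x. f k x \<partial>W n)"
        proof (rule integral_mono)
          show "integrable (W n) (indicat_real A)" using A by (simp add: less_top[symmetric])
          show "integrable (W n) (f k)"
            using f_bd f_meas by (intro integrable_const_bound[where B=1]) auto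
          show "indicat_real A x \<le> f k x" for x
            using A(2)[of x] f_nn[of k x] by (auto simp: f_def split: split_indicator)
        qed
        finally show ?thesis using elim by simp
      qed
      show ?case by (intro conjI *) auto
    qed
  qed simp
qed

section \<open>Infinite divisibility\<close>

text \<open>One exponential would determine the limit only up to periods. Real parts follow from
  moduli. For imaginary parts, the characteristic functions of the point masses at
  \<open>Im (z n)\<close> converge, so these laws converge weakly, and the bounded injective test
  function \<open>arctan\<close> recovers their positions.\<close>

lemma tendsto_of_exp_multiples:
  fixes z :: "nat \<Rightarrow> complex"
  assumes lim: "\<And>x::real. x \<ge> 0 \<Longrightarrow> (\<lambda>n. exp (of_real x * z n)) \<longlonglongrightarrow> exp (of_real x * w)"
  shows "z \<longlonglongrightarrow> w"
proof -
  have "(\<lambda>n. ln (norm (exp (of_real 1 * z n)))) \<longlonglongrightarrow> ln (norm (exp (of_real 1 * w)))"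
    by (intro tendsto_ln tendsto_norm lim) auto
  then have re: "(\<lambda>n. Re (z n)) \<longlonglongrightarrow> Re w" by simp
  have split: "iexp (t * Im v) = exp (of_real t * v) / exp (of_real (t * Re v))" for t and v :: complex
  proof -
    have "\<i> * of_real (t * Im v) = of_real t * v - of_real (t * Re v)" by (simp add: complex_eq_iff)
    then show ?thesis by (simp only: exp_diff)
  qed
  have pos: "(\<lambda>n. iexp (t * Im (z n))) \<longlonglongrightarrow> iexp (t * Im w)" if "t \<ge> 0" for t
    unfolding split by (intro tendsto_divide lim that tendsto_exp tendsto_of_real tendsto_mult tendsto_const re) simp
  have cnj: "iexp (t * a) = cnj (iexp ((- t) * a))" for t a by (simp add: exp_cnj)
  have all: "(\<lambda>n. iexp (t * Im (z n))) \<longlonglongrightarrow> iexp (t * Im w)" for t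
  proof (cases "t \<ge> 0")
    case True then show ?thesis by (rule pos)
  next
    case False
    then show ?thesis unfolding cnj[of t] by (intro tendsto_cnj pos) simp
  qed
  have ch: "char (return borel a) t = iexp (t * a)" for a t
    unfolding char_def by (subst integral_return) auto
  have rd: "real_distribution (return borel a)" for a :: real
    by (intro real_distribution.intro real_distribution_axioms.intro prob_space_return) auto
  have "weak_conv_m (\<lambda>n. return borel (Im (z n))) (return borel (Im w))"
    by (rule levy_continuity[OF rd rd]) (simp only: ch all)
  moreover have "norm (arctan x) \<le> pi / 2" for x
    using arctan_lbound[of x] arctan_ubound[of x] unfolding real_norm_def by linarith
  ultimately have "(\<lambda>n. \<integral>x. arctan x \<partial>return borel (Im (z n))) \<longlonglongrightarrow> (\<integral>x. arctan x \<partial>return borel (Im w))"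
    by (rule weak_conv_imp_integral_bdd_continuous_conv[OF rd rd _ isCont_arctan])
  then have "(\<lambda>n. arctan (Im (z n))) \<longlonglongrightarrow> arctan (Im w)"
    by (simp add: integral_return)
  then have "(\<lambda>n. tan (arctan (Im (z n)))) \<longlonglongrightarrow> tan (arctan (Im w))"
    by (rule isCont_tendsto_compose[OF isCont_tan, rotated]) simp
  then have im: "(\<lambda>n. Im (z n)) \<longlonglongrightarrow> Im w" by (simp add: tan_arctan)
  show ?thesis using re im by (rule tendsto_complex_iff[THEN iffD2, OF conjI])
qed

lemma eq_0_of_exp_multiples:
  fixes z :: complex
  assumes "\<And>x::real. x \<ge> 0 \<Longrightarrow> exp (of_real x * z) = 1"
  shows "z = 0"
proof -
  \<comment> \<open>Small enough to keep \<open>x * Im z\<close> within one period of the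
    exponential.\<close>
  define x where "x = 1 / (1 + \<bar>Im z\<bar>)"
  have x: "x > 0" by (simp add: x_def add_pos_nonneg)
  have "\<bar>x * Im z\<bar> \<le> 1" by (simp add: x_def abs_mult field_simps)
  then have "\<bar>Im (of_real x * z) - Im 0\<bar> < 2 * pi" using pi_gt3 by simp
  moreover have "exp (of_real x * z) = exp 0" using assms[of x] x by simp
  ultimately have "of_real x * z = 0" by (rule exp_complex_eqI)
  with x show ?thesis by simp
qed

text \<open>Points of the two nonnegative half-axes separate the components.\<close>

lemma exp_pairing_inject:
  assumes "\<And>x. x \<in> state_D \<Longrightarrow> exp (pairing v x) = exp (pairing w x)"
  shows "v = w"
proof -
  have "exp (of_real x * (fst v - fst w)) = 1" "exp (of_real x * (snd v - snd w)) = 1" if "x \<ge> 0" for x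
    using assms[of "(x, 0)"] assms[of "(0, x)"] that
    by (simp_all add: pairing_def state_D_def right_diff_distrib exp_diff mult.commute)
  then have "fst v - fst w = 0" "snd v - snd w = 0" by (blast intro: eq_0_of_exp_multiples)+
  then show ?thesis by (simp add: prod_eq_iff)
qed

lemma continuous_on_transform_time:
  assumes M: "\<And>t. t \<ge> 0 \<Longrightarrow> M t \<in> space (prob_algebra borel_D)" and wc: "weakly_continuous M" and u: "u \<in> dom_U"
  shows "continuous_on {0..} (\<lambda>t. transform (M t) u)"
proof -
  have eq: "transform (M t) u = of_real (\<integral>\<xi>. Re (exp (pairing u \<xi>)) \<partial>M t) + \<i> * of_real (\<integral>\<xi>. Im (exp (pairing u \<xi>)) \<partial>M t)"
    if "t \<in> {0..}" for t
    using integrable_exp_pairing[OF prob_algebra_D(3) prob_algebra_D(2) u, OF M M] that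
    by (simp add: transform_def complex_eq_iff del: Re_exp Im_exp)
  have bd: "\<bar>Re (exp (pairing u \<xi>))\<bar> \<le> 1" "\<bar>Im (exp (pairing u \<xi>))\<bar> \<le> 1" if "\<xi> \<in> state_D" for \<xi>
    using norm_exp_pairing_le[OF u that] abs_Re_le_cmod[of "exp (pairing u \<xi>)"] abs_Im_le_cmod[of "exp (pairing u \<xi>)"] by linarith+
  have "continuous_on {0..} (\<lambda>t. \<integral>\<xi>. Re (exp (pairing u \<xi>)) \<partial>M t)" "continuous_on {0..} (\<lambda>t. \<integral>\<xi>. Im (exp (pairing u \<xi>)) \<partial>M t)"
    by (intro wc[unfolded weakly_continuous_def, rule_format] conjI continuous_intros boundedI[of _ 1]; use bd in force)+
  then have "continuous_on {0..} (\<lambda>t. complex_of_real (\<integral>\<xi>. Re (exp (pairing u \<xi>)) \<partial>M t) + \<i> * of_real (\<integral>\<xi>. Im (exp (pairing u \<xi>)) \<partial>M t))"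
    by (intro continuous_intros)
  then show ?thesis by (subst continuous_on_cong[OF refl eq])
qed

section \<open>The exponents as a continuous flow on \<open>dom_U\<close>\<close>

locale affine_semigroup =
  fixes Q :: "real \<Rightarrow> real \<times> real \<Rightarrow> (real \<times> real) measure"
    and \<psi> :: "real \<Rightarrow> complex \<times> complex \<Rightarrow> complex \<times> complex"
    and \<beta>11 \<beta>12 \<beta>22 \<alpha> :: "real \<Rightarrow> real" and \<mu> :: "real \<Rightarrow> (real \<times> real) measure"
  assumes regular: "regular_HA_semigroup Q \<psi>"
    and params: "HA_parameters \<psi> \<beta>11 \<beta>12 \<beta>22 \<alpha> \<mu>"
begin

lemma kernel: "t \<ge> 0 \<Longrightarrow> Q t \<in> borel_D \<rightarrow>\<^sub>M prob_algebra borel_D"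
  using regular by (simp add: regular_HA_semigroup_def HA_semigroup_def transition_semigroup_def)

lemma kernel_in: "t \<ge> 0 \<Longrightarrow> x \<in> state_D \<Longrightarrow> Q t x \<in> space (prob_algebra borel_D)"
  using measurable_space[OF kernel, of t x] by (simp add: space_restrict_space)

lemma transform_kernel: "t \<ge> 0 \<Longrightarrow> x \<in> state_D \<Longrightarrow> u \<in> dom_U \<Longrightarrow> transform (Q t x) u = exp (pairing (\<psi> t u) x)"
  using regular by (simp add: regular_HA_semigroup_def HA_semigroup_def transform_def)

lemma snd_psi: "t \<ge> 0 \<Longrightarrow> u \<in> dom_U \<Longrightarrow> snd (\<psi> t u) = of_real (\<beta>22 t) * snd u"
  using params by (simp add: HA_parameters_def)

text \<open>The kernel started at \<open>(1, 0)\<close> has a transform of modulus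
  \<open>exp (Re (fst (\<psi> t u)))\<close>, which is at most 1; the second component stays
  imaginary because \<open>\<beta>22 t\<close> is real.\<close>

lemma psi_in_dom_U: 
  assumes "t \<ge> 0" "u \<in> dom_U"
  shows "\<psi> t u \<in> dom_U"
proof -
  have "norm (exp (pairing (\<psi> t u) (1, 0))) \<le> 1"
    using norm_transform_le_1[OF kernel_in assms(2), of t "(1, 0)"] transform_kernel[OF assms(1) _ assms(2), of "(1, 0)"] assms(1)
    by (simp add: state_D_def)
  then have "Re (fst (\<psi> t u)) \<le> 0" by (simp add: pairing_def)
  moreover have "Re (snd (\<psi> t u)) = 0" using snd_psi[OF assms] dom_UD(2)[OF assms(2)] by simp
  ultimately show ?thesis by (simp add: dom_U_def)
qed

lemma psi_time_0: "u \<in> dom_U \<Longrightarrow> \<psi> 0 u = u"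
proof (rule exp_pairing_inject)
  fix x assume "u \<in> dom_U" "x \<in> state_D"
  moreover have "Q 0 x = return borel_D x" if "x \<in> state_D"
    using regular that by (simp add: regular_HA_semigroup_def HA_semigroup_def transition_semigroup_def)
  ultimately show "exp (pairing (\<psi> 0 u) x) = exp (pairing u x)"
    using transform_kernel[of 0 x u] transform_return[of x u] by simp
qed

lemma transform_bind_kernel:
  assumes "M \<in> space (prob_algebra borel_D)" "t \<ge> 0" "u \<in> dom_U"
  shows "transform (bind M (Q t)) u = transform M (\<psi> t u)"
proof -
  have "transform (bind M (Q t)) u = (\<integral>x. transform (Q t x) u \<partial>M)"
    by (rule transform_bind[OF assms(1) kernel[OF assms(2)] assms(3)])
  also have "\<dots> = (\<integral>x. exp (pairing (\<psi> t u) x) \<partial>M)"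
    using assms space_of_sets_borel_D[OF prob_algebra_D(2)[OF assms(1)]]
    by (intro Bochner_Integration.integral_cong refl transform_kernel) auto
  finally show ?thesis by (simp add: transform_def)
qed

lemma psi_semigroup:
  assumes "r \<ge> 0" "t \<ge> 0" "u \<in> dom_U"
  shows "\<psi> (r + t) u = \<psi> r (\<psi> t u)"
proof (rule exp_pairing_inject)
  fix x assume x: "x \<in> state_D"
  have "Q (r + t) x = bind (Q r x) (Q t)"
    using regular assms x by (simp add: regular_HA_semigroup_def HA_semigroup_def transition_semigroup_def)
  then show "exp (pairing (\<psi> (r + t) u) x) = exp (pairing (\<psi> r (\<psi> t u)) x)"
    using transform_kernel[of "r + t" x u] transform_kernel[OF _ x psi_in_dom_U, of r t u]
      transform_bind_kernel[OF kernel_in, of r x t u] assms x by simp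
qed

lemma psi_0: "t \<ge> 0 \<Longrightarrow> \<psi> t 0 = 0"
  using params by (simp add: HA_parameters_def prod_eq_iff LK_exponent_def)

text \<open>Weak continuity of the kernels started on the half-axes makes \<open>exp\<close> of each
  nonnegative multiple of either component continuous in time;
  \<open>tendsto_of_exp_multiples\<close> then removes the exponential.\<close>

lemma continuous_on_psi_time:
  assumes u: "u \<in> dom_U"
  shows "continuous_on {0..} (\<lambda>t. \<psi> t u)"
proof -
  have cont: "continuous_on {0..} (\<lambda>t. exp (pairing (\<psi> t u) x))" if x: "x \<in> state_D" for x
  proof -
    have "weakly_continuous (\<lambda>t. Q t x)" using regular x by (simp add: regular_HA_semigroup_def)
    then have "continuous_on {0..} (\<lambda>t. transform (Q t x) u)"
      by (intro continuous_on_transform_time kernel_in x u) auto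
    then show ?thesis by (rule continuous_on_eq) (simp add: transform_kernel x u)
  qed
  show ?thesis
    unfolding continuous_on_sequentially comp_def
  proof (intro allI ballI impI)
    fix s and a :: real assume a: "a \<in> {0..}" and s: "(\<forall>n. s n \<in> {0..}) \<and> s \<longlonglongrightarrow> a"
    have lim: "(\<lambda>n. exp (pairing (\<psi> (s n) u) x)) \<longlonglongrightarrow> exp (pairing (\<psi> a u) x)" if "x \<in> state_D" for x
      using cont[OF that] s a unfolding continuous_on_sequentially comp_def by blast
    have "(\<lambda>n. fst (\<psi> (s n) u)) \<longlonglongrightarrow> fst (\<psi> a u)"
    proof (rule tendsto_of_exp_multiples)
      fix x :: real assume "x \<ge> 0"
      then show "(\<lambda>n. exp (of_real x * fst (\<psi> (s n) u))) \<longlonglongrightarrow> exp (of_real x * fst (\<psi> a u))"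
        using lim[of "(x, 0)"] by (simp add: pairing_def state_D_def mult.commute)
    qed
    moreover have "(\<lambda>n. snd (\<psi> (s n) u)) \<longlonglongrightarrow> snd (\<psi> a u)"
    proof (rule tendsto_of_exp_multiples)
      fix x :: real assume "x \<ge> 0"
      then show "(\<lambda>n. exp (of_real x * snd (\<psi> (s n) u))) \<longlonglongrightarrow> exp (of_real x * snd (\<psi> a u))"
        using lim[of "(0, x)"] by (simp add: pairing_def state_D_def mult.commute)
    qed
    ultimately show "(\<lambda>n. \<psi> (s n) u) \<longlonglongrightarrow> \<psi> a u"
      using tendsto_Pair[of "\<lambda>n. fst (\<psi> (s n) u)" "fst (\<psi> a u)" sequentially "\<lambda>n. snd (\<psi> (s n) u)" "snd (\<psi> a u)"] by simp
  qed
qed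

lemma psi_tendsto:
  assumes "u \<in> dom_U" "\<And>n. s n \<ge> 0" "s \<longlonglongrightarrow> 0"
  shows "(\<lambda>n. \<psi> (s n) u) \<longlonglongrightarrow> u"
  using continuous_on_psi_time[OF assms(1)] assms(2,3) psi_time_0[OF assms(1)]
  unfolding continuous_on_sequentially comp_def by (metis atLeast_iff order_refl)

end

section \<open>Convolution roots of the laws of a skew convolution semigroup\<close>

locale skew_semigroup = affine_semigroup +
  fixes \<gamma> :: "real \<Rightarrow> (real \<times> real) measure"
  assumes SC: "SC_semigroup Q \<gamma>" and \<gamma>_cont: "weakly_continuous \<gamma>"
begin

lemma \<gamma>_in: "t \<ge> 0 \<Longrightarrow> \<gamma> t \<in> space (prob_algebra borel_D)"
  using SC by (simp add: SC_semigroup_def)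

lemma transform_\<gamma>_add:
  assumes "r \<ge> 0" "t \<ge> 0" "u \<in> dom_U"
  shows "transform (\<gamma> (r + t)) u = transform (\<gamma> r) (\<psi> t u) * transform (\<gamma> t) u"
proof -
  have "\<gamma> (r + t) = conv_D (bind (\<gamma> r) (Q t)) (\<gamma> t)" using SC assms by (simp add: SC_semigroup_def)
  then show ?thesis
    using assms by (simp add: transform_conv_D bind_in_prob_algebra \<gamma>_in kernel transform_bind_kernel)
qed

text \<open>For \<open>r = t = 0\<close> the semigroup relation equates the transform with its
  square. Its values are thus 0 or 1, and continuity on the connected set \<open>dom_U\<close>
  forces the value 1 taken at the origin.\<close>

lemma transform_\<gamma>_0:
  assumes "u \<in> dom_U"
  shows "transform (\<gamma> 0) u = 1"
proof -
  have "transform (\<gamma> 0) v \<in> {0, 1}" if "v \<in> dom_U" for v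
    using transform_\<gamma>_add[of 0 0 v] that by (simp add: psi_time_0)
  then have "transform (\<gamma> 0) ` dom_U \<subseteq> {0, 1}" by blast
  then have "finite (transform (\<gamma> 0) ` dom_U)" by (rule finite_subset) simp
  then have "transform (\<gamma> 0) constant_on dom_U"
    using prob_algebra_D[OF \<gamma>_in[OF order_refl]]
    by (intro continuous_finite_range_constant connected_dom_U continuous_on_transform)
  then show ?thesis
    using assms transform_0[OF \<gamma>_in[of 0]] zero_in_dom_U(1) by (auto simp: constant_on_def)
qed

text \<open>In the splitting \<open>s + n s\<close> the law of the first interval evolves for the
  remaining time \<open>n s\<close>; this is why the factor with index \<open>k\<close> is evaluated
  at \<open>\<psi> (k s) u\<close>.\<close>

lemma transform_\<gamma>_prod:
  assumes "s \<ge> 0" "u \<in> dom_U"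
  shows "transform (\<gamma> (real n * s)) u = (\<Prod>k<n. transform (\<gamma> s) (\<psi> (real k * s) u))"
proof (induction n)
  case 0
  then show ?case by (simp add: transform_\<gamma>_0 assms)
next
  case (Suc n)
  have "real (Suc n) * s = s + real n * s" by (simp add: algebra_simps)
  moreover have "transform (\<gamma> (s + real n * s)) u = transform (\<gamma> s) (\<psi> (real n * s) u) * transform (\<gamma> (real n * s)) u"
    using assms by (intro transform_\<gamma>_add) auto
  ultimately have "transform (\<gamma> (real (Suc n) * s)) u = transform (\<gamma> s) (\<psi> (real n * s) u) * transform (\<gamma> (real n * s)) u"
    by (simp only:)
  then show ?case unfolding Suc by (simp only: prod.lessThan_Suc mult.commute)
qed

text \<open>Divide \<open>[0, t]\<close> into \<open>m (n + 1)\<close> equal intervals and let \<open>P n\<close> be the contribution to \<open>\<gamma> t\<close> of every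
  \<open>m\<close>-th one. Shifting these intervals by \<open>i\<close> steps turns the transform of \<open>P n\<close> at \<open>u\<close> into that at
  \<open>\<psi> (i s) u\<close>, which is close to \<open>u\<close>, so that the \<open>m\<close>-th power of the transform of \<open>P n\<close> nearly is the transform of
  \<open>\<gamma> t\<close>. Tightness of the second coordinate of \<open>P n\<close> is not automatic, since factors are tight only up to
  translations: it follows from the weak convergence of the law of \<open>\<Sum>\<^sub>i \<beta>\<^sub>i Y\<^sub>i\<close>, where the \<open>Y\<^sub>i\<close> are independent
  copies of that coordinate and \<open>\<beta>\<^sub>i = \<beta>22 (i s) \<rightarrow> 1\<close>.\<close>

lemma root_exists:
  assumes t: "t \<ge> 0" and m: "m \<ge> 1"
  obtains N where "N \<in> space (prob_algebra borel_D)" "\<And>u. u \<in> dom_U \<Longrightarrow> transform (\<gamma> t) u = transform N u ^ m"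
proof -
  define s where "s n = t / (real m * (real n + 1))" for n :: nat
  have s_nn: "s n \<ge> 0" for n using t by (simp add: s_def)
  have s_0: "(\<lambda>n. real i * s n) \<longlonglongrightarrow> 0" for i
  proof -
    have "(\<lambda>n. (real i * t / real m) / real (Suc n)) \<longlonglongrightarrow> 0" by (intro LIMSEQ_Suc lim_const_over_n)
    then show ?thesis by (simp add: s_def field_simps)
  qed
  have s_total: "real ((n + 1) * m) * s n = t" for n
  proof -
    have "real ((n + 1) * m) = real m * (real n + 1)" by (simp add: algebra_simps)
    moreover have "real n + 1 \<noteq> 0" by linarith
    then have "real m * (real n + 1) \<noteq> 0" using m by simp
    ultimately show ?thesis unfolding s_def by (simp only: times_divide_eq_right nonzero_mult_div_cancel_left not_False_eq_True)
  qed
  \<comment> \<open>Only the multiples of \<open>m\<close> among the factors of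
    \<open>transform_\<gamma>_prod\<close> enter: the factor with index \<open>j * m\<close> is the
    transform of \<open>\<gamma> (s n)\<close> transported by \<open>Q\<close>.\<close>
  have "\<exists>P \<in> space (prob_algebra borel_D). \<forall>u\<in>dom_U. transform P u = (\<Prod>j<n+1. transform (bind (\<gamma> (s n)) (Q (real (j * m) * s n))) u)" for n
    by (rule transform_prod_exists) (auto intro!: bind_in_prob_algebra \<gamma>_in kernel simp: s_nn)
  then obtain P where P: "\<And>n. P n \<in> space (prob_algebra borel_D)"
    and trP': "\<And>n u. u \<in> dom_U \<Longrightarrow> transform (P n) u = (\<Prod>j<n+1. transform (bind (\<gamma> (s n)) (Q (real (j * m) * s n))) u)"
    by metis
  have trP: "transform (P n) u = (\<Prod>j<n+1. transform (\<gamma> (s n)) (\<psi> (real (j * m) * s n) u))" if "u \<in> dom_U" for n u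
    unfolding trP'[OF that] using that s_nn by (intro prod.cong refl transform_bind_kernel \<gamma>_in) auto
  define \<Phi> where "\<Phi> n i u = transform (P n) (\<psi> (real i * s n) u)" for n i u
  have psi_s: "\<psi> (real i * s n) u \<in> dom_U" if "u \<in> dom_U" for i n u
    using that s_nn by (intro psi_in_dom_U) auto
  have \<Phi>_le: "norm (\<Phi> n i u) \<le> 1" if "u \<in> dom_U" for n i u
    unfolding \<Phi>_def by (intro norm_transform_le_1 P psi_s that)
  have \<Phi>_prod: "(\<Prod>i<m. \<Phi> n i u) = transform (\<gamma> t) u" if u: "u \<in> dom_U" for n u
  proof -
    have "(\<Prod>i<m. \<Phi> n i u) = (\<Prod>i<m. \<Prod>j<n+1. transform (\<gamma> (s n)) (\<psi> (real (j * m + i) * s n) u))"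
    proof (intro prod.cong refl)
      fix i
      have "\<psi> (real (j * m) * s n) (\<psi> (real i * s n) u) = \<psi> (real (j * m + i) * s n) u" for j
        using u s_nn by (subst psi_semigroup[symmetric]) (auto simp: algebra_simps)
      then show "\<Phi> n i u = (\<Prod>j<n+1. transform (\<gamma> (s n)) (\<psi> (real (j * m + i) * s n) u))"
        unfolding \<Phi>_def by (subst trP[OF psi_s[OF u]]) simp
    qed
    also have "\<dots> = (\<Prod>j<n+1. \<Prod>i<m. transform (\<gamma> (s n)) (\<psi> (real (j * m + i) * s n) u))"
      by (rule prod.swap)
    also have "\<dots> = (\<Prod>j<n+1. \<Prod>k=j * m..<j * m + m. transform (\<gamma> (s n)) (\<psi> (real k * s n) u))"
    proof (rule prod.cong[OF refl])
      fix j
      show "(\<Prod>i<m. transform (\<gamma> (s n)) (\<psi> (real (j * m + i) * s n) u)) = (\<Prod>k=j * m..<j * m + m. transform (\<gamma> (s n)) (\<psi> (real k * s n) u))"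
        using prod.shift_bounds_nat_ivl[of "\<lambda>k. transform (\<gamma> (s n)) (\<psi> (real k * s n) u)" 0 "j * m" m]
        by (simp add: atLeast0LessThan add.commute)
    qed
    also have "\<dots> = (\<Prod>k<(n + 1) * m. transform (\<gamma> (s n)) (\<psi> (real k * s n) u))"
      by (rule prod.nat_group)
    also have "\<dots> = transform (\<gamma> t) u"
      using transform_\<gamma>_prod[OF s_nn[of n] u, of "(n + 1) * m"] unfolding s_total ..
    finally show ?thesis .
  qed
  \<comment> \<open>The transform of \<open>\<gamma> t\<close> is a product of \<open>m\<close>
    factors of modulus at most 1, so the factor with \<open>i = 0\<close>, which is
    \<open>lap (P n) d\<close>, is no smaller than the modulus of the product. The bound does not
    depend on \<open>n\<close>.\<close>
  have lapP: "1 - lap (P n) d \<le> 1 - norm (transform (\<gamma> t) (of_real (- d), 0))" if d: "d \<ge> 0" for n d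
  proof -
    have U: "(complex_of_real (- d), 0) \<in> dom_U" using d by (auto intro: dom_UI)
    have "norm (transform (\<gamma> t) (of_real (- d), 0)) = (\<Prod>i<m. norm (\<Phi> n i (of_real (- d), 0)))"
      unfolding \<Phi>_prod[OF U, of n, symmetric] by (rule prod_norm[symmetric])
    also have "\<dots> = norm (\<Phi> n 0 (of_real (- d), 0)) * (\<Prod>i\<in>{..<m} - {0}. norm (\<Phi> n i (of_real (- d), 0)))"
      using m by (intro prod.remove) auto
    also have "\<dots> \<le> norm (\<Phi> n 0 (of_real (- d), 0)) * 1"
      using \<Phi>_le[OF U] by (intro mult_left_mono prod_le_1) auto
    also have "\<Phi> n 0 (of_real (- d), 0) = of_real (lap (P n) d)"
      using U by (simp only: \<Phi>_def psi_time_0 transform_eq_lap of_nat_0 mult_zero_left)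
    also have "norm (complex_of_real (lap (P n) d)) = lap (P n) d"
      unfolding lap_def by (simp add: integral_nonneg_AE)
    finally show ?thesis by simp
  qed
  have psi_lim: "(\<lambda>n. \<psi> (real i * s n) u) \<longlonglongrightarrow> u" if "u \<in> dom_U" for i u
    by (rule psi_tendsto[OF that _ s_0]) (simp add: s_nn)
  have \<beta>_lim: "(\<lambda>n. \<beta>22 (real i * s n)) \<longlonglongrightarrow> 1" for i
  proof -
    have U: "(0, \<i>) \<in> dom_U" by (auto intro: dom_UI)
    have "(\<lambda>n. Im (snd (\<psi> (real i * s n) (0, \<i>)))) \<longlonglongrightarrow> Im (snd (0 :: complex, \<i>))"
      by (intro tendsto_Im tendsto_snd psi_lim[OF U])
    then show ?thesis using s_nn by (simp add: snd_psi[OF _ U])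
  qed
  \<comment> \<open>The law of \<open>\<beta>\<^sub>i Y\<^sub>i\<close>. Its characteristic function
    is the transform of \<open>P n\<close> at \<open>\<psi> (i s) u\<close> with the first component
    replaced by 0; for \<open>fst u = 0\<close> that component tends to 0.\<close>
  define \<nu> where "\<nu> n i = distr (P n) borel (\<lambda>\<xi>. \<beta>22 (real i * s n) * snd \<xi>)" for n i
  have sP: "sets (P n) = sets borel_D" and fP: "finite_measure (P n)" for n using P prob_algebra_D by blast+
  have spP: "space (P n) = state_D" for n by (rule space_of_sets_borel_D[OF sP])
  have mP: "(\<lambda>\<xi>. c * snd \<xi>) \<in> borel_measurable (P n)" for c n
    using fst_snd_measurable_D[OF sP] by (intro borel_measurable_times) auto
  have rd\<nu>: "real_distribution (\<nu> n i)" for n i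
    unfolding \<nu>_def using prob_algebra_D(1)[OF P] mP by (intro prob_space.real_distribution_distr)
  have ch\<nu>: "char (\<nu> n i) \<theta> = transform (P n) (0, \<i> * of_real (\<beta>22 (real i * s n) * \<theta>))" for n i \<theta>
    unfolding \<nu>_def char_def transform_def
    by (subst integral_distr[OF mP]) (auto simp: pairing_def algebra_simps)
  have "\<exists>W. real_distribution W \<and> (\<forall>\<theta>. char W \<theta> = (\<Prod>i<m. char (\<nu> n i) \<theta>)) \<and>
    (\<forall>K. (\<Prod>i<m. measure (\<nu> n i) {K..}) \<le> measure W {real m * K..} \<and>
         (\<Prod>i<m. measure (\<nu> n i) {..-K}) \<le> measure W {..-(real m * K)})" for n
    by (rule sum_distribution_exists) (rule rd\<nu>)
  then obtain W where W: "\<And>n. real_distribution (W n)" "\<And>n \<theta>. char (W n) \<theta> = (\<Prod>i<m. char (\<nu> n i) \<theta>)"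
    "\<And>n K. (\<Prod>i<m. measure (\<nu> n i) {K..}) \<le> measure (W n) {real m * K..}"
    "\<And>n K. (\<Prod>i<m. measure (\<nu> n i) {..-K}) \<le> measure (W n) {..-(real m * K)}"
    by metis
  define G where "G = distr (\<gamma> t) borel snd"
  note \<gamma>t = \<gamma>_in[OF t]
  have rdG: "real_distribution G"
    unfolding G_def using prob_algebra_D(1)[OF \<gamma>t] fst_snd_measurable_D[OF prob_algebra_D(2)[OF \<gamma>t]]
    by (intro prob_space.real_distribution_distr)
  have chG: "char G \<theta> = transform (\<gamma> t) (0, \<i> * of_real \<theta>)" for \<theta>
    unfolding G_def char_def transform_def
    by (subst integral_distr[OF fst_snd_measurable_D(2)[OF prob_algebra_D(2)[OF \<gamma>t]]]) (auto simp: pairing_def algebra_simps)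
  have "(\<lambda>n. char (W n) \<theta>) \<longlonglongrightarrow> char G \<theta>" for \<theta>
  proof (rule tendstoI)
    fix \<epsilon> :: real assume "\<epsilon> > 0"
    define u where "u = (0 :: complex, \<i> * complex_of_real \<theta>)"
    have U: "u \<in> dom_U" by (auto intro: dom_UI simp: u_def)
    \<comment> \<open>The denominator absorbs the constant 4 of
      \<open>norm_transform_diff_le_lap\<close> and the sum over the \<open>m\<close>
      factors.\<close>
    obtain d where d: "d > 0" "1 - norm (transform (\<gamma> t) (of_real (- d), 0)) < \<epsilon> / (4 * real m)"
      using transform_near_1[OF \<gamma>t, of "\<epsilon> / (4 * real m)"] \<open>\<epsilon> > 0\<close> m by auto
    have "\<forall>\<^sub>F n in sequentially. norm (fst (\<psi> (real i * s n) u)) < d" for i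
    proof -
      have "(\<lambda>n. norm (fst (\<psi> (real i * s n) u))) \<longlonglongrightarrow> norm (fst u)"
        by (intro tendsto_norm tendsto_fst psi_lim[OF U])
      then show ?thesis using d(1) by (intro order_tendstoD(2)) (auto simp: u_def)
    qed
    then have "\<forall>\<^sub>F n in sequentially. \<forall>i\<in>{..<m}. norm (fst (\<psi> (real i * s n) u)) < d"
      by (intro eventually_ball_finite) auto
    then show "\<forall>\<^sub>F n in sequentially. dist (char (W n) \<theta>) (char G \<theta>) < \<epsilon>"
    proof eventually_elim
      case (elim n)
      have "dist (char (W n) \<theta>) (char G \<theta>) = norm ((\<Prod>i<m. \<Phi> n i u) - (\<Prod>i<m. char (\<nu> n i) \<theta>))"
        unfolding \<Phi>_prod[OF U] by (simp add: W chG u_def dist_norm) (rule norm_minus_commute)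
      also have "\<dots> \<le> (\<Sum>i<m. norm (\<Phi> n i u - char (\<nu> n i) \<theta>))"
        using \<Phi>_le[OF U] real_distribution.cmod_char_le_1[OF rd\<nu>] by (intro norm_prod_diff) auto
      also have "\<dots> < (\<Sum>i<m. \<epsilon> / real m)"
      proof (rule sum_strict_mono)
        fix i assume i: "i \<in> {..<m}"
        have snd: "snd (\<psi> (real i * s n) u) = \<i> * of_real (\<beta>22 (real i * s n) * \<theta>)"
          using s_nn by (subst snd_psi[OF _ U]) (auto simp: u_def)
        have "\<Phi> n i u = transform (P n) (fst (\<psi> (real i * s n) u), \<i> * of_real (\<beta>22 (real i * s n) * \<theta>))"
          unfolding \<Phi>_def snd[symmetric] by simp
        then have "norm (\<Phi> n i u - char (\<nu> n i) \<theta>) \<le> 4 * (1 - lap (P n) d)"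
          unfolding ch\<nu> using elim i dom_UD(1)[OF psi_s[OF U]]
          by (simp only:) (intro norm_transform_diff_le_lap P, auto intro: less_imp_le)
        also have "\<dots> < \<epsilon> / real m"
        proof -
          have "1 - lap (P n) d < \<epsilon> / (4 * real m)" using lapP[of d n] d by linarith
          then show ?thesis using m by (simp add: field_simps)
        qed
        finally show "norm (\<Phi> n i u - char (\<nu> n i) \<theta>) < \<epsilon> / real m" .
      qed (use m in \<open>auto simp: lessThan_empty_iff\<close>)
      also have "\<dots> = \<epsilon>" using m by simp
      finally show ?case .
    qed
  qed
  then have wW: "weak_conv_m W G" by (rule levy_continuity[OF W(1) rdG])
  have tail: "\<exists>R. \<forall>\<^sub>F n in sequentially. measure (P n) {\<xi>\<in>state_D. R < fst \<xi> \<or> R < \<bar>snd \<xi>\<bar>} \<le> \<epsilon>" if "\<epsilon> > 0" for \<epsilon>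
  proof -
    \<comment> \<open>The tail is split into three parts of size \<open>\<epsilon> / 3\<close>. The
      first needs \<open>\<epsilon> / 6\<close> because of the factor 2 in
      \<open>measure_fst_tail_le\<close>; the others need \<open>(\<epsilon> / 3) ^ m\<close>
      because tails of the sum bound the \<open>m\<close>-th power of the tails of one
      summand.\<close>
    obtain d where d: "d > 0" "1 - norm (transform (\<gamma> t) (of_real (- d), 0)) < \<epsilon> / 6"
      using transform_near_1[OF \<gamma>t, of "\<epsilon> / 6"] \<open>\<epsilon> > 0\<close> by auto
    obtain k where k: "k > 0" "\<forall>\<^sub>F n in sequentially. measure (W n) {k..} \<le> (\<epsilon> / 3) ^ m \<and> measure (W n) {..-k} \<le> (\<epsilon> / 3) ^ m"
      using weak_conv_tail[OF W(1) rdG wW, of "(\<epsilon> / 3) ^ m"] \<open>\<epsilon> > 0\<close> by auto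
    have "\<forall>\<^sub>F n in sequentially. \<beta>22 (real i * s n) > 1 / 2" for i
      using \<beta>_lim[of i] by (rule order_tendstoD(1)) simp
    then have "\<forall>\<^sub>F n in sequentially. \<forall>i\<in>{..<m}. \<beta>22 (real i * s n) > 1 / 2"
      by (intro eventually_ball_finite) auto
    \<comment> \<open>The factor 2 in front of \<open>k / m\<close> compensates for
      \<open>\<beta>22 > 1 / 2\<close>.\<close>
    with k(2) have "\<forall>\<^sub>F n in sequentially. measure (P n) {\<xi>\<in>state_D. max (1 / d) (2 * (k / m)) < fst \<xi> \<or> max (1 / d) (2 * (k / m)) < \<bar>snd \<xi>\<bar>} \<le> \<epsilon>"
    proof eventually_elim
      case (elim n)
      interpret prob_space "P n" using prob_algebra_D(1)[OF P] .
      note [measurable] = fst_snd_measurable_D[OF sP[of n]]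
      define K where "K = k / real m"
      have K: "K > 0" "real m * K = k" using k(1) m by (auto simp: K_def)
      let ?A = "{\<xi>\<in>state_D. 1 / d < fst \<xi>}" and ?B = "{\<xi>\<in>state_D. 2 * K \<le> snd \<xi>}" and ?C = "{\<xi>\<in>state_D. snd \<xi> \<le> - 2 * K}"
      have S: "?A \<in> sets (P n)" "?B \<in> sets (P n)" "?C \<in> sets (P n)"
        unfolding spP[of n, symmetric] by measurable
      have A: "measure (P n) ?A \<le> \<epsilon> / 3"
        using measure_fst_tail_le[OF P, of "1 / d" n] lapP[of d n] d by simp
      have root: "x \<le> \<epsilon> / 3" if "x ^ m \<le> (\<epsilon> / 3) ^ m" "0 \<le> x" for x
        using that m \<open>\<epsilon> > 0\<close> power_mono_iff[of x "\<epsilon> / 3" m] by simp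
      have B: "measure (P n) ?B \<le> \<epsilon> / 3"
      proof (rule root)
        have "measure (P n) ?B \<le> measure (\<nu> n i) {K..}" if "i < m" for i
        proof -
          have b: "\<beta>22 (real i * s n) > 1 / 2" using elim(2) that by simp
          have sub: "?B \<subseteq> (\<lambda>\<xi>. \<beta>22 (real i * s n) * snd \<xi>) -` {K..} \<inter> space (P n)"
          proof
            fix \<xi> assume \<xi>: "\<xi> \<in> ?B"
            have "1 / 2 * (2 * K) \<le> \<beta>22 (real i * s n) * snd \<xi>" using \<xi> b K by (intro mult_mono) auto
            then show "\<xi> \<in> (\<lambda>\<xi>. \<beta>22 (real i * s n) * snd \<xi>) -` {K..} \<inter> space (P n)" using \<xi> by (simp add: spP)
          qed
          show ?thesis
            unfolding \<nu>_def using finite_measure_mono[OF sub] mP by (subst measure_distr) auto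
        qed
        then have "measure (P n) ?B ^ m \<le> (\<Prod>i<m. measure (\<nu> n i) {K..})"
          using prod_mono[of "{..<m}" "\<lambda>_. measure (P n) ?B" "\<lambda>i. measure (\<nu> n i) {K..}"] by simp
        also have "\<dots> \<le> (\<epsilon> / 3) ^ m" using W(3)[of n K] elim(1) K by simp
        finally show "measure (P n) ?B ^ m \<le> (\<epsilon> / 3) ^ m" .
      qed simp
      have C: "measure (P n) ?C \<le> \<epsilon> / 3"
      proof (rule root)
        have "measure (P n) ?C \<le> measure (\<nu> n i) {..-K}" if "i < m" for i
        proof -
          have b: "\<beta>22 (real i * s n) > 1 / 2" using elim(2) that by simp
          have sub: "?C \<subseteq> (\<lambda>\<xi>. \<beta>22 (real i * s n) * snd \<xi>) -` {..-K} \<inter> space (P n)"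
          proof
            fix \<xi> assume \<xi>: "\<xi> \<in> ?C"
            have "1 / 2 * (2 * K) \<le> \<beta>22 (real i * s n) * (- snd \<xi>)" using \<xi> b K by (intro mult_mono) auto
            then show "\<xi> \<in> (\<lambda>\<xi>. \<beta>22 (real i * s n) * snd \<xi>) -` {..-K} \<inter> space (P n)" using \<xi> by (simp add: spP)
          qed
          show ?thesis
            unfolding \<nu>_def using finite_measure_mono[OF sub] mP by (subst measure_distr) auto
        qed
        then have "measure (P n) ?C ^ m \<le> (\<Prod>i<m. measure (\<nu> n i) {..-K})"
          using prod_mono[of "{..<m}" "\<lambda>_. measure (P n) ?C" "\<lambda>i. measure (\<nu> n i) {..-K}"] by simp
        also have "\<dots> \<le> (\<epsilon> / 3) ^ m" using W(4)[of n K] elim(1) K by simp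
        finally show "measure (P n) ?C ^ m \<le> (\<epsilon> / 3) ^ m" .
      qed simp
      have "{\<xi>\<in>state_D. max (1 / d) (2 * (k / m)) < fst \<xi> \<or> max (1 / d) (2 * (k / m)) < \<bar>snd \<xi>\<bar>} \<subseteq> ?A \<union> ?B \<union> ?C"
        unfolding K_def[symmetric] by auto
      then have "measure (P n) {\<xi>\<in>state_D. max (1 / d) (2 * (k / m)) < fst \<xi> \<or> max (1 / d) (2 * (k / m)) < \<bar>snd \<xi>\<bar>} \<le> measure (P n) (?A \<union> ?B \<union> ?C)"
        using S by (intro finite_measure_mono) auto
      also have "\<dots> \<le> measure (P n) (?A \<union> ?B) + measure (P n) ?C"
        using S by (intro measure_Un_le) auto
      also have "\<dots> \<le> measure (P n) ?A + measure (P n) ?B + measure (P n) ?C"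
        using S by (intro add_right_mono measure_Un_le) auto
      also have "\<dots> \<le> \<epsilon>" using A B C by simp
      finally show ?case .
    qed
    then show ?thesis by blast
  qed
  have "measure (P n) state_D \<le> 1" for n
    using prob_space.prob_le_1[OF prob_algebra_D(1)[OF P]] .
  from tight_subsequence[OF fP sP this tail]
  obtain r N where r: "strict_mono (r :: nat \<Rightarrow> nat)" and N: "finite_measure N" "sets N = sets borel_D"
    and conv: "\<And>f :: real \<times> real \<Rightarrow> complex. continuous_on state_D f \<Longrightarrow> bounded (f ` state_D) \<Longrightarrow>
       (\<lambda>n. \<integral>\<xi>. f \<xi> \<partial>P (r n)) \<longlonglongrightarrow> (\<integral>\<xi>. f \<xi> \<partial>N)" by metis
  have \<Phi>_lim: "(\<lambda>n. \<Phi> (r n) i u) \<longlonglongrightarrow> transform N u" if u: "u \<in> dom_U" for i u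
    unfolding \<Phi>_def
  proof (rule transform_tendsto_moving[OF fP sP N conv psi_s[OF u] _ u])
    show "(\<lambda>n. \<psi> (real i * s (r n)) u) \<longlonglongrightarrow> u"
      using LIMSEQ_subseq_LIMSEQ[OF psi_lim[OF u] r] by (simp add: comp_def)
  qed
  have trN: "transform (\<gamma> t) u = transform N u ^ m" if u: "u \<in> dom_U" for u
  proof -
    have "(\<lambda>n. \<Prod>i<m. \<Phi> (r n) i u) \<longlonglongrightarrow> (\<Prod>i<m. transform N u)"
      by (intro tendsto_prod \<Phi>_lim u)
    then show ?thesis by (simp add: \<Phi>_prod[OF u] LIMSEQ_const_iff)
  qed
  \<comment> \<open>The transform at 0 is the total mass, so no mass is lost in the limit.\<close>
  have "(\<lambda>n. \<Phi> (r n) 0 0) \<longlonglongrightarrow> transform N 0" by (intro \<Phi>_lim) simp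
  then have "transform N 0 = 1"
    using transform_0[OF P] by (simp add: \<Phi>_def psi_time_0 LIMSEQ_const_iff)
  then have "complex_of_real (measure N (space N)) = 1" by (simp add: transform_def scaleR_conv_of_real)
  then have "measure N (space N) = 1" by (simp only: of_real_eq_1_iff)
  then have "prob_space N"
    using N by (intro prob_spaceI) (simp add: finite_measure.emeasure_eq_measure)
  then have "N \<in> space (prob_algebra borel_D)" using N by (simp add: space_prob_algebra)
  with trN that show thesis by blast
qed

lemma infinitely_divisible_\<gamma>:
  assumes t: "t \<ge> 0"
  shows "infinitely_divisible_D (\<gamma> t)"
  unfolding infinitely_divisible_D_def
proof (intro conjI allI impI \<gamma>_in t)
  fix m :: nat assume "m \<ge> 1"
  then obtain N where N: "N \<in> space (prob_algebra borel_D)" "\<And>u. u \<in> dom_U \<Longrightarrow> transform (\<gamma> t) u = transform N u ^ m"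
    using root_exists[OF t] by metis
  then have "\<gamma> t = (conv_D N ^^ m) (return borel_D 0)"
    by (intro prob_algebra_D_eqI \<gamma>_in t conv_D_power) (auto simp: conv_D_power)
  with N show "\<exists>N\<in>space (prob_algebra borel_D). \<gamma> t = (conv_D N ^^ m) (return borel_D 0)" by blast
qed

end

section \<open>Estimates for the Levy-Khintchine integrand\<close>

lemma chi_alt: "chi x = max (-1) (min 1 x)"
  by (auto simp: chi_def)

lemma continuous_on_chi [continuous_intros]: "continuous_on A f \<Longrightarrow> continuous_on A (\<lambda>x. chi (f x))"
  unfolding chi_alt by (intro continuous_intros)

lemma chi_nonneg: "0 \<le> x \<Longrightarrow> 0 \<le> chi x"
  and abs_chi_le_1: "\<bar>chi x\<bar> \<le> 1"
  and chi_eq_0_iff: "chi x = 0 \<longleftrightarrow> x = 0"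
  and chi_eq_self: "\<bar>x\<bar> \<le> 1 \<Longrightarrow> chi x = x"
  and chi_0 [simp]: "chi 0 = 0"
  by (auto simp: chi_def)

lemma chi_nonneg_eq: "0 \<le> x \<Longrightarrow> chi x = min 1 x"
  by (auto simp: chi_def)

lemma chi_sq_le_1: "(chi x)\<^sup>2 \<le> 1"
  using abs_chi_le_1[of x] abs_square_le_1 by blast

lemma chi_sq_eq_1: "1 \<le> \<bar>x\<bar> \<Longrightarrow> (chi x)\<^sup>2 = 1"
  by (auto simp: chi_def abs_if split: if_splits)

lemma chi_sq_le_sq: "(chi x)\<^sup>2 \<le> x\<^sup>2"
  by (rule abs_le_square_iff[THEN iffD1]) (auto simp: chi_def)

text \<open>Multiplying a Levy measure by this function makes it finite; on \<open>state_D\<close>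
  the function vanishes only at the origin.\<close>

definition weight :: "real \<times> real \<Rightarrow> real" where
  "weight \<xi> = chi (fst \<xi>) + (chi (snd \<xi>))\<^sup>2"

lemma continuous_on_weight: "continuous_on A weight"
  unfolding weight_def by (intro continuous_intros)

lemma
  assumes "\<xi> \<in> state_D"
  shows chi_fst_nonneg: "0 \<le> chi (fst \<xi>)" and weight_nonneg: "0 \<le> weight \<xi>" and weight_le_2: "weight \<xi> \<le> 2"
    and weight_eq_0_iff: "weight \<xi> = 0 \<longleftrightarrow> \<xi> = 0"
    and chi_fst_le_weight: "chi (fst \<xi>) \<le> weight \<xi>" and chi_snd_le_weight: "(chi (snd \<xi>))\<^sup>2 \<le> weight \<xi>"
proof -
  show *: "0 \<le> chi (fst \<xi>)" using assms by (intro chi_nonneg) (auto simp: state_D_def)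
  then show "0 \<le> weight \<xi>" "weight \<xi> \<le> 2" "chi (fst \<xi>) \<le> weight \<xi>" "(chi (snd \<xi>))\<^sup>2 \<le> weight \<xi>"
    using chi_sq_le_1[of "snd \<xi>"] abs_chi_le_1[of "fst \<xi>"] by (auto simp: weight_def)
  show "weight \<xi> = 0 \<longleftrightarrow> \<xi> = 0"
    using * by (auto simp: weight_def add_nonneg_eq_0_iff chi_eq_0_iff prod_eq_iff)
qed

lemma weight_0 [simp]: "weight 0 = 0"
  by (simp add: weight_def)

text \<open>The estimate \<open>norm z * x\<close> serves up to \<open>x = 1\<close>, the trivial
  bound 2 beyond, where \<open>chi x = 1\<close>.\<close>

lemma norm_exp_minus_1_le_chi:
  fixes z :: complex
  assumes "Re z \<le> 0" "0 \<le> x"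
  shows "norm (exp (z * of_real x) - 1) \<le> (2 + norm z) * chi x"
proof -
  have "norm (exp (z * of_real x) - exp 0) \<le> min (norm z * x) 2"
    using norm_exp_diff_le[of "z * of_real x" 0] assms by (auto simp: norm_mult mult_nonpos_nonneg)
  also have "\<dots> \<le> (2 + norm z) * chi x"
  proof (cases "x \<le> 1")
    case True
    have "min (norm z * x) 2 \<le> norm z * x" by simp
    also have "\<dots> \<le> (2 + norm z) * x" using assms by (intro mult_right_mono) auto
    finally show ?thesis using True assms by (simp add: chi_nonneg_eq)
  next
    case False
    then have "chi x = 1" by (simp add: chi_def)
    then show ?thesis by (intro order_trans[OF min.cobounded2]) simp
  qed
  finally show ?thesis by simp
qed

text \<open>For \<open>\<bar>y\<bar> \<le> 1\<close> the truncation is the identity and the left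
  side is a first-order Taylor remainder; beyond, \<open>(chi y)\<^sup>2 = 1\<close> and the
  triangle inequality gives \<open>2 + norm w\<close>.\<close>

lemma norm_iexp_minus_le_chi_sq:
  fixes w :: complex
  assumes "Re w = 0"
  shows "norm (exp (w * of_real y) - 1 - w * of_real (chi y)) \<le> (2 + norm w + (norm w)\<^sup>2) * (chi y)\<^sup>2"
proof -
  obtain \<theta> where w: "w = \<i> * of_real \<theta>" using assms by (intro that[of "Im w"]) (simp add: complex_eq_iff)
  show ?thesis
  proof (cases "\<bar>y\<bar> \<le> 1")
    case True
    have "norm (iexp (\<theta> * y) - (\<Sum>k\<le>1. (\<i> * of_real (\<theta> * y))^k / fact k)) \<le> \<bar>\<theta> * y\<bar>^Suc 1 / fact (Suc 1)"
      by (rule iexp_approx1)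
    also have "\<bar>\<theta> * y\<bar>^Suc 1 / fact (Suc 1) = \<theta>\<^sup>2 * y\<^sup>2 / 2"
      by (simp only: Suc_1 power2_abs fact_2 power_mult_distrib)
    also have "\<dots> \<le> \<theta>\<^sup>2 * y\<^sup>2" by simp
    also have "\<dots> \<le> (2 + norm w + (norm w)\<^sup>2) * (chi y)\<^sup>2"
      using True by (auto simp: chi_eq_self w norm_mult intro!: mult_right_mono)
    finally show ?thesis using True by (simp add: w chi_eq_self mult.assoc diff_diff_eq)
  next
    case False
    have "norm (exp (w * of_real y) - 1 - w * of_real (chi y)) \<le> norm (exp (w * of_real y)) + norm (1 :: complex) + norm (w * of_real (chi y))"
      by (intro order_trans[OF norm_triangle_ineq4] add_mono order_refl norm_triangle_ineq4)
    also have "\<dots> \<le> 1 + 1 + norm w"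
      using assms abs_chi_le_1[of y] by (intro add_mono) (auto simp: norm_mult mult_left_le)
    also have "\<dots> \<le> (2 + norm w + (norm w)\<^sup>2) * (chi y)\<^sup>2" using False by (simp add: chi_sq_eq_1)
    finally show ?thesis .
  qed
qed

definition LK_integrand :: "complex \<times> complex \<Rightarrow> real \<times> real \<Rightarrow> complex" where
  "LK_integrand u \<xi> = exp (pairing u \<xi>) - 1 - snd u * of_real (chi (snd \<xi>))"

text \<open>The sum of the constants of \<open>norm_exp_minus_1_le_chi\<close> for
  \<open>fst u\<close> and of \<open>norm_iexp_minus_le_chi_sq\<close> for
  \<open>snd u\<close>.\<close>

definition LK_const :: "complex \<times> complex \<Rightarrow> real" where
  "LK_const u = 4 + norm (fst u) + norm (snd u) + (norm (snd u))\<^sup>2"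

text \<open>The two terms are of the orders \<open>chi (fst \<xi>)\<close> and
  \<open>(chi (snd \<xi>))\<^sup>2\<close>, the two summands of \<open>weight\<close>.\<close>

lemma LK_integrand_split:
  "LK_integrand u \<xi> = (exp (fst u * of_real (fst \<xi>)) - 1) * exp (snd u * of_real (snd \<xi>)) +
     (exp (snd u * of_real (snd \<xi>)) - 1 - snd u * of_real (chi (snd \<xi>)))"
  by (simp add: LK_integrand_def pairing_def exp_add algebra_simps)

lemma norm_LK_integrand_le:
  assumes u: "u \<in> dom_U" and \<xi>: "\<xi> \<in> state_D"
  shows "norm (LK_integrand u \<xi>) \<le> LK_const u * weight \<xi>"
proof -
  have "norm ((exp (fst u * of_real (fst \<xi>)) - 1) * exp (snd u * of_real (snd \<xi>))) \<le> (2 + norm (fst u)) * chi (fst \<xi>)"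
    using dom_UD[OF u] \<xi> norm_exp_minus_1_le_chi[of "fst u" "fst \<xi>"] by (auto simp: norm_mult state_D_def)
  then have "norm (LK_integrand u \<xi>) \<le> (2 + norm (fst u)) * chi (fst \<xi>) + (2 + norm (snd u) + (norm (snd u))\<^sup>2) * (chi (snd \<xi>))\<^sup>2"
    unfolding LK_integrand_split using norm_iexp_minus_le_chi_sq[OF dom_UD(2)[OF u]]
    by (intro order_trans[OF norm_triangle_ineq] add_mono)
  also have "\<dots> \<le> LK_const u * chi (fst \<xi>) + LK_const u * (chi (snd \<xi>))\<^sup>2"
    using chi_fst_nonneg[OF \<xi>] by (intro add_mono mult_right_mono) (auto simp: LK_const_def)
  finally show ?thesis by (simp add: weight_def distrib_left)
qed

lemma continuous_on_punctured:
  fixes f :: "real \<Rightarrow> complex"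
  assumes "continuous_on (-{0}) f" "(f \<longlongrightarrow> f 0) (at 0)"
  shows "continuous_on UNIV f"
  unfolding continuous_on_eq_continuous_at[OF open_UNIV]
proof
  fix x show "isCont f x"
  proof (cases "x = 0")
    case False
    then show ?thesis using assms(1) continuous_on_eq_continuous_at[of "-{0}" f] by (simp add: open_Compl)
  qed (use assms(2) in \<open>simp add: isCont_def\<close>)
qed

text \<open>The value at 0 is the derivative of the numerator, which extends the quotient
  continuously; it later turns an atom at the origin into the drift in the first coordinate.\<close>

definition LK_quot1 :: "complex \<Rightarrow> real \<Rightarrow> complex" where
  "LK_quot1 z x = (if x = 0 then z else (exp (z * of_real x) - 1) / of_real (chi x))"

text \<open>The value at 0 is the second Taylor coefficient of \<open>exp\<close>; it later turns an
  atom at the origin into twice the coefficient of \<open>(snd u)\<^sup>2\<close>.\<close>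

definition LK_quot2 :: "complex \<Rightarrow> real \<Rightarrow> complex" where
  "LK_quot2 w y = (if y = 0 then w\<^sup>2 / 2 else (exp (w * of_real y) - 1 - w * of_real (chi y)) / (of_real (chi y))\<^sup>2)"

lemma LK_quot1_mult: "of_real (chi x) * LK_quot1 z x = exp (z * of_real x) - 1"
  and LK_quot2_mult: "(of_real (chi y))\<^sup>2 * LK_quot2 w y = exp (w * of_real y) - 1 - w * of_real (chi y)"
  by (auto simp: LK_quot1_def LK_quot2_def chi_eq_0_iff)

lemma continuous_on_LK_quot1: "continuous_on UNIV (LK_quot1 z)"
proof (rule continuous_on_punctured)
  have "continuous_on (-{0}) (\<lambda>x. (exp (z * of_real x) - 1) / of_real (chi x))"
    by (intro continuous_intros) (auto simp: chi_eq_0_iff)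
  then show "continuous_on (-{0}) (LK_quot1 z)"
    by (rule continuous_on_eq) (auto simp: LK_quot1_def)
  have "((\<lambda>v. exp (z * v)) has_field_derivative z) (at (of_real 0))"
    by (auto intro!: derivative_eq_intros)
  then have "((\<lambda>h. (exp (z * h) - 1) / h) \<longlongrightarrow> z) (at 0)"
    by (simp add: DERIV_def)
  moreover have "filterlim complex_of_real (at 0) (at 0)"
    unfolding filterlim_at by (auto intro!: tendsto_eq_intros simp: eventually_at_filter)
  ultimately have "((\<lambda>x. (exp (z * of_real x) - 1) / of_real x) \<longlongrightarrow> z) (at (0::real))"
    by (rule filterlim_compose)
  moreover have "\<forall>\<^sub>F x in at 0. (exp (z * of_real x) - 1) / of_real x = LK_quot1 z x"
    unfolding eventually_at
    by (intro exI[of _ 1]) (auto simp: LK_quot1_def chi_eq_self dist_norm)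
  ultimately have "(LK_quot1 z \<longlongrightarrow> z) (at 0)" by (rule Lim_transform_eventually)
  then show "(LK_quot1 z \<longlongrightarrow> LK_quot1 z 0) (at 0)" by (simp add: LK_quot1_def)
qed

lemma continuous_on_LK_quot2:
  assumes "Re w = 0"
  shows "continuous_on UNIV (LK_quot2 w)"
proof (rule continuous_on_punctured)
  have "continuous_on (-{0}) (\<lambda>y. (exp (w * of_real y) - 1 - w * of_real (chi y)) / (of_real (chi y))\<^sup>2)"
    by (intro continuous_intros) (auto simp: chi_eq_0_iff)
  then show "continuous_on (-{0}) (LK_quot2 w)"
    by (rule continuous_on_eq) (auto simp: LK_quot2_def)
  obtain \<theta> where w: "w = \<i> * of_real \<theta>" using assms by (intro that[of "Im w"]) (simp add: complex_eq_iff)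
  \<comment> \<open>Near 0 the truncation is the identity, so the difference is a second-order
    Taylor remainder divided by \<open>y\<^sup>2\<close>, hence of order
    \<open>\<bar>y\<bar>\<close>.\<close>
  have "((\<lambda>y. LK_quot2 w y - w\<^sup>2 / 2) \<longlongrightarrow> 0) (at 0)"
  proof (rule Lim_null_comparison)
    show "((\<lambda>y. \<bar>\<theta>\<bar>^3 / 6 * \<bar>y\<bar>) \<longlongrightarrow> 0) (at 0)" by (auto intro!: tendsto_eq_intros)
    show "\<forall>\<^sub>F y in at 0. norm (LK_quot2 w y - w\<^sup>2 / 2) \<le> \<bar>\<theta>\<bar>^3 / 6 * \<bar>y\<bar>"
      unfolding eventually_at
    proof (intro exI[of _ 1] conjI ballI impI)
      fix y :: real assume y: "y \<noteq> 0 \<and> dist y 0 < 1"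
      then have c: "chi y = y" by (intro chi_eq_self) (simp add: dist_norm)
      have "norm (iexp (\<theta> * y) - (\<Sum>k\<le>2. (\<i> * of_real (\<theta> * y))^k / fact k)) \<le> \<bar>\<theta> * y\<bar>^Suc 2 / fact (Suc 2)"
        by (rule iexp_approx1)
      also have "\<bar>\<theta> * y\<bar>^Suc 2 / fact (Suc 2) = \<bar>\<theta>\<bar>^3 / 6 * \<bar>y\<bar> * y\<^sup>2"
      proof -
        have y3: "\<bar>y\<bar>^3 = \<bar>y\<bar> * y\<^sup>2" by (simp add: power3_eq_cube power2_eq_square mult.assoc)
        have "Suc 2 = 3" "(fact 3 :: real) = 6" by (simp_all add: fact_numeral)
        then show ?thesis by (simp only: abs_mult power_mult_distrib y3)
      qed
      also have "(\<Sum>k\<le>2. (\<i> * of_real (\<theta> * y))^k / fact k) = 1 + w * of_real y + (w\<^sup>2 / 2) * (of_real y)\<^sup>2"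
        by (simp add: w numeral_eq_Suc power2_eq_square algebra_simps)
      also have "iexp (\<theta> * y) = exp (w * of_real y)" by (simp add: w mult.assoc)
      finally have "norm (exp (w * of_real y) - (1 + w * of_real y + (w\<^sup>2 / 2) * (of_real y)\<^sup>2)) \<le> \<bar>\<theta>\<bar>^3 / 6 * \<bar>y\<bar> * y\<^sup>2" .
      moreover have "exp (w * of_real y) - (1 + w * of_real y + (w\<^sup>2 / 2) * (of_real y)\<^sup>2) = (LK_quot2 w y - w\<^sup>2 / 2) * (of_real y)\<^sup>2"
        using y by (simp add: LK_quot2_def c field_simps)
      ultimately show "norm (LK_quot2 w y - w\<^sup>2 / 2) \<le> \<bar>\<theta>\<bar>^3 / 6 * \<bar>y\<bar>"
        using y by (simp add: norm_mult norm_power power2_abs)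
    qed simp
  qed
  then show "(LK_quot2 w \<longlongrightarrow> LK_quot2 w 0) (at 0)" by (simp add: LK_quot2_def[of w 0] LIM_zero_iff)
qed

lemma norm_LK_quot1_le:
  assumes "Re z \<le> 0" "0 \<le> x"
  shows "norm (LK_quot1 z x) \<le> 2 + norm z"
proof (cases "x = 0")
  case False
  then have c: "0 < chi x" using assms by (simp add: chi_nonneg_eq)
  have "chi x * norm (LK_quot1 z x) \<le> (2 + norm z) * chi x"
    using norm_exp_minus_1_le_chi[OF assms] LK_quot1_mult[of x z] c
    by (metis abs_of_pos norm_mult norm_of_real)
  then show ?thesis using c by (simp add: mult.commute)
qed (simp add: LK_quot1_def)

lemma norm_LK_quot2_le:
  assumes "Re w = 0"
  shows "norm (LK_quot2 w y) \<le> 2 + norm w + (norm w)\<^sup>2"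
proof (cases "y = 0")
  case False
  then have c: "0 < (chi y)\<^sup>2" by (simp add: chi_eq_0_iff)
  have "norm ((of_real (chi y))\<^sup>2 * LK_quot2 w y) \<le> (2 + norm w + (norm w)\<^sup>2) * (chi y)\<^sup>2"
    unfolding LK_quot2_mult by (rule norm_iexp_minus_le_chi_sq[OF assms])
  then have "(chi y)\<^sup>2 * norm (LK_quot2 w y) \<le> (2 + norm w + (norm w)\<^sup>2) * (chi y)\<^sup>2"
    by (simp add: norm_mult norm_power)
  then show ?thesis using c by (simp add: mult.commute)
qed (simp add: LK_quot2_def norm_power norm_divide field_simps add_increasing)

section \<open>Truncated moments\<close>

text \<open>\<open>1 - sin y / y\<close> is the mean of \<open>1 - cos (s y)\<close> over
  \<open>s\<close> in \<open>[0, 1]\<close>. On \<open>(0, 2]\<close> the fifth-order Taylor bound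
  shows that it is at least \<open>(1/6 - 1/30) * y\<^sup>2\<close>, hence at least
  \<open>y\<^sup>2 / 8\<close>; beyond 2 it is at least \<open>1/2\<close>.\<close>

lemma chi_sq_le_sinc:
  assumes "y \<noteq> 0"
  shows "(chi y)\<^sup>2 \<le> 8 * (1 - sin y / y)"
proof -
  have pos: "(chi y)\<^sup>2 \<le> 8 * (1 - sin y / y)" if "y > 0" for y :: real
  proof (cases "y \<le> 2")
    case True
    have "\<bar>sin y - (\<Sum>m<5. sin_coeff m * y ^ m)\<bar> \<le> inverse (fact 5) * \<bar>y\<bar> ^ 5"
      by (rule Maclaurin_sin_bound)
    moreover have "(\<Sum>m<5. sin_coeff m * y ^ m) = y - y^3 / 6"
    proof -
      have "{..<5} = {0, 1, 2, 3, 4 :: nat}" by auto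
      then show ?thesis by (simp add: sin_coeff_def fact_numeral)
    qed
    ultimately have "sin y \<le> y - y^3 / 6 + y^5 / 120"
      using that abs_ge_self[of "sin y - (y - y^3 / 6)"] by (simp add: fact_numeral)
    also have "y^5 / 120 \<le> 4 * y^3 / 120"
    proof -
      have "y^2 \<le> 2^2" using True that by (intro power_mono) auto
      then have "y^2 * y^3 \<le> 4 * y^3" using that by (intro mult_right_mono) auto
      then show ?thesis by (simp add: power_add[symmetric])
    qed
    finally have "sin y \<le> y - y^3 / 8" using zero_less_power[OF that, of 3] by linarith
    then have "sin y / y \<le> (y - y^3 / 8) / y" using that by (intro divide_right_mono) auto
    also have "\<dots> = 1 - y^2 / 8" using that by (simp add: field_simps power3_eq_cube power2_eq_square)
    finally show ?thesis using chi_sq_le_sq[of y] by simp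
  next
    case False
    then have "sin y * 2 \<le> y" using sin_le_one[of y] by linarith
    then have "sin y / y \<le> 1 / 2" using that by (simp add: field_simps)
    then show ?thesis using chi_sq_le_1[of y] by simp
  qed
  show ?thesis
  proof (cases "y > 0")
    case False
    then have "(chi (- y))\<^sup>2 \<le> 8 * (1 - sin (- y) / (- y))" using assms by (intro pos) auto
    then show ?thesis by (simp add: chi_def split: if_splits)
  qed (rule pos)
qed

text \<open>By \<open>chi_sq_le_sinc\<close> the integrand is at most 8 times the mean of
  \<open>1 - cos (s * d * y)\<close> over \<open>s\<close> in \<open>[0, 1]\<close>. After the
  integrals are exchanged, each \<open>s\<close> contributes the real part of one minus the
  transform, which is at most \<open>B\<close>.\<close>

lemma integral_chi_snd_sq_le:
  assumes M: "M \<in> space (prob_algebra borel_D)" and d: "0 \<le> d"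
    and B: "\<And>\<theta>. 0 \<le> \<theta> \<Longrightarrow> \<theta> \<le> d \<Longrightarrow> Re (1 - transform M (0, \<i> * of_real \<theta>)) \<le> B"
  shows "(\<integral>\<xi>. (chi (d * snd \<xi>))\<^sup>2 \<partial>M) \<le> 8 * B"
proof -
  interpret M: prob_space M using M by (auto dest: prob_algebra_D)
  note sM = prob_algebra_D(2)[OF M]
  note [measurable] = fst_snd_measurable_D[OF sM]
  define L where "L = restrict_space lborel {0..1::real}"
  have eL: "emeasure L (space L) = 1"
    by (simp add: L_def space_restrict_space emeasure_restrict_space)
  interpret L: prob_space L using eL by (rule prob_spaceI)
  interpret pair_prob_space L M ..
  have idL [measurable]: "(\<lambda>s. s) \<in> L \<rightarrow>\<^sub>M borel"
    unfolding L_def by (intro measurable_restrict_space1) simp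
  have sL: "space L = {0..1}" by (simp add: L_def space_restrict_space)
  define F where "F s \<xi> = 1 - cos (s * (d * snd \<xi>))" for s :: real and \<xi> :: "real \<times> real"
  have F_bd: "\<bar>F s \<xi>\<bar> \<le> 2" for s \<xi> unfolding F_def using cos_ge_minus_one cos_le_one by (smt (verit))
  have Fm [measurable]: "case_prod F \<in> borel_measurable (L \<Otimes>\<^sub>M M)" unfolding F_def by measurable
  have int: "integrable (L \<Otimes>\<^sub>M M) (case_prod F)"
    using F_bd by (intro P.integrable_const_bound[where B=2]) auto
  have inner: "(\<integral>\<xi>. F s \<xi> \<partial>M) \<le> B" if s: "s \<in> {0..1}" for s
  proof -
    have U: "(0, \<i> * of_real (s * d)) \<in> dom_U" by (auto intro: dom_UI)
    have int: "integrable M (\<lambda>\<xi>. exp (pairing (0, \<i> * of_real (s * d)) \<xi>))"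
      by (rule integrable_exp_pairing[OF M.finite_measure_axioms sM U])
    have "F s \<xi> = Re (1 - exp (pairing (0, \<i> * of_real (s * d)) \<xi>))" for \<xi>
      by (simp add: F_def pairing_def Re_exp mult.assoc)
    then have "(\<integral>\<xi>. F s \<xi> \<partial>M) = Re (1 - transform M (0, \<i> * of_real (s * d)))"
      unfolding transform_def using int M.prob_space by (simp del: Re_exp)
    also have "\<dots> \<le> B" using s d by (intro B) (auto simp: mult_left_le_one_le)
    finally show ?thesis .
  qed
  have outer: "(chi (d * snd \<xi>))\<^sup>2 \<le> 8 * (\<integral>s. F s \<xi> \<partial>L)" for \<xi>
  proof (cases "d * snd \<xi> = 0")
    case False
    define y where "y = d * snd \<xi>"
    have y: "y \<noteq> 0" using False by (simp add: y_def)
    have "(\<integral>s. F s \<xi> \<partial>L) = (\<integral>s. indicator {0..1} s *\<^sub>R (1 - cos (s * y)) \<partial>lborel)"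
      unfolding L_def F_def y_def by (subst integral_restrict_space) auto
    also have "\<dots> = (1 - sin (1 * y) / y) - (0 - sin (0 * y) / y)"
      using y by (intro integral_FTC_atLeastAtMost)
        (auto intro!: derivative_eq_intros continuous_intros simp: has_real_derivative_iff_has_vector_derivative[symmetric])
    finally show ?thesis using chi_sq_le_sinc[OF y] by (simp add: y_def)
  qed (auto simp: F_def)
  have "(\<integral>\<xi>. (chi (d * snd \<xi>))\<^sup>2 \<partial>M) \<le> (\<integral>\<xi>. 8 * (\<integral>s. F s \<xi> \<partial>L) \<partial>M)"
  proof (rule integral_mono)
    show "integrable M (\<lambda>\<xi>. (chi (d * snd \<xi>))\<^sup>2)"
      using chi_sq_le_1 by (intro integrable_bounded_on_D[OF M.finite_measure_axioms sM, where B=1] continuous_on_D_measurable[OF sM] continuous_intros) auto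
    show "integrable M (\<lambda>\<xi>. 8 * (\<integral>s. F s \<xi> \<partial>L))"
      using integrable_snd[OF int] by simp
  qed (rule outer)
  also have "\<dots> = 8 * (\<integral>\<xi>. (\<integral>s. F s \<xi> \<partial>L) \<partial>M)" by simp
  also have "(\<integral>\<xi>. (\<integral>s. F s \<xi> \<partial>L) \<partial>M) = (\<integral>s. (\<integral>\<xi>. F s \<xi> \<partial>M) \<partial>L)"
    by (rule Fubini_integral[OF int])
  also have "\<dots> \<le> (\<integral>s. B \<partial>L)"
    using inner integrable_fst[OF int] by (intro integral_mono) (auto simp: sL)
  also have "\<dots> = B" using L.prob_space by simp
  finally show ?thesis by simp
qed

lemma integral_chi_fst_le:
  assumes M: "M \<in> space (prob_algebra borel_D)" and d: "0 \<le> d"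
  shows "(\<integral>\<xi>. chi (d * fst \<xi>) \<partial>M) \<le> 2 * norm (1 - transform M (of_real (- d), 0))"
proof -
  interpret prob_space M using M by (auto dest: prob_algebra_D)
  note sM = prob_algebra_D(2)[OF M]
  have "(\<integral>\<xi>. chi (d * fst \<xi>) \<partial>M) \<le> (\<integral>\<xi>. 2 * (1 - exp (- d * fst \<xi>)) \<partial>M)"
  proof (rule integral_mono)
    show "integrable M (\<lambda>\<xi>. chi (d * fst \<xi>))"
      using abs_chi_le_1 by (intro integrable_bounded_on_D[OF finite_measure_axioms sM, where B=1] continuous_on_D_measurable[OF sM] continuous_intros) auto
    show "integrable M (\<lambda>\<xi>. 2 * (1 - exp (- d * fst \<xi>)))"
      using d by (intro integrable_mult_right integral_one_minus_exp[OF M])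
    fix \<xi> assume "\<xi> \<in> space M"
    then have "0 \<le> d * fst \<xi>" using d by (auto simp: space_of_sets_borel_D[OF sM] state_D_def)
    then show "chi (d * fst \<xi>) \<le> 2 * (1 - exp (- d * fst \<xi>))"
      using min_1_le_exp[of "d * fst \<xi>"] by (simp add: chi_nonneg_eq)
  qed
  also have "\<dots> = 2 * (1 - lap M d)"
    by (simp only: integral_mult_right_zero integral_one_minus_exp(1)[OF M d])
  also have "1 - lap M d \<le> norm (complex_of_real (1 - lap M d))"
    unfolding norm_of_real by (rule abs_ge_self)
  also have "complex_of_real (1 - lap M d) = 1 - transform M (of_real (- d), 0)"
    unfolding transform_eq_lap by simp
  finally show ?thesis by simp
qed

section \<open>Existence of the Levy-Khintchine representation\<close>

lemma closed_dom_U: "closed dom_U"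
  unfolding dom_U_def by (intro closed_Int closed_Collect_le closed_Collect_eq continuous_intros)

lemma scaled_exp_diff_tendsto:
  fixes z :: complex
  shows "(\<lambda>n. of_nat (Suc n) * (exp (z / of_nat (Suc n)) - 1)) \<longlonglongrightarrow> z"
proof -
  have "((\<lambda>v. exp (z * v)) has_field_derivative z) (at 0)"
    by (auto intro!: derivative_eq_intros)
  then have "((\<lambda>h. (exp (z * h) - 1) / h) \<longlongrightarrow> z) (at 0)"
    by (simp add: DERIV_def)
  moreover have "filterlim (\<lambda>n. 1 / of_nat (Suc n) :: complex) (at 0) sequentially"
    unfolding filterlim_at by (intro conjI LIMSEQ_Suc lim_const_over_n always_eventually) (simp_all del: of_nat_Suc)
  ultimately have "(\<lambda>n. (exp (z * (1 / of_nat (Suc n))) - 1) / (1 / of_nat (Suc n))) \<longlonglongrightarrow> z"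
    by (rule filterlim_compose)
  then show ?thesis by (simp add: mult.commute)
qed

text \<open>The measures \<open>k N\<^sub>k\<close>, \<open>k = n + 1\<close>, where \<open>N\<^sub>k\<close> is a \<open>k\<close>-th root, converge to the Levy measure away from
  the origin. Near the origin the Levy-Khintchine integrand divided by \<^const>\<open>weight\<close> is not continuous, so
  the weak limits \<open>A\<close> and \<open>B\<close> for the weights \<open>\<chi>(\<xi>\<^sub>1)\<close> and \<open>\<chi>(\<xi>\<^sub>2)\<^sup>2\<close> are taken separately; their masses at the origin yield
  the drift and the diffusion coefficient.\<close>

lemma LK_exists:
  fixes \<phi> :: "complex \<times> complex \<Rightarrow> complex"
  assumes \<phi>: "continuous_on dom_U \<phi>" "\<phi> 0 = 0" "\<And>u. u \<in> dom_U \<Longrightarrow> Re (\<phi> u) \<le> 0"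
    and N: "\<And>n. N n \<in> space (prob_algebra borel_D)"
    and trN: "\<And>n u. u \<in> dom_U \<Longrightarrow> transform (N n) u = exp (\<phi> u / of_nat (Suc n))"
  obtains b1 b2 a m where "LK_triple b1 b2 a m" "\<And>u. u \<in> dom_U \<Longrightarrow> \<phi> u = LK_exponent b1 b2 a m u"
proof -
  define c where "c n = real (Suc n)" for n
  have c: "c n > 0" and c': "of_nat (Suc n) = complex_of_real (c n)" for n by (auto simp: c_def)
  have sN: "sets (N n) = sets borel_D" and fN: "finite_measure (N n)" and pN: "prob_space (N n)" for n
    using N prob_algebra_D by blast+
  have spN: "space (N n) = state_D" for n by (rule space_of_sets_borel_D[OF sN])
  \<comment> \<open>The estimate
    \<open>norm (1 - exp (\<phi> u / k)) \<le> norm (\<phi> u) / k\<close> keeps the rescaled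
    differences bounded although \<open>k\<close> grows.\<close>
  have diff_le: "c n * norm (1 - transform (N n) u) \<le> norm (\<phi> u)" if u: "u \<in> dom_U" for n u
  proof -
    have "norm (exp (\<phi> u / of_nat (Suc n)) - exp 0) \<le> norm (\<phi> u / of_nat (Suc n) - 0)"
      using \<phi>(3)[OF u] by (intro norm_exp_diff_le(1)) (auto simp: divide_nonpos_pos c' c)
    then have "norm (1 - transform (N n) u) \<le> norm (\<phi> u) / c n"
      using c[of n] by (simp add: trN[OF u] norm_minus_commute norm_divide c' del: of_nat_Suc)
    then show ?thesis using c[of n] by (simp add: field_simps)
  qed
  have lim: "(\<lambda>n. of_real (c n) * (transform (N n) u - 1)) \<longlonglongrightarrow> \<phi> u" if u: "u \<in> dom_U" for u
    using scaled_exp_diff_tendsto[of "\<phi> u"] by (simp only: trN[OF u] c')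
  have int: "integrable (N n) f" if "continuous_on state_D f" "\<And>\<xi>. \<xi> \<in> state_D \<Longrightarrow> norm (f \<xi>) \<le> K" for n K and f :: "real \<times> real \<Rightarrow> 'c::{banach, second_countable_topology}"
    using that by (intro integrable_bounded_on_D[OF fN sN, where B=K] continuous_on_D_measurable[OF sN])
  have chi1_c: "continuous_on state_D (\<lambda>\<xi>. chi (d * fst \<xi>))" and chi2_c: "continuous_on state_D (\<lambda>\<xi>. (chi (d * snd \<xi>))\<^sup>2)" for d
    by (intro continuous_intros)+
  \<comment> \<open>Here \<open>10 = 2 + 8\<close>, the constants of
    \<open>integral_chi_fst_le\<close> and \<open>integral_chi_snd_sq_le\<close>.\<close>
  have moment: "c n * (\<integral>\<xi>. chi (d * fst \<xi>) + (chi (d * snd \<xi>))\<^sup>2 \<partial>N n) \<le> 10 * \<eta>"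
    if d: "d \<ge> 0" and \<eta>: "\<And>u. u \<in> dom_U \<Longrightarrow> norm u \<le> d \<Longrightarrow> norm (\<phi> u) \<le> \<eta>" for d \<eta> n
  proof -
    have U1: "(complex_of_real (- d), 0) \<in> dom_U" using d by (auto intro: dom_UI)
    have i: "integrable (N n) (\<lambda>\<xi>. chi (d * fst \<xi>))" "integrable (N n) (\<lambda>\<xi>. (chi (d * snd \<xi>))\<^sup>2)"
      using abs_chi_le_1 chi_sq_le_1 by (auto intro!: int[of _ 1] chi1_c chi2_c)
    have "c n * (\<integral>\<xi>. chi (d * fst \<xi>) \<partial>N n) \<le> c n * (2 * norm (1 - transform (N n) (of_real (- d), 0)))"
      using c[of n] by (intro mult_left_mono integral_chi_fst_le N d) auto
    also have "\<dots> \<le> 2 * \<eta>"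
      using diff_le[OF U1, of n] \<eta>[OF U1] d by (simp add: norm_Pair)
    finally have 1: "c n * (\<integral>\<xi>. chi (d * fst \<xi>) \<partial>N n) \<le> 2 * \<eta>" .
    have "(\<integral>\<xi>. (chi (d * snd \<xi>))\<^sup>2 \<partial>N n) \<le> 8 * (\<eta> / c n)"
    proof (rule integral_chi_snd_sq_le[OF N d])
      fix \<theta> assume \<theta>: "0 \<le> \<theta>" "\<theta> \<le> d"
      have U: "(0, \<i> * of_real \<theta>) \<in> dom_U" by (auto intro: dom_UI)
      have "norm (\<phi> (0, \<i> * of_real \<theta>)) \<le> \<eta>" using \<theta> by (intro \<eta> U) (simp add: norm_Pair norm_mult)
      then have "c n * norm (1 - transform (N n) (0, \<i> * of_real \<theta>)) \<le> \<eta>" using diff_le[OF U, of n] by linarith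
      then have "norm (1 - transform (N n) (0, \<i> * of_real \<theta>)) \<le> \<eta> / c n" using c[of n] by (simp add: field_simps)
      then show "Re (1 - transform (N n) (0, \<i> * of_real \<theta>)) \<le> \<eta> / c n" by (rule order_trans[OF complex_Re_le_cmod])
    qed
    then have 2: "c n * (\<integral>\<xi>. (chi (d * snd \<xi>))\<^sup>2 \<partial>N n) \<le> 8 * \<eta>" using c[of n] by (simp add: field_simps)
    show ?thesis using 1 2 i by (simp add: distrib_left)
  qed
  have weight_alt: "weight \<xi> = chi (1 * fst \<xi>) + (chi (1 * snd \<xi>))\<^sup>2" for \<xi> by (simp add: weight_def)
  obtain C where C: "\<And>n. c n * (\<integral>\<xi>. weight \<xi> \<partial>N n) \<le> C"
  proof -
    have "compact (dom_U \<inter> cball 0 1)" by (intro closed_Int_compact closed_dom_U compact_cball)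
    then have "bounded (\<phi> ` (dom_U \<inter> cball 0 1))"
      by (intro compact_imp_bounded compact_continuous_image continuous_on_subset[OF \<phi>(1)]) auto
    then obtain K where "\<And>u. u \<in> dom_U \<Longrightarrow> norm u \<le> 1 \<Longrightarrow> norm (\<phi> u) \<le> K"
      unfolding bounded_iff by fastforce
    then have "c n * (\<integral>\<xi>. weight \<xi> \<partial>N n) \<le> 10 * K" for n unfolding weight_alt by (intro moment) auto
    then show thesis by (rule that)
  qed
  \<comment> \<open>Continuity of \<open>\<phi>\<close> at the origin makes these moments uniformly
    small for small \<open>d\<close>. As the integrand is at least 1 where \<open>fst \<xi>\<close>
    or \<open>\<bar>snd \<xi>\<bar>\<close> exceeds \<open>1 / d\<close>, this is the tightness used
    below.\<close>
  have small: "\<exists>d>0. \<forall>n. c n * (\<integral>\<xi>. chi (d * fst \<xi>) + (chi (d * snd \<xi>))\<^sup>2 \<partial>N n) \<le> \<epsilon>" if \<epsilon>: "\<epsilon> > 0" for \<epsilon>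
  proof -
    obtain \<delta> where \<delta>: "\<delta> > 0" "\<And>u. u \<in> dom_U \<Longrightarrow> dist u 0 < \<delta> \<Longrightarrow> dist (\<phi> u) (\<phi> 0) < \<epsilon> / 10"
      using \<phi>(1) \<epsilon> unfolding continuous_on_iff by (metis zero_in_dom_U(1) divide_pos_pos zero_less_numeral)
    have sm: "norm (\<phi> u) \<le> \<epsilon> / 10" if "u \<in> dom_U" "norm u \<le> \<delta> / 2" for u
      using \<delta>(2)[of u] that \<delta>(1) \<phi>(2) by (simp add: less_imp_le)
    have "c n * (\<integral>\<xi>. chi (\<delta> / 2 * fst \<xi>) + (chi (\<delta> / 2 * snd \<xi>))\<^sup>2 \<partial>N n) \<le> 10 * (\<epsilon> / 10)" for n
      using \<delta>(1) by (intro moment sm) auto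
    then have "\<forall>n. c n * (\<integral>\<xi>. chi (\<delta> / 2 * fst \<xi>) + (chi (\<delta> / 2 * snd \<xi>))\<^sup>2 \<partial>N n) \<le> \<epsilon>" by simp
    moreover have "\<delta> / 2 > 0" using \<delta>(1) by simp
    ultimately show ?thesis by blast
  qed
  \<comment> \<open>Extraction of a weak limit for one weight \<open>w\<close> along given indices
    \<open>q\<close>. It is applied three times, each time refining the previous
    subsequence.\<close>
  have sub: "\<exists>r V. strict_mono (r :: nat \<Rightarrow> nat) \<and> finite_measure V \<and> sets V = sets borel_D \<and>
      (\<forall>f :: real \<times> real \<Rightarrow> complex. continuous_on state_D f \<longrightarrow> bounded (f ` state_D) \<longrightarrow>
        (\<lambda>n. of_real (c (q (r n))) * (\<integral>\<xi>. of_real (w \<xi>) * f \<xi> \<partial>N (q (r n)))) \<longlonglongrightarrow> (\<integral>\<xi>. f \<xi> \<partial>V))"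
    if w: "continuous_on state_D w" "\<And>\<xi>. \<xi> \<in> state_D \<Longrightarrow> 0 \<le> w \<xi>" "\<And>\<xi>. \<xi> \<in> state_D \<Longrightarrow> w \<xi> \<le> weight \<xi>"
    for w :: "real \<times> real \<Rightarrow> real" and q :: "nat \<Rightarrow> nat"
  proof -
    define M where "M n = density (N (q n)) (\<lambda>\<xi>. ennreal (c (q n) * w \<xi>))" for n
    have wm: "w \<in> borel_measurable (N n)" for n by (rule continuous_on_D_measurable[OF sN w(1)])
    have w2: "w \<xi> \<le> 2" if "\<xi> \<in> state_D" for \<xi> using w(3)[OF that] weight_le_2[OF that] by simp
    have sM: "sets (M n) = sets borel_D" for n by (simp add: M_def sN)
    have fM: "finite_measure (M n)" for n
      unfolding M_def using c[of "q n"] w2 wm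
      by (intro finite_measure_density_le[OF fN, where B="c (q n) * 2"]) (auto simp: spN intro!: ennreal_leI)
    have iM: "(\<integral>\<xi>. f \<xi> \<partial>M n) = of_real (c (q n)) * (\<integral>\<xi>. of_real (w \<xi>) * f \<xi> \<partial>N (q n))"
      if "f \<in> borel_measurable borel_D" for f :: "real \<times> real \<Rightarrow> complex" and n
    proof -
      have "f \<in> borel_measurable (N (q n))" using that sN by (simp cong: measurable_cong_sets)
      then have "(\<integral>\<xi>. f \<xi> \<partial>M n) = (\<integral>\<xi>. (c (q n) * w \<xi>) *\<^sub>R f \<xi> \<partial>N (q n))"
        unfolding M_def using c[of "q n"] w(2) wm by (intro integral_density) (auto simp: spN)
      then show ?thesis by (simp add: scaleR_conv_of_real mult.assoc)
    qed
    have mM: "measure (M n) S = c (q n) * (\<integral>\<xi>. w \<xi> * indicator S \<xi> \<partial>N (q n))" if "S \<in> sets borel_D" for S n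
    proof -
      interpret finite_measure "M n" by (rule fM)
      have S: "S \<in> sets (M n)" "S \<in> sets (N (q n))" using that sM sN by auto
      have "measure (M n) S = (\<integral>\<xi>. indicator S \<xi> \<partial>M n)" using S by simp
      also have "\<dots> = (\<integral>\<xi>. (c (q n) * w \<xi>) *\<^sub>R indicator S \<xi> \<partial>N (q n))"
        unfolding M_def using c[of "q n"] w(2) wm S by (intro integral_density) (auto simp: spN)
      finally show ?thesis by (simp add: mult.assoc)
    qed
    have iw: "integrable (N n) (\<lambda>\<xi>. w \<xi> * indicator S \<xi>)" if "S \<in> sets borel_D" for n S
      using that w2 w(2) wm[of n] sN[of n]
      by (intro integrable_bounded_on_D[OF fN sN, where B=2]) (auto split: split_indicator)
    have iweight: "integrable (N n) weight" for n
      using weight_nonneg weight_le_2 by (intro int[of _ 2] continuous_on_weight) auto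
    have mass: "measure (M n) state_D \<le> C" for n
    proof -
      have D: "state_D \<in> sets borel_D" using state_D_borel by (simp add: sets_borel_D_iff)
      have "(\<integral>\<xi>. w \<xi> * indicator state_D \<xi> \<partial>N (q n)) \<le> (\<integral>\<xi>. weight \<xi> \<partial>N (q n))"
        using w(3) by (intro integral_mono iw D iweight) (auto simp: spN)
      then have "measure (M n) state_D \<le> c (q n) * (\<integral>\<xi>. weight \<xi> \<partial>N (q n))"
        unfolding mM[OF D] using c[of "q n"] by (intro mult_left_mono) auto
      then show ?thesis using C[of "q n"] by linarith
    qed
    have tail: "\<exists>R. \<forall>\<^sub>F n in sequentially. measure (M n) {\<xi>\<in>state_D. R < fst \<xi> \<or> R < \<bar>snd \<xi>\<bar>} \<le> \<epsilon>" if \<epsilon>: "\<epsilon> > 0" for \<epsilon>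
    proof -
      obtain d where d: "d > 0" "\<And>n. c n * (\<integral>\<xi>. chi (d * fst \<xi>) + (chi (d * snd \<xi>))\<^sup>2 \<partial>N n) \<le> \<epsilon> / 2"
        using small[of "\<epsilon> / 2"] \<epsilon> by auto
      define S where "S = {\<xi>\<in>state_D. 1 / d < fst \<xi> \<or> 1 / d < \<bar>snd \<xi>\<bar>}"
      have S: "S \<in> sets borel_D"
      proof -
        have "{\<xi>::real\<times>real. 1 / d < fst \<xi> \<or> 1 / d < \<bar>snd \<xi>\<bar>} \<in> sets borel"
          by (intro borel_open open_Collect_disj open_Collect_less continuous_intros)
        moreover have "S = {\<xi>::real\<times>real. 1 / d < fst \<xi> \<or> 1 / d < \<bar>snd \<xi>\<bar>} \<inter> state_D" by (auto simp: S_def)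
        ultimately show ?thesis using state_D_borel by (simp add: sets_borel_D_iff)
      qed
      have "measure (M n) S \<le> \<epsilon>" for n
      proof -
        have "(\<integral>\<xi>. w \<xi> * indicator S \<xi> \<partial>N (q n)) \<le> (\<integral>\<xi>. 2 * (chi (d * fst \<xi>) + (chi (d * snd \<xi>))\<^sup>2) \<partial>N (q n))"
        proof (intro integral_mono iw S)
          show "integrable (N (q n)) (\<lambda>\<xi>. 2 * (chi (d * fst \<xi>) + (chi (d * snd \<xi>))\<^sup>2))"
            using abs_chi_le_1 chi_sq_le_1
            by (intro integrable_mult_right Bochner_Integration.integrable_add int[of _ 1] chi1_c chi2_c) auto
          fix \<xi> assume "\<xi> \<in> space (N (q n))"
          then have \<xi>: "\<xi> \<in> state_D" by (simp add: spN)
          have nn: "0 \<le> chi (d * fst \<xi>)" using \<xi> d(1) by (intro chi_nonneg) (auto simp: state_D_def)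
          have "1 \<le> chi (d * fst \<xi>) + (chi (d * snd \<xi>))\<^sup>2" if "\<xi> \<in> S"
          proof (cases "1 / d < fst \<xi>")
            case True
            then have "d * fst \<xi> > 1" using d(1) by (simp add: field_simps)
            then show ?thesis by (simp add: chi_def)
          next
            case False
            then have "\<bar>d * snd \<xi>\<bar> \<ge> 1" using that d(1) by (auto simp: S_def abs_mult field_simps)
            then show ?thesis using nn by (simp add: chi_sq_eq_1)
          qed
          then show "w \<xi> * indicator S \<xi> \<le> 2 * (chi (d * fst \<xi>) + (chi (d * snd \<xi>))\<^sup>2)"
            using w2[OF \<xi>] nn by (auto split: split_indicator)
        qed
        then have "c (q n) * (\<integral>\<xi>. w \<xi> * indicator S \<xi> \<partial>N (q n)) \<le> c (q n) * (2 * (\<integral>\<xi>. chi (d * fst \<xi>) + (chi (d * snd \<xi>))\<^sup>2 \<partial>N (q n)))"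
          using c[of "q n"] by (intro mult_left_mono) (auto simp only: integral_mult_right_zero)
        also have "\<dots> \<le> \<epsilon>" using d(2)[of "q n"] by simp
        finally show ?thesis unfolding mM[OF S] .
      qed
      then show ?thesis unfolding S_def by (intro exI[of _ "1 / d"]) simp
    qed
    from tight_subsequence[OF fM sM mass tail]
    obtain r V where "strict_mono (r :: nat \<Rightarrow> nat)" "finite_measure V" "sets V = sets borel_D"
      and conv: "\<And>f :: real \<times> real \<Rightarrow> complex. continuous_on state_D f \<Longrightarrow> bounded (f ` state_D) \<Longrightarrow>
         (\<lambda>n. \<integral>\<xi>. f \<xi> \<partial>M (r n)) \<longlonglongrightarrow> (\<integral>\<xi>. f \<xi> \<partial>V)" by metis
    moreover have "(\<lambda>n. of_real (c (q (r n))) * (\<integral>\<xi>. of_real (w \<xi>) * f \<xi> \<partial>N (q (r n)))) \<longlonglongrightarrow> (\<integral>\<xi>. f \<xi> \<partial>V)"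
      if f: "continuous_on state_D f" "bounded (f ` state_D)" for f :: "real \<times> real \<Rightarrow> complex"
      using conv[OF f] iM[OF continuous_on_D_measurable[OF refl f(1)]] by simp
    ultimately show ?thesis by blast
  qed
  define w1 w2 :: "real \<times> real \<Rightarrow> real" where "w1 \<xi> = chi (fst \<xi>)" and "w2 \<xi> = (chi (snd \<xi>))\<^sup>2" for \<xi>
  have w1: "continuous_on state_D w1" "\<And>\<xi>. \<xi> \<in> state_D \<Longrightarrow> 0 \<le> w1 \<xi>" "\<And>\<xi>. \<xi> \<in> state_D \<Longrightarrow> w1 \<xi> \<le> weight \<xi>"
    unfolding w1_def using chi_fst_nonneg chi_fst_le_weight by (auto intro!: continuous_intros)
  have w2: "continuous_on state_D w2" "\<And>\<xi>. \<xi> \<in> state_D \<Longrightarrow> 0 \<le> w2 \<xi>" "\<And>\<xi>. \<xi> \<in> state_D \<Longrightarrow> w2 \<xi> \<le> weight \<xi>"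
    unfolding w2_def using chi_snd_le_weight by (auto intro!: continuous_intros)
  define conv where "conv r w V \<longleftrightarrow> (\<forall>f :: real \<times> real \<Rightarrow> complex. continuous_on state_D f \<longrightarrow> bounded (f ` state_D) \<longrightarrow>
        (\<lambda>n. of_real (c (r n)) * (\<integral>\<xi>. of_real (w \<xi>) * f \<xi> \<partial>N (r n))) \<longlonglongrightarrow> (\<integral>\<xi>. f \<xi> \<partial>V))"
    for r :: "nat \<Rightarrow> nat" and w :: "real \<times> real \<Rightarrow> real" and V
  have conv_sub: "conv (r \<circ> s) w V" if "conv r w V" "strict_mono s" for r s :: "nat \<Rightarrow> nat" and w V
    using that unfolding conv_def comp_def
    by (auto intro: LIMSEQ_subseq_LIMSEQ[where f=s, unfolded comp_def])
  obtain r1 A where r1: "strict_mono r1" and A: "finite_measure A" "sets A = sets borel_D" and "conv (id \<circ> r1) w1 A"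
    using sub[OF w1, of id] unfolding conv_def comp_def by blast
  moreover obtain r2 B where r2: "strict_mono r2" and B: "finite_measure B" "sets B = sets borel_D" and "conv (r1 \<circ> r2) w2 B"
    using sub[OF w2, of r1] unfolding conv_def comp_def by blast
  \<comment> \<open>The limit for the full \<open>weight\<close> provides one reference measure from
    which a common Levy measure for \<open>A\<close> and \<open>B\<close> is read off.\<close>
  moreover obtain r3 G where r3: "strict_mono r3" and G: "finite_measure G" "sets G = sets borel_D" and "conv ((r1 \<circ> r2) \<circ> r3) weight G"
    using sub[OF continuous_on_weight weight_nonneg order_refl, of "r1 \<circ> r2"] unfolding conv_def comp_def by blast
  moreover define r where "r = r1 \<circ> r2 \<circ> r3"
  ultimately have convA: "conv r w1 A" and convB: "conv r w2 B" and convG: "conv r weight G"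
    using conv_sub[OF conv_sub[of r1 w1 A, OF _ r2] r3] conv_sub[of "r1 \<circ> r2" w2 B, OF _ r3] by auto
  have r: "strict_mono r" unfolding r_def by (intro strict_mono_o r1 r2 r3)
  define f where "f u \<xi> = LK_quot1 (fst u) (fst \<xi>) * exp (snd u * of_real (snd \<xi>))" for u :: "complex \<times> complex" and \<xi> :: "real \<times> real"
  define g where "g u \<xi> = LK_quot2 (snd u) (snd \<xi>)" for u :: "complex \<times> complex" and \<xi> :: "real \<times> real"
  have f_c: "continuous_on state_D (f u)" for u
    unfolding f_def by (intro continuous_intros continuous_on_compose2[OF continuous_on_LK_quot1]) auto
  have g_c: "continuous_on state_D (g u)" if "u \<in> dom_U" for u
    unfolding g_def by (intro continuous_intros continuous_on_compose2[OF continuous_on_LK_quot2] dom_UD that) auto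
  have f_b: "norm (f u \<xi>) \<le> 2 + norm (fst u)" if "u \<in> dom_U" "\<xi> \<in> state_D" for u \<xi>
    using norm_LK_quot1_le[of "fst u" "fst \<xi>"] dom_UD[OF that(1)] that(2)
    by (auto simp: f_def norm_mult state_D_def)
  have g_b: "norm (g u \<xi>) \<le> 2 + norm (snd u) + (norm (snd u))\<^sup>2" if "u \<in> dom_U" for u \<xi>
    unfolding g_def by (intro norm_LK_quot2_le dom_UD that)
  have bdd: "bounded (f u ` state_D)" "bounded (g u ` state_D)" if "u \<in> dom_U" for u
    using f_b[OF that] g_b[OF that] by (auto intro!: boundedI)
  have split: "LK_integrand u \<xi> = of_real (w1 \<xi>) * f u \<xi> + of_real (w2 \<xi>) * g u \<xi>" for u \<xi>
    unfolding LK_integrand_split w1_def w2_def f_def g_def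
    by (simp only: of_real_power mult.assoc[symmetric] LK_quot1_mult LK_quot2_mult)
  \<comment> \<open>These compensator moments are not estimated directly; they converge because all
    other terms of \<open>decomp\<close> do.\<close>
  define \<kappa> where "\<kappa> n = c n * (\<integral>\<xi>. chi (snd \<xi>) \<partial>N n)" for n
  have decomp: "of_real (c n) * (transform (N n) u - 1) = of_real (c n) * (\<integral>\<xi>. of_real (w1 \<xi>) * f u \<xi> \<partial>N n) +
      of_real (c n) * (\<integral>\<xi>. of_real (w2 \<xi>) * g u \<xi> \<partial>N n) + snd u * of_real (\<kappa> n)" if u: "u \<in> dom_U" for n u
  proof -
    interpret prob_space "N n" by (rule pN)
    have w_le: "norm (complex_of_real (w1 \<xi>)) \<le> 2" "norm (complex_of_real (w2 \<xi>)) \<le> 2" if "\<xi> \<in> state_D" for \<xi>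
      using w1(2,3)[OF that] w2(2,3)[OF that] weight_le_2[OF that] by auto
    have "norm (of_real (w1 \<xi>) * f u \<xi>) \<le> 2 * (2 + norm (fst u))" if "\<xi> \<in> state_D" for \<xi>
      unfolding norm_mult by (intro mult_mono w_le f_b u that) auto
    then have i1: "integrable (N n) (\<lambda>\<xi>. of_real (w1 \<xi>) * f u \<xi>)"
      by (intro int[of _ "2 * (2 + norm (fst u))"] continuous_intros w1 f_c)
    have "norm (of_real (w2 \<xi>) * g u \<xi>) \<le> 2 * (2 + norm (snd u) + (norm (snd u))\<^sup>2)" if "\<xi> \<in> state_D" for \<xi>
      unfolding norm_mult by (intro mult_mono w_le g_b u that) auto
    then have i2: "integrable (N n) (\<lambda>\<xi>. of_real (w2 \<xi>) * g u \<xi>)"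
      by (intro int[of _ "2 * (2 + norm (snd u) + (norm (snd u))\<^sup>2)"] continuous_intros w2 g_c u)
    have i3: "integrable (N n) (\<lambda>\<xi>. complex_of_real (chi (snd \<xi>)))"
      using abs_chi_le_1 by (intro int[of _ 1] continuous_intros) auto
    have ie: "integrable (N n) (\<lambda>\<xi>. exp (pairing u \<xi>))" by (rule integrable_exp_pairing[OF fN sN u])
    have "transform (N n) u - 1 = (\<integral>\<xi>. exp (pairing u \<xi>) - 1 \<partial>N n)"
      unfolding transform_def using ie prob_space by simp
    also have "\<dots> = (\<integral>\<xi>. of_real (w1 \<xi>) * f u \<xi> + of_real (w2 \<xi>) * g u \<xi> + snd u * of_real (chi (snd \<xi>)) \<partial>N n)"
      unfolding split[symmetric] by (simp add: LK_integrand_def)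
    also have "\<dots> = (\<integral>\<xi>. of_real (w1 \<xi>) * f u \<xi> \<partial>N n) + (\<integral>\<xi>. of_real (w2 \<xi>) * g u \<xi> \<partial>N n) + snd u * (\<integral>\<xi>. of_real (chi (snd \<xi>)) \<partial>N n)"
      using i1 i2 i3 by simp
    finally show ?thesis by (simp add: \<kappa>_def algebra_simps)
  qed
  have \<kappa>_lim: "(\<lambda>n. snd u * of_real (\<kappa> (r n))) \<longlonglongrightarrow> \<phi> u - (\<integral>\<xi>. f u \<xi> \<partial>A) - (\<integral>\<xi>. g u \<xi> \<partial>B)" if u: "u \<in> dom_U" for u
  proof -
    have "(\<lambda>n. of_real (c (r n)) * (transform (N (r n)) u - 1) - of_real (c (r n)) * (\<integral>\<xi>. of_real (w1 \<xi>) * f u \<xi> \<partial>N (r n))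
        - of_real (c (r n)) * (\<integral>\<xi>. of_real (w2 \<xi>) * g u \<xi> \<partial>N (r n))) \<longlonglongrightarrow> \<phi> u - (\<integral>\<xi>. f u \<xi> \<partial>A) - (\<integral>\<xi>. g u \<xi> \<partial>B)"
      using convA convB f_c g_c[OF u] bdd[OF u] LIMSEQ_subseq_LIMSEQ[OF lim[OF u] r]
      unfolding conv_def comp_def by (intro tendsto_diff) auto
    then show ?thesis by (simp add: decomp[OF u])
  qed
  obtain b2 where b2: "(\<lambda>n. \<kappa> (r n)) \<longlonglongrightarrow> b2"
  proof -
    have "(0, \<i>) \<in> dom_U" by (auto intro: dom_UI)
    from tendsto_Im[OF \<kappa>_lim[OF this]] show thesis by (intro that) simp
  qed
  have \<phi>_eq: "\<phi> u = (\<integral>\<xi>. f u \<xi> \<partial>A) + (\<integral>\<xi>. g u \<xi> \<partial>B) + snd u * of_real b2" if u: "u \<in> dom_U" for u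
  proof -
    have "(\<lambda>n. snd u * of_real (\<kappa> (r n))) \<longlonglongrightarrow> snd u * of_real b2" by (intro tendsto_intros b2)
    from LIMSEQ_unique[OF this \<kappa>_lim[OF u]] show ?thesis by (simp add: algebra_simps)
  qed
  \<comment> \<open>Testing the convergence to \<open>V\<close> with \<open>weight\<close> times an
    exponential, and that to \<open>G\<close> with \<open>w\<close> times the same exponential,
    produces one and the same sequence. Hence \<open>V\<close> weighted by \<open>weight\<close> and
    \<open>G\<close> weighted by \<open>w\<close> have equal transforms.\<close>
  have dens: "density V (\<lambda>\<xi>. ennreal (weight \<xi>)) = density G (\<lambda>\<xi>. ennreal (w \<xi>))"
    if w: "continuous_on state_D w" "\<And>\<xi>. \<xi> \<in> state_D \<Longrightarrow> 0 \<le> w \<xi>" "\<And>\<xi>. \<xi> \<in> state_D \<Longrightarrow> w \<xi> \<le> weight \<xi>"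
      and V: "finite_measure V" "sets V = sets borel_D" "conv r w V" for w V
  proof (rule finite_measure_D_eqI)
    have w2: "w \<xi> \<le> 2" if "\<xi> \<in> state_D" for \<xi> using w(3)[OF that] weight_le_2[OF that] by simp
    have m: "weight \<in> borel_measurable V" "w \<in> borel_measurable G"
      by (rule continuous_on_D_measurable[OF V(2) continuous_on_weight] continuous_on_D_measurable[OF G(2) w(1)])+
    show "finite_measure (density V (\<lambda>\<xi>. ennreal (weight \<xi>)))"
      using m weight_le_2 by (intro finite_measure_density_le[OF V(1), where B=2]) (auto simp: space_of_sets_borel_D[OF V(2)] simp del: ennreal_numeral intro!: ennreal_leI)
    show "finite_measure (density G (\<lambda>\<xi>. ennreal (w \<xi>)))"
      using m w2 by (intro finite_measure_density_le[OF G(1), where B=2]) (auto simp: space_of_sets_borel_D[OF G(2)] simp del: ennreal_numeral intro!: ennreal_leI)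
    fix u assume u: "u \<in> dom_U"
    have e_bd: "bounded ((\<lambda>\<xi>. of_real (h \<xi>) * exp (pairing u \<xi>)) ` state_D)" if "\<And>\<xi>. \<xi> \<in> state_D \<Longrightarrow> \<bar>h \<xi>\<bar> \<le> 2" for h :: "real \<times> real \<Rightarrow> real"
    proof (rule boundedI)
      fix y assume "y \<in> (\<lambda>\<xi>. of_real (h \<xi>) * exp (pairing u \<xi>)) ` state_D"
      then obtain \<xi> where \<xi>: "\<xi> \<in> state_D" "y = of_real (h \<xi>) * exp (pairing u \<xi>)" by blast
      have "norm y \<le> 2 * 1"
        unfolding \<xi>(2) norm_mult using that[OF \<xi>(1)] norm_exp_pairing_le[OF u \<xi>(1)] by (intro mult_mono) auto
      then show "norm y \<le> 2" by simp
    qed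
    have "(\<lambda>n. of_real (c (r n)) * (\<integral>\<xi>. of_real (w \<xi>) * (of_real (weight \<xi>) * exp (pairing u \<xi>)) \<partial>N (r n))) \<longlonglongrightarrow> (\<integral>\<xi>. of_real (weight \<xi>) * exp (pairing u \<xi>) \<partial>V)"
      using V(3) weight_nonneg weight_le_2 unfolding conv_def
      by (elim allE impE) (auto intro!: continuous_intros continuous_on_weight e_bd)
    moreover have "(\<lambda>n. of_real (c (r n)) * (\<integral>\<xi>. of_real (weight \<xi>) * (of_real (w \<xi>) * exp (pairing u \<xi>)) \<partial>N (r n))) \<longlonglongrightarrow> (\<integral>\<xi>. of_real (w \<xi>) * exp (pairing u \<xi>) \<partial>G)"
      using convG w2 w(2) unfolding conv_def
      by (elim allE impE) (auto intro!: continuous_intros w e_bd)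
    ultimately have "(\<integral>\<xi>. of_real (weight \<xi>) * exp (pairing u \<xi>) \<partial>V) = (\<integral>\<xi>. of_real (w \<xi>) * exp (pairing u \<xi>) \<partial>G)"
      by (simp only: mult.left_commute) (rule LIMSEQ_unique)
    moreover have "transform (density V (\<lambda>\<xi>. ennreal (weight \<xi>))) u = (\<integral>\<xi>. of_real (weight \<xi>) * exp (pairing u \<xi>) \<partial>V)"
      unfolding transform_def using m(1) weight_nonneg borel_measurable_on_D[OF V(2) exp_pairing_measurable]
      by (subst integral_density) (auto simp: space_of_sets_borel_D[OF V(2)] scaleR_conv_of_real)
    moreover have "transform (density G (\<lambda>\<xi>. ennreal (w \<xi>))) u = (\<integral>\<xi>. of_real (w \<xi>) * exp (pairing u \<xi>) \<partial>G)"
      unfolding transform_def using m(2) w(2) borel_measurable_on_D[OF G(2) exp_pairing_measurable]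
      by (subst integral_density) (auto simp: space_of_sets_borel_D[OF G(2)] scaleR_conv_of_real)
    ultimately show "transform (density V (\<lambda>\<xi>. ennreal (weight \<xi>))) u = transform (density G (\<lambda>\<xi>. ennreal (w \<xi>))) u" by simp
  qed (use V G in auto)
  \<comment> \<open>The value 0 at the origin leaves \<open>m\<close> without mass there.\<close>
  define iw where "iw \<xi> = (if \<xi> = 0 then 0 else inverse (weight \<xi>))" for \<xi>
  define m where "m = density G (\<lambda>\<xi>. ennreal (iw \<xi>))"
  have iw_nn: "0 \<le> iw \<xi>" if "\<xi> \<in> state_D" for \<xi> using weight_nonneg[OF that] by (simp add: iw_def)
  have iw_meas: "iw \<in> borel_measurable V" if "sets V = sets borel_D" for V
  proof -
    have [measurable]: "weight \<in> borel_measurable borel" by (rule borel_measurable_continuous_onI[OF continuous_on_weight])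
    have "iw \<in> borel_measurable borel" unfolding iw_def by measurable
    then show ?thesis by (rule borel_measurable_on_D[OF that])
  qed
  have weight_iw: "weight \<xi> * iw \<xi> = indicator (-{0}) \<xi>" if "\<xi> \<in> state_D" for \<xi>
    using weight_eq_0_iff[OF that] by (auto simp: iw_def)
  have spG: "space G = state_D" by (rule space_of_sets_borel_D[OF G(2)])
  have m_sets: "sets m = sets borel_D" by (simp add: m_def G)
  \<comment> \<open>Off the origin \<open>V\<close> is \<open>w / weight\<close> times
    \<open>G\<close>, that is, \<open>w\<close> times \<open>m\<close>; only the atom of
    \<open>V\<close> at the origin has to be split off.\<close>
  have m_int: "integrable m (\<lambda>\<xi>. of_real (w \<xi>) * h \<xi>) \<and> (\<integral>\<xi>. h \<xi> \<partial>V) = h 0 * of_real (measure V {0}) + (\<integral>\<xi>. of_real (w \<xi>) * h \<xi> \<partial>m)"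
    if w: "continuous_on state_D w" "\<And>\<xi>. \<xi> \<in> state_D \<Longrightarrow> 0 \<le> w \<xi>" "\<And>\<xi>. \<xi> \<in> state_D \<Longrightarrow> w \<xi> \<le> weight \<xi>"
      and V: "finite_measure V" "sets V = sets borel_D" "conv r w V"
      and h: "continuous_on state_D h" "\<And>\<xi>. \<xi> \<in> state_D \<Longrightarrow> norm (h \<xi>) \<le> K" for w V K and h :: "real \<times> real \<Rightarrow> complex"
  proof
    interpret V: finite_measure V by (rule V)
    have spV: "space V = state_D" by (rule space_of_sets_borel_D[OF V(2)])
    have hV: "h \<in> borel_measurable V" by (rule continuous_on_D_measurable[OF V(2) h(1)])
    have hG: "h \<in> borel_measurable G" and wG: "w \<in> borel_measurable G"
      by (rule continuous_on_D_measurable[OF G(2)], fact)+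
    have wV: "weight \<in> borel_measurable V" by (rule continuous_on_D_measurable[OF V(2) continuous_on_weight])
    have K: "0 \<le> K" using h(2)[OF zero_in_state_D(1)] norm_ge_zero order_trans by blast
    have "integrable G (\<lambda>\<xi>. iw \<xi> *\<^sub>R (of_real (w \<xi>) * h \<xi>))"
    proof (rule integrable_bounded_on_D[OF G, where B=K])
      show "(\<lambda>\<xi>. iw \<xi> *\<^sub>R (of_real (w \<xi>) * h \<xi>)) \<in> borel_measurable G"
        using iw_meas[OF G(2)] wG hG by measurable
      fix \<xi> assume \<xi>: "\<xi> \<in> state_D"
      have "iw \<xi> * w \<xi> \<le> iw \<xi> * weight \<xi>" using iw_nn[OF \<xi>] w(3)[OF \<xi>] by (intro mult_left_mono)
      also have "\<dots> \<le> 1" using weight_iw[OF \<xi>] by (simp add: mult.commute split: split_indicator)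
      finally have "(iw \<xi> * w \<xi>) * norm (h \<xi>) \<le> 1 * K" using h(2)[OF \<xi>] by (intro mult_mono) auto
      then show "norm (iw \<xi> *\<^sub>R (of_real (w \<xi>) * h \<xi>)) \<le> K" using iw_nn[OF \<xi>] w(2)[OF \<xi>] by (simp add: norm_mult mult.assoc)
    qed
    then show "integrable m (\<lambda>\<xi>. of_real (w \<xi>) * h \<xi>)"
      unfolding m_def using iw_meas[OF G(2)] iw_nn wG hG by (subst integrable_density) (auto simp: spG)
    have z: "{0} \<in> sets V" using zero_sets_borel_D V(2) by simp
    have hint: "integrable V h" by (rule integrable_bounded_on_D[OF V(1,2) hV h(2)])
    have "(\<integral>\<xi>. h \<xi> \<partial>V) = (\<integral>\<xi>. indicator {0} \<xi> *\<^sub>R h 0 + indicator (-{0}) \<xi> *\<^sub>R h \<xi> \<partial>V)"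
      by (intro Bochner_Integration.integral_cong) (auto split: split_indicator)
    also have "\<dots> = measure V {0} *\<^sub>R h 0 + (\<integral>\<xi>. indicator (-{0}) \<xi> *\<^sub>R h \<xi> \<partial>V)"
    proof -
      have "integrable V (\<lambda>\<xi>. indicator (space V - {0}) \<xi> *\<^sub>R h \<xi>)"
        using hint z by (intro integrable_mult_indicator) auto
      then have "integrable V (\<lambda>\<xi>. indicator (-{0}) \<xi> *\<^sub>R h \<xi>)"
        by (rule Bochner_Integration.integrable_cong[THEN iffD1, rotated -1]) (auto split: split_indicator)
      moreover have "integrable V (\<lambda>\<xi>. indicator {0} \<xi> *\<^sub>R h 0)" using z by (simp add: less_top[symmetric])
      moreover have "(\<integral>\<xi>. indicat_real {0} \<xi> *\<^sub>R h 0 \<partial>V) = measure V {0} *\<^sub>R h 0"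
        by (subst integral_scaleR_left) (use z in \<open>auto simp: less_top[symmetric]\<close>)
      ultimately show ?thesis by simp
    qed
    also have "(\<integral>\<xi>. indicator (-{0}) \<xi> *\<^sub>R h \<xi> \<partial>V) = (\<integral>\<xi>. weight \<xi> *\<^sub>R (iw \<xi> *\<^sub>R h \<xi>) \<partial>V)"
      by (intro Bochner_Integration.integral_cong) (auto simp: spV weight_iw[symmetric])
    also have "\<dots> = (\<integral>\<xi>. iw \<xi> *\<^sub>R h \<xi> \<partial>density V (\<lambda>\<xi>. ennreal (weight \<xi>)))"
      using iw_meas[OF V(2)] hV wV weight_nonneg by (intro integral_density[symmetric]) (auto simp: spV)
    also have "\<dots> = (\<integral>\<xi>. iw \<xi> *\<^sub>R h \<xi> \<partial>density G (\<lambda>\<xi>. ennreal (w \<xi>)))"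
      by (simp only: dens[OF w V])
    also have "\<dots> = (\<integral>\<xi>. w \<xi> *\<^sub>R (iw \<xi> *\<^sub>R h \<xi>) \<partial>G)"
      using iw_meas[OF G(2)] hG wG w(2) by (intro integral_density) (auto simp: spG)
    also have "\<dots> = (\<integral>\<xi>. iw \<xi> *\<^sub>R (of_real (w \<xi>) * h \<xi>) \<partial>G)"
      by (simp add: scaleR_conv_of_real mult.left_commute)
    also have "\<dots> = (\<integral>\<xi>. of_real (w \<xi>) * h \<xi> \<partial>m)"
      unfolding m_def using iw_meas[OF G(2)] iw_nn wG hG by (intro integral_density[symmetric]) (auto simp: spG)
    finally show "(\<integral>\<xi>. h \<xi> \<partial>V) = h 0 * of_real (measure V {0}) + (\<integral>\<xi>. of_real (w \<xi>) * h \<xi> \<partial>m)"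
      by (simp add: scaleR_conv_of_real mult.commute)
  qed
  show thesis
  proof (rule that)
    \<comment> \<open>At the origin \<open>f u\<close> is \<open>fst u\<close> and
      \<open>g u\<close> is \<open>(snd u)\<^sup>2 / 2\<close>, whence the coefficients given by the
      atoms of \<open>A\<close> and \<open>B\<close>.\<close>
    show "LK_triple (measure A {0}) b2 (measure B {0} / 2) m"
      unfolding LK_triple_def
    proof (intro conjI)
      show "sigma_finite_measure m"
        unfolding m_def using iw_meas[OF G(2)] finite_measure.axioms(1)[OF G(1)]
        by (subst sigma_finite_measure.sigma_finite_iff_density_finite) auto
      have "emeasure m {0} = (\<integral>\<^sup>+\<xi>. ennreal (iw \<xi>) * indicator {0} \<xi> \<partial>G)"
        unfolding m_def using iw_meas[OF G(2)] zero_sets_borel_D G(2) by (intro emeasure_density) auto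
      also have "\<dots> = (\<integral>\<^sup>+\<xi>. 0 \<partial>G)"
        by (intro nn_integral_cong) (auto simp: iw_def split: split_indicator)
      finally show "emeasure m {0} = 0" by simp
      interpret G: finite_measure G by (rule G)
      have "(\<integral>\<^sup>+\<xi>. ennreal (weight \<xi>) \<partial>m) = (\<integral>\<^sup>+\<xi>. ennreal (iw \<xi>) * ennreal (weight \<xi>) \<partial>G)"
        unfolding m_def using iw_meas[OF G(2)] continuous_on_D_measurable[OF G(2) continuous_on_weight]
        by (intro nn_integral_density) auto
      also have "\<dots> \<le> (\<integral>\<^sup>+\<xi>. 1 \<partial>G)"
        using iw_nn weight_nonneg weight_iw
        by (intro nn_integral_mono) (auto simp: spG ennreal_mult[symmetric] mult.commute split: split_indicator)
      also have "\<dots> < \<infinity>" by (simp add: less_top[symmetric])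
      finally show "(\<integral>\<^sup>+\<xi>. ennreal (chi (fst \<xi>) + (chi (snd \<xi>))\<^sup>2) \<partial>m) < \<infinity>" by (simp add: weight_def)
    qed (auto simp: m_sets state_D_def)
    fix u assume u: "u \<in> dom_U"
    have 1: "integrable m (\<lambda>\<xi>. of_real (w1 \<xi>) * f u \<xi>)" "(\<integral>\<xi>. f u \<xi> \<partial>A) = f u 0 * of_real (measure A {0}) + (\<integral>\<xi>. of_real (w1 \<xi>) * f u \<xi> \<partial>m)"
      using m_int[OF w1 A convA f_c f_b[OF u]] by auto
    have 2: "integrable m (\<lambda>\<xi>. of_real (w2 \<xi>) * g u \<xi>)" "(\<integral>\<xi>. g u \<xi> \<partial>B) = g u 0 * of_real (measure B {0}) + (\<integral>\<xi>. of_real (w2 \<xi>) * g u \<xi> \<partial>m)"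
      using m_int[OF w2 B convB g_c[OF u] g_b[OF u]] by auto
    have "(\<integral>\<xi>. LK_integrand u \<xi> \<partial>m) = (\<integral>\<xi>. of_real (w1 \<xi>) * f u \<xi> \<partial>m) + (\<integral>\<xi>. of_real (w2 \<xi>) * g u \<xi> \<partial>m)"
      unfolding split using 1 2 by simp
    moreover have "f u 0 = fst u" "g u 0 = (snd u)\<^sup>2 / 2" by (simp_all add: f_def g_def LK_quot1_def LK_quot2_def)
    ultimately show "\<phi> u = LK_exponent (measure A {0}) b2 (measure B {0} / 2) m u"
      unfolding \<phi>_eq[OF u] 1(2) 2(2) LK_exponent_def LK_integrand_def[symmetric] by (simp add: algebra_simps)
  qed
qed

section \<open>Uniqueness of the Levy-Khintchine representation\<close>

definition levy_measure :: "(real \<times> real) measure \<Rightarrow> bool" where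
  "levy_measure m \<longleftrightarrow> sets m = sets borel_D \<and> emeasure m {0} = 0 \<and> (\<integral>\<^sup>+\<xi>. ennreal (weight \<xi>) \<partial>m) < \<infinity>"

lemma levy_measureD:
  assumes "levy_measure m"
  shows "sets m = sets borel_D" "space m = state_D" "emeasure m {0} = 0" "integrable m weight"
proof -
  show *: "sets m = sets borel_D" "emeasure m {0} = 0" using assms by (auto simp: levy_measure_def)
  show sp: "space m = state_D" by (rule space_of_sets_borel_D[OF *(1)])
  have "(\<integral>\<^sup>+\<xi>. ennreal (norm (weight \<xi>)) \<partial>m) = (\<integral>\<^sup>+\<xi>. ennreal (weight \<xi>) \<partial>m)"
    using weight_nonneg by (intro nn_integral_cong) (simp add: sp)
  then show "integrable m weight"
    using assms continuous_on_D_measurable[OF *(1) continuous_on_weight]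
    by (simp add: integrable_iff_bounded levy_measure_def)
qed

lemma LK_triple_levy: "LK_triple b1 b2 a m \<Longrightarrow> levy_measure m"
  by (simp add: LK_triple_def levy_measure_def weight_def)

lemma levy_integrable:
  fixes f :: "real \<times> real \<Rightarrow> 'b::{banach, second_countable_topology}"
  assumes m: "levy_measure m" and f: "f \<in> borel_measurable m" and le: "\<And>\<xi>. \<xi> \<in> state_D \<Longrightarrow> norm (f \<xi>) \<le> K * weight \<xi>"
  shows "integrable m f"
proof (rule Bochner_Integration.integrable_bound)
  show "integrable m (\<lambda>\<xi>. K * weight \<xi>)" using levy_measureD(4)[OF m] by simp
  show "AE \<xi> in m. norm (f \<xi>) \<le> norm (K * weight \<xi>)"
    using le levy_measureD(2)[OF m] by (intro AE_I2) (fastforce intro: order_trans)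
qed (rule f)

lemma continuous_on_LK_integrand: "continuous_on state_D (LK_integrand u)"
  unfolding LK_integrand_def by (intro continuous_intros)

lemma LK_integrand_0 [simp]: "LK_integrand u 0 = 0"
  by (simp add: LK_integrand_def)

lemma integrable_LK_integrand:
  assumes "levy_measure m" "u \<in> dom_U"
  shows "integrable m (LK_integrand u)"
  using levy_measureD(1)[OF assms(1)] norm_LK_integrand_le[OF assms(2)]
  by (intro levy_integrable[OF assms(1)] continuous_on_D_measurable continuous_on_LK_integrand)

lemma LK_exponent_alt:
  "LK_exponent b1 b2 a m u = of_real b1 * fst u + of_real b2 * snd u + of_real a * (snd u)\<^sup>2 + (\<integral>\<xi>. LK_integrand u \<xi> \<partial>m)"
  by (simp add: LK_exponent_def LK_integrand_def)

lemma LK_exponent_0 [simp]: "LK_exponent b1 b2 a m 0 = 0"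
  by (simp add: LK_exponent_def)

text \<open>\<open>LK_const\<close> is bounded along a convergent sequence of arguments, so a fixed
  multiple of \<open>weight\<close> dominates the integrands.\<close>

lemma continuous_on_LK_exponent:
  assumes m: "levy_measure m"
  shows "continuous_on dom_U (LK_exponent b1 b2 a m)"
  unfolding continuous_on_sequentially comp_def
proof (intro allI ballI impI)
  fix x v assume v: "v \<in> dom_U" and "(\<forall>n. x n \<in> dom_U) \<and> x \<longlonglongrightarrow> v"
  then have x: "\<And>n. x n \<in> dom_U" "x \<longlonglongrightarrow> v" by auto
  have "(\<lambda>n. LK_const (x n)) \<longlonglongrightarrow> LK_const v" unfolding LK_const_def by (intro tendsto_intros x)
  then have "Bseq (\<lambda>n. LK_const (x n))" by (intro convergent_imp_Bseq convergentI)
  then obtain K where K: "\<And>n. norm (LK_const (x n)) \<le> K" unfolding Bseq_def by auto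
  have "(\<lambda>n. \<integral>\<xi>. LK_integrand (x n) \<xi> \<partial>m) \<longlonglongrightarrow> (\<integral>\<xi>. LK_integrand v \<xi> \<partial>m)"
  proof (rule integral_dominated_convergence[where w="\<lambda>\<xi>. K * weight \<xi>"])
    show "integrable m (\<lambda>\<xi>. K * weight \<xi>)" using levy_measureD(4)[OF m] by simp
    show "AE \<xi> in m. (\<lambda>n. LK_integrand (x n) \<xi>) \<longlonglongrightarrow> LK_integrand v \<xi>"
      unfolding LK_integrand_def by (intro AE_I2 tendsto_intros x)
    show "AE \<xi> in m. norm (LK_integrand (x n) \<xi>) \<le> K * weight \<xi>" for n
    proof (rule AE_I2)
      fix \<xi> assume "\<xi> \<in> space m"
      then have \<xi>: "\<xi> \<in> state_D" by (simp add: levy_measureD(2)[OF m])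
      have "norm (LK_integrand (x n) \<xi>) \<le> LK_const (x n) * weight \<xi>" by (rule norm_LK_integrand_le[OF x(1) \<xi>])
      also have "\<dots> \<le> K * weight \<xi>" using K[of n] weight_nonneg[OF \<xi>] by (intro mult_right_mono) auto
      finally show "norm (LK_integrand (x n) \<xi>) \<le> K * weight \<xi>" .
    qed
  qed (rule continuous_on_D_measurable[OF levy_measureD(1)[OF m] continuous_on_LK_integrand])+
  then show "(\<lambda>n. LK_exponent b1 b2 a m (x n)) \<longlonglongrightarrow> LK_exponent b1 b2 a m v"
    unfolding LK_exponent_alt by (intro tendsto_intros x)
qed

text \<open>The hypothesis equates the transforms of two finite measures, each with density
  \<open>h\<close> plus an atom \<open>k\<close> or \<open>k'\<close> at the origin. As
  \<open>h\<close> vanishes there, the atoms agree, and division by \<open>h\<close> recovers the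
  Levy measures where \<open>h\<close> is positive.\<close>

lemma weighted_levy_eq:
  fixes h :: "real \<times> real \<Rightarrow> real"
  assumes m: "levy_measure m" and m': "levy_measure m'" and k: "0 \<le> k" "0 \<le> k'"
    and h: "continuous_on state_D h" "\<And>\<xi>. \<xi> \<in> state_D \<Longrightarrow> 0 \<le> h \<xi>" "\<And>\<xi>. \<xi> \<in> state_D \<Longrightarrow> h \<xi> \<le> K * weight \<xi>"
    and eq: "\<And>u. u \<in> dom_U \<Longrightarrow> of_real k + (\<integral>\<xi>. exp (pairing u \<xi>) * of_real (h \<xi>) \<partial>m) =
                                of_real k' + (\<integral>\<xi>. exp (pairing u \<xi>) * of_real (h \<xi>) \<partial>m')"
  shows "k = k'" and "\<And>B. B \<in> sets borel_D \<Longrightarrow> (\<And>\<xi>. \<xi> \<in> B \<Longrightarrow> 0 < h \<xi>) \<Longrightarrow> emeasure m B = emeasure m' B"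
proof -
  define P where "P l = density l (\<lambda>\<xi>. ennreal (h \<xi>))" for l :: "(real \<times> real) measure"
  define R where "R c = density (return borel_D (0 :: real \<times> real)) (\<lambda>_. ennreal c)" for c
  define F where "F l c = add_measure (P l) (R c)" for l c
  have hm: "h \<in> borel_measurable l" if "levy_measure l" for l
    by (rule continuous_on_D_measurable[OF levy_measureD(1)[OF that] h(1)])
  have h0: "h 0 = 0" using h(2,3)[OF zero_in_state_D(1)] by simp
  have sP: "sets (P l) = sets borel_D" if "levy_measure l" for l using levy_measureD(1)[OF that] by (simp add: P_def)
  have sR: "sets (R c) = sets borel_D" for c by (simp add: R_def)
  have fR: "finite_measure (R c)" for c
    unfolding R_def using prob_space.finite_measure[OF prob_space_return, of 0 borel_D] zero_in_state_D
    by (intro finite_measure_density_le[where B=c]) (auto simp: space_restrict_space)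
  have ih: "integrable l h" if "levy_measure l" for l
    using h(2,3) by (intro levy_integrable[OF that hm[OF that], of K]) auto
  have fP: "finite_measure (P l)" if "levy_measure l" for l
  proof (rule finite_measureI)
    have "emeasure (P l) (space l) = (\<integral>\<^sup>+\<xi>. ennreal (h \<xi>) \<partial>l)"
      unfolding P_def using hm[OF that] by (simp add: emeasure_density cong: nn_integral_cong)
    also have "\<dots> < \<infinity>"
      using ih[OF that] h(2) by (simp add: real_integrable_def less_top[symmetric])
    finally show "emeasure (P l) (space (P l)) \<noteq> \<infinity>" by (simp add: P_def)
  qed
  have trF: "transform (F l c) u = of_real c + (\<integral>\<xi>. exp (pairing u \<xi>) * of_real (h \<xi>) \<partial>l)"
    if l: "levy_measure l" and c: "0 \<le> c" and u: "u \<in> dom_U" for l c u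
  proof -
    have "transform (F l c) u = (\<integral>\<xi>. exp (pairing u \<xi>) \<partial>P l) + (\<integral>\<xi>. exp (pairing u \<xi>) \<partial>R c)"
      unfolding transform_def F_def using sP[OF l] sR
      by (intro integral_add_measure integrable_exp_pairing fP l fR u) auto
    moreover have "(\<integral>\<xi>. exp (pairing u \<xi>) \<partial>P l) = (\<integral>\<xi>. exp (pairing u \<xi>) * of_real (h \<xi>) \<partial>l)"
      unfolding P_def using hm[OF l] h(2) levy_measureD(2)[OF l] borel_measurable_on_D[OF levy_measureD(1)[OF l] exp_pairing_measurable]
      by (subst integral_density) (auto simp: scaleR_conv_of_real mult.commute)
    moreover have "(\<integral>\<xi>. exp (pairing u \<xi>) \<partial>R c) = of_real c"
    proof -
      have e: "(\<lambda>\<xi>. exp (pairing u \<xi>)) \<in> borel_measurable borel_D" by (rule borel_measurable_on_D[OF refl exp_pairing_measurable])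
      then have "(\<integral>\<xi>. exp (pairing u \<xi>) \<partial>R c) = (\<integral>\<xi>. c *\<^sub>R exp (pairing u \<xi>) \<partial>return borel_D 0)"
        unfolding R_def using c by (intro integral_density) auto
      also have "\<dots> = c *\<^sub>R transform (return borel_D 0) u" by (simp add: transform_def)
      finally show ?thesis by (simp add: transform_return zero_in_state_D scaleR_conv_of_real)
    qed
    ultimately show ?thesis by simp
  qed
  have "F m k = F m' k'"
  proof (rule finite_measure_D_eqI)
    show "finite_measure (F m k)" "finite_measure (F m' k')"
      unfolding F_def using sP[OF m] sP[OF m'] sR by (auto intro!: finite_measure_add_measure fP fR m m')
    show "sets (F m k) = sets borel_D" "sets (F m' k') = sets borel_D"
      using sP[OF m] sP[OF m'] by (simp_all add: F_def)
    fix u assume "u \<in> dom_U"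
    then show "transform (F m k) u = transform (F m' k') u" using eq k m m' by (simp add: trF)
  qed
  have eR: "emeasure (R c) B = ennreal c * indicator B 0" if "B \<in> sets borel_D" for c B
    unfolding R_def using that by (subst emeasure_density_const) auto
  have "emeasure (F l c) {0} = ennreal c" if l: "levy_measure l" for l c
  proof -
    have "emeasure (P l) {0} = (\<integral>\<^sup>+\<xi>. ennreal (h \<xi>) * indicator {0} \<xi> \<partial>l)"
      unfolding P_def using hm[OF l] zero_sets_borel_D levy_measureD(1)[OF l] by (intro emeasure_density) auto
    also have "\<dots> = (\<integral>\<^sup>+\<xi>. 0 \<partial>l)"
      by (intro nn_integral_cong) (auto simp: h0 split: split_indicator)
    finally have "emeasure (P l) {0} = 0" by simp
    then show ?thesis
      unfolding F_def using sP[OF l] sR zero_sets_borel_D by (subst emeasure_add_measure) (auto simp: eR)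
  qed
  with \<open>F m k = F m' k'\<close> m m' have "ennreal k = ennreal k'" by metis
  then show "k = k'" using k by simp
  fix B assume B: "B \<in> sets borel_D" and pos: "\<And>\<xi>. \<xi> \<in> B \<Longrightarrow> 0 < h \<xi>"
  have 0: "0 \<notin> B" using pos[of 0] h0 by auto
  have "(\<integral>\<^sup>+\<xi>. indicator B \<xi> * ennreal (1 / h \<xi>) \<partial>F l c) = emeasure l B" if l: "levy_measure l" for l c
  proof -
    note [measurable] = hm[OF l]
    have hD: "h \<in> borel_measurable borel_D" by (rule continuous_on_D_measurable[OF refl h(1)])
    have Bl: "B \<in> sets l" using B levy_measureD(1)[OF l] by simp
    have fm: "(\<lambda>\<xi>. indicator B \<xi> * ennreal (1 / h \<xi>)) \<in> borel_measurable borel_D"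
      using B hD by measurable
    have fP': "(\<lambda>\<xi>. indicator B \<xi> * ennreal (1 / h \<xi>)) \<in> borel_measurable (P l)"
      using fm sP[OF l] by (simp cong: measurable_cong_sets)
    have fl: "(\<lambda>\<xi>. indicator B \<xi> * ennreal (1 / h \<xi>)) \<in> borel_measurable l"
      using fm levy_measureD(1)[OF l] by (simp cong: measurable_cong_sets)
    have "(\<integral>\<^sup>+\<xi>. indicator B \<xi> * ennreal (1 / h \<xi>) \<partial>R c) = (\<integral>\<^sup>+\<xi>. ennreal c * (indicator B \<xi> * ennreal (1 / h \<xi>)) \<partial>return borel_D 0)"
      unfolding R_def using fm by (intro nn_integral_density) auto
    also have "\<dots> = 0" using 0 fm zero_in_state_D by (subst nn_integral_return) (auto simp: space_restrict_space)
    finally have R0: "(\<integral>\<^sup>+\<xi>. indicator B \<xi> * ennreal (1 / h \<xi>) \<partial>R c) = 0" .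
    have "(\<integral>\<^sup>+\<xi>. indicator B \<xi> * ennreal (1 / h \<xi>) \<partial>P l) = (\<integral>\<^sup>+\<xi>. ennreal (h \<xi>) * (indicator B \<xi> * ennreal (1 / h \<xi>)) \<partial>l)"
      unfolding P_def using fl by (intro nn_integral_density) auto
    also have "\<dots> = (\<integral>\<^sup>+\<xi>. indicator B \<xi> \<partial>l)"
      using pos by (intro nn_integral_cong) (auto simp: ennreal_mult'[symmetric] less_imp_le order_less_imp_not_eq2 split: split_indicator)
    also have "\<dots> = emeasure l B" using Bl by simp
    finally show ?thesis
      unfolding F_def using R0 fP' sP[OF l] sR by (subst nn_integral_add_measure) auto
  qed
  from this[OF m, of k] this[OF m', of k'] \<open>F m k = F m' k'\<close> show "emeasure m B = emeasure m' B" by simp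
qed

lemma one_minus_cos_le_chi_sq: "1 - cos (s * y) \<le> (2 + \<bar>s\<bar> + s\<^sup>2) * (chi y)\<^sup>2"
proof -
  have "1 - cos (s * y) \<le> \<bar>Re (exp (\<i> * of_real s * of_real y) - 1 - \<i> * of_real s * of_real (chi y))\<bar>"
    by (simp add: Re_exp)
  also have "\<dots> \<le> norm (exp (\<i> * of_real s * of_real y) - 1 - \<i> * of_real s * of_real (chi y))"
    by (rule abs_Re_le_cmod)
  also have "\<dots> \<le> (2 + norm (\<i> * complex_of_real s) + (norm (\<i> * complex_of_real s))\<^sup>2) * (chi y)\<^sup>2"
    by (rule norm_iexp_minus_le_chi_sq) simp
  finally show ?thesis by (simp add: norm_mult)
qed

text \<open>The imaginary part of \<open>norm_iexp_minus_le_chi_sq\<close>. It lets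
  \<open>sin\<close>, whose integral is part of a transform, replace the truncation.\<close>

lemma abs_sin_minus_chi_le: "\<bar>sin (s * y) - s * chi y\<bar> \<le> (2 + \<bar>s\<bar> + s\<^sup>2) * (chi y)\<^sup>2"
proof -
  have "\<bar>sin (s * y) - s * chi y\<bar> = \<bar>Im (exp (\<i> * of_real s * of_real y) - 1 - \<i> * of_real s * of_real (chi y))\<bar>"
    by (simp add: Im_exp)
  also have "\<dots> \<le> norm (exp (\<i> * of_real s * of_real y) - 1 - \<i> * of_real s * of_real (chi y))"
    by (rule abs_Im_le_cmod)
  also have "\<dots> \<le> (2 + norm (\<i> * complex_of_real s) + (norm (\<i> * complex_of_real s))\<^sup>2) * (chi y)\<^sup>2"
    by (rule norm_iexp_minus_le_chi_sq) simp
  finally show ?thesis by (simp add: norm_mult)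
qed

text \<open>The differences \<open>\<phi>(u) - \<phi>(u - (1, 0))\<close> and \<open>\<phi>(u) - (\<phi>(u + (0, is)) + \<phi>(u - (0, is))) / 2\<close> are transforms of
  finite measures with densities \<open>1 - e\<^sup>-\<^sup>x\<close> and \<open>1 - cos (s y)\<close>, up to atoms \<open>b1\<close> and \<open>a s\<^sup>2\<close> at the origin.\<close>

lemma LK_unique:
  assumes m: "levy_measure m" and m': "levy_measure m'"
    and nn: "0 \<le> b1" "0 \<le> b1'" "0 \<le> a" "0 \<le> a'"
    and eq: "\<And>u. u \<in> dom_U \<Longrightarrow> LK_exponent b1 b2 a m u = LK_exponent b1' b2' a' m' u"
  shows "b1 = b1'" "b2 = b2'" "a = a'" "\<And>B. B \<in> sets borel_D \<Longrightarrow> emeasure m B = emeasure m' B"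
proof -
  have D1: "LK_exponent c1 c2 d l u - LK_exponent c1 c2 d l (u + (-1, 0)) =
      of_real c1 + (\<integral>\<xi>. exp (pairing u \<xi>) * of_real (1 - exp (- fst \<xi>)) \<partial>l)"
    if l: "levy_measure l" and u: "u \<in> dom_U" for c1 c2 d l u
  proof -
    have U: "u + (-1, 0) \<in> dom_U" using u by (auto simp: dom_U_def)
    have "(\<integral>\<xi>. LK_integrand u \<xi> \<partial>l) - (\<integral>\<xi>. LK_integrand (u + (-1, 0)) \<xi> \<partial>l) = (\<integral>\<xi>. LK_integrand u \<xi> - LK_integrand (u + (-1, 0)) \<xi> \<partial>l)"
      by (intro Bochner_Integration.integral_diff[symmetric] integrable_LK_integrand l u U)
    also have "\<dots> = (\<integral>\<xi>. exp (pairing u \<xi>) * of_real (1 - exp (- fst \<xi>)) \<partial>l)"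
    proof (intro Bochner_Integration.integral_cong refl)
      fix \<xi> :: "real \<times> real"
      have p: "pairing (u + (-1, 0)) \<xi> = pairing u \<xi> + - of_real (fst \<xi>)" by (simp add: pairing_def algebra_simps)
      have e: "complex_of_real (exp (- fst \<xi>)) = exp (- of_real (fst \<xi>))" by (simp add: exp_of_real[symmetric])
      show "LK_integrand u \<xi> - LK_integrand (u + (-1, 0)) \<xi> = exp (pairing u \<xi>) * of_real (1 - exp (- fst \<xi>))"
        unfolding LK_integrand_def p exp_add of_real_diff e by (simp add: algebra_simps)
    qed
    finally show ?thesis by (simp add: LK_exponent_alt algebra_simps)
  qed
  have D2: "LK_exponent c1 c2 d l u - (LK_exponent c1 c2 d l (u + (0, \<i> * of_real s)) + LK_exponent c1 c2 d l (u + (0, - (\<i> * of_real s)))) / 2 =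
      of_real (d * s\<^sup>2) + (\<integral>\<xi>. exp (pairing u \<xi>) * of_real (1 - cos (s * snd \<xi>)) \<partial>l)"
    if l: "levy_measure l" and u: "u \<in> dom_U" for c1 c2 d l u s
  proof -
    have U: "u + (0, \<i> * of_real s) \<in> dom_U" "u + (0, - (\<i> * of_real s)) \<in> dom_U" using u by (auto simp: dom_U_def)
    note i = integrable_LK_integrand[OF l u] integrable_LK_integrand[OF l U(1)] integrable_LK_integrand[OF l U(2)]
    have "(\<integral>\<xi>. LK_integrand u \<xi> \<partial>l) - ((\<integral>\<xi>. LK_integrand (u + (0, \<i> * of_real s)) \<xi> \<partial>l) + (\<integral>\<xi>. LK_integrand (u + (0, - (\<i> * of_real s))) \<xi> \<partial>l)) / 2 =
        (\<integral>\<xi>. LK_integrand u \<xi> - (LK_integrand (u + (0, \<i> * of_real s)) \<xi> + LK_integrand (u + (0, - (\<i> * of_real s))) \<xi>) / 2 \<partial>l)"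
      using i by simp
    also have "\<dots> = (\<integral>\<xi>. exp (pairing u \<xi>) * of_real (1 - cos (s * snd \<xi>)) \<partial>l)"
    proof (intro Bochner_Integration.integral_cong refl)
      fix \<xi> :: "real \<times> real"
      have p: "pairing (u + (0, w)) \<xi> = pairing u \<xi> + w * of_real (snd \<xi>)" for w by (simp add: pairing_def algebra_simps)
      have c: "complex_of_real (cos (s * snd \<xi>)) = (exp (\<i> * of_real (s * snd \<xi>)) + exp (- (\<i> * of_real (s * snd \<xi>)))) / 2"
        by (simp only: cos_of_real[symmetric] cos_exp_eq)
      show "LK_integrand u \<xi> - (LK_integrand (u + (0, \<i> * of_real s)) \<xi> + LK_integrand (u + (0, - (\<i> * of_real s))) \<xi>) / 2 =
          exp (pairing u \<xi>) * of_real (1 - cos (s * snd \<xi>))"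
        unfolding LK_integrand_def p exp_add of_real_diff c by (simp add: algebra_simps add_divide_distrib diff_divide_distrib)
    qed
    finally show ?thesis
      by (simp add: LK_exponent_alt power2_eq_square field_simps)
  qed
  have h1: "1 - exp (- fst \<xi>) \<le> 1 * weight \<xi>" "0 \<le> 1 - exp (- fst \<xi>)" if \<xi>: "\<xi> \<in> state_D" for \<xi>
  proof -
    have x: "0 \<le> fst \<xi>" using \<xi> by (auto simp: state_D_def)
    then have "1 - exp (- fst \<xi>) \<le> chi (fst \<xi>)"
      using exp_ge_add_one_self[of "- fst \<xi>"] by (simp add: chi_nonneg_eq)
    then show "1 - exp (- fst \<xi>) \<le> 1 * weight \<xi>" using chi_fst_le_weight[OF \<xi>] by simp
    show "0 \<le> 1 - exp (- fst \<xi>)" using x by simp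
  qed
  note E1 = weighted_levy_eq[OF m m' nn(1,2), of "\<lambda>\<xi>. 1 - exp (- fst \<xi>)" 1]
  have e1: "of_real b1 + (\<integral>\<xi>. exp (pairing u \<xi>) * of_real (1 - exp (- fst \<xi>)) \<partial>m) =
      of_real b1' + (\<integral>\<xi>. exp (pairing u \<xi>) * of_real (1 - exp (- fst \<xi>)) \<partial>m')" if u: "u \<in> dom_U" for u
  proof -
    have "u + (-1, 0) \<in> dom_U" using u by (auto simp: dom_U_def)
    then show ?thesis using D1[OF m u, of b1 b2 a] D1[OF m' u, of b1' b2' a'] eq u by simp
  qed
  show "b1 = b1'" by (rule E1(1)) (use h1 e1 in \<open>auto intro!: continuous_intros\<close>)
  have pos1: "emeasure m B = emeasure m' B" if "B \<in> sets borel_D" "\<And>\<xi>. \<xi> \<in> B \<Longrightarrow> 0 < fst \<xi>" for B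
    by (rule E1(2)) (use h1 e1 that in \<open>auto intro!: continuous_intros\<close>)
  have h2: "1 - cos (s * snd \<xi>) \<le> (2 + \<bar>s\<bar> + s\<^sup>2) * weight \<xi>" if \<xi>: "\<xi> \<in> state_D" for \<xi> s
    using one_minus_cos_le_chi_sq[of s "snd \<xi>"] chi_snd_le_weight[OF \<xi>]
    by (elim order_trans) (intro mult_left_mono, auto)
  have e2: "of_real (a * s\<^sup>2) + (\<integral>\<xi>. exp (pairing u \<xi>) * of_real (1 - cos (s * snd \<xi>)) \<partial>m) =
      of_real (a' * s\<^sup>2) + (\<integral>\<xi>. exp (pairing u \<xi>) * of_real (1 - cos (s * snd \<xi>)) \<partial>m')" if u: "u \<in> dom_U" for u s
  proof -
    have "u + (0, \<i> * of_real s) \<in> dom_U" "u + (0, - (\<i> * of_real s)) \<in> dom_U" using u by (auto simp: dom_U_def)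
    then show ?thesis unfolding D2[OF m u, of b1 b2 a s, symmetric] D2[OF m' u, of b1' b2' a' s, symmetric] using eq u by simp
  qed
  have E2: "a * s\<^sup>2 = a' * s\<^sup>2" "\<And>B. B \<in> sets borel_D \<Longrightarrow> (\<And>\<xi>. \<xi> \<in> B \<Longrightarrow> 0 < 1 - cos (s * snd \<xi>)) \<Longrightarrow> emeasure m B = emeasure m' B" for s
    using nn by (rule_tac weighted_levy_eq[OF m m' _ _ _ _ h2 e2]; auto intro!: continuous_intros)+
  show "a = a'" using E2(1)[of 1] by simp
  have pos2: "emeasure m B = emeasure m' B" if B: "B \<in> sets borel_D" "\<And>\<xi>. \<xi> \<in> B \<Longrightarrow> snd \<xi> \<noteq> 0" for B
  proof -
    \<comment> \<open>On the strip \<open>\<bar>snd \<xi>\<bar> \<le> k + 1\<close> the frequency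
      \<open>s = 1 / (k + 1)\<close> keeps \<open>s * snd \<xi>\<close> in \<open>[-1, 1]\<close>,
      where \<open>1 - cos\<close> vanishes only at 0.\<close>
    define S where "S k = B \<inter> {\<xi>. \<bar>snd \<xi>\<bar> \<le> real (Suc k)}" for k
    have cl: "{\<xi> :: real \<times> real. \<bar>snd \<xi>\<bar> \<le> real (Suc k)} \<in> sets borel" for k
      by (intro borel_closed closed_Collect_le continuous_intros)
    have S: "S k \<in> sets borel_D" for k using B(1) cl[of k] by (auto simp: S_def sets_borel_D_iff)
    have inc: "incseq S" by (auto simp: incseq_def S_def)
    have U: "(\<Union>k. S k) = B"
    proof -
      have "\<exists>k. \<bar>snd \<xi>\<bar> \<le> real (Suc k)" for \<xi> :: "real \<times> real"
        using real_arch_simple[of "\<bar>snd \<xi>\<bar>"] by (metis le_Suc_eq of_nat_le_iff order_refl order_trans)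
      then show ?thesis by (auto simp: S_def)
    qed
    have "emeasure m (S k) = emeasure m' (S k)" for k
    proof (rule E2(2)[OF S])
      fix \<xi> assume \<xi>: "\<xi> \<in> S k"
      define z where "z = 1 / real (Suc k) * snd \<xi>"
      have "\<bar>z\<bar> \<le> 1" "z \<noteq> 0" using \<xi> B(2)[of \<xi>] by (auto simp: S_def z_def abs_mult field_simps)
      then have "cos \<bar>z\<bar> < cos 0" using pi_gt3 by (intro cos_monotone_0_pi) auto
      then have "0 < 1 - cos z" by simp
      then show "0 < 1 - cos (1 / real (Suc k) * snd \<xi>)" unfolding z_def .
    qed
    moreover have "emeasure l B = (SUP k. emeasure l (S k))" if "levy_measure l" for l
    proof -
      have "range S \<subseteq> sets l" using S levy_measureD(1)[OF that] by blast
      from SUP_emeasure_incseq[OF this inc] show ?thesis unfolding U ..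
    qed
    ultimately show ?thesis using m m' by simp
  qed
  \<comment> \<open>A point of \<open>state_D\<close> other than the origin with
    \<open>fst \<xi> = 0\<close> has \<open>snd \<xi> \<noteq> 0\<close>. So \<open>pos1\<close>,
    \<open>pos2\<close> and the null set \<open>{0}\<close> cover every Borel set.\<close>
  have all: "emeasure m B = emeasure m' B" if B: "B \<in> sets borel_D" for B
  proof -
    have "{\<xi> :: real \<times> real. 0 < fst \<xi>} \<in> sets borel" by (intro borel_open open_Collect_less continuous_intros)
    then have s1: "B \<inter> {\<xi>. 0 < fst \<xi>} \<in> sets borel_D" using B by (auto simp: sets_borel_D_iff)
    have s2: "B - {0} - {\<xi>. 0 < fst \<xi>} \<in> sets borel_D"
    proof -
      have "B - {0} - {\<xi>. 0 < fst \<xi>} = B - {0} - (B \<inter> {\<xi>. 0 < fst \<xi>})" by auto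
      then show ?thesis using B s1 zero_sets_borel_D by (simp add: sets.Diff)
    qed
    have s3: "B \<inter> {0} \<in> sets borel_D" using B zero_sets_borel_D by (rule sets.Int)
    have dec: "emeasure l B = emeasure l (B \<inter> {\<xi>. 0 < fst \<xi>}) + emeasure l (B - {0} - {\<xi>. 0 < fst \<xi>})" if l: "levy_measure l" for l
    proof -
      have sl: "sets l = sets borel_D" by (rule levy_measureD(1)[OF l])
      have z: "emeasure l (B \<inter> {0}) = 0"
        using levy_measureD(3)[OF l] emeasure_mono[of "B \<inter> {0}" "{0}" l] zero_sets_borel_D sl by (simp add: le_zero_eq)
      have B_eq: "B = ((B \<inter> {\<xi>. 0 < fst \<xi>}) \<union> (B - {0} - {\<xi>. 0 < fst \<xi>})) \<union> (B \<inter> {0})" by auto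
      have "emeasure l B = emeasure l ((B \<inter> {\<xi>. 0 < fst \<xi>}) \<union> (B - {0} - {\<xi>. 0 < fst \<xi>})) + emeasure l (B \<inter> {0})"
        by (subst B_eq, subst plus_emeasure) (use s1 s2 s3 sl in auto)
      also have "emeasure l ((B \<inter> {\<xi>. 0 < fst \<xi>}) \<union> (B - {0} - {\<xi>. 0 < fst \<xi>})) = emeasure l (B \<inter> {\<xi>. 0 < fst \<xi>}) + emeasure l (B - {0} - {\<xi>. 0 < fst \<xi>})"
        by (rule plus_emeasure[symmetric]) (use s1 s2 sl in auto)
      finally show ?thesis using z by simp
    qed
    have "B \<subseteq> state_D" using B by (simp add: sets_borel_D_iff)
    then have "snd \<xi> \<noteq> 0" if "\<xi> \<in> B - {0} - {\<xi>. 0 < fst \<xi>}" for \<xi>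
      using that by (force simp: state_D_def prod_eq_iff)
    then show ?thesis unfolding dec[OF m] dec[OF m'] using pos1[OF s1] pos2[OF s2] by simp
  qed
  then show "\<And>B. B \<in> sets borel_D \<Longrightarrow> emeasure m B = emeasure m' B" .
  have "m = m'"
    using all levy_measureD(1)[OF m] levy_measureD(1)[OF m'] by (intro measure_eqI) auto
  moreover have "(0, \<i>) \<in> dom_U" by (auto intro: dom_UI)
  ultimately have "complex_of_real b2 * \<i> = of_real b2' * \<i>"
    using eq[of "(0, \<i>)"] \<open>a = a'\<close> by (simp add: LK_exponent_alt)
  then show "b2 = b2'" by simp
qed

section \<open>The exponents of a skew convolution semigroup\<close>

text \<open>The values of \<open>F\<close> are multiples of 2 pi i, hence isolated, so
  \<open>F\<close> is constant on a connected set. This turns multiplicative relations between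
  transforms into additive ones between exponents.\<close>

lemma eq_0_of_exp_eq_1:
  fixes F :: "'a::topological_space \<Rightarrow> complex"
  assumes S: "connected S" and F: "continuous_on S F" "\<And>x. x \<in> S \<Longrightarrow> exp (F x) = 1"
    and a: "a \<in> S" "F a = 0" and x: "x \<in> S"
  shows "F x = 0"
proof -
  have "F constant_on S"
  proof (rule continuous_discrete_range_constant[OF S F(1)])
    fix x assume x: "x \<in> S"
    show "\<exists>e>0. \<forall>y. y \<in> S \<and> F y \<noteq> F x \<longrightarrow> e \<le> norm (F y - F x)"
    proof (intro exI[of _ "2 * pi"] conjI allI impI)
      fix y assume y: "y \<in> S \<and> F y \<noteq> F x"
      have "\<not> \<bar>Im (F y) - Im (F x)\<bar> < 2 * pi"
        using exp_complex_eqI[of "F y" "F x"] F(2)[of y] F(2)[OF x] y by auto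
      then show "2 * pi \<le> norm (F y - F x)"
        using abs_Im_le_cmod[of "F y - F x"] by simp
    qed simp
  qed
  then show ?thesis using a x by (auto simp: constant_on_def)
qed

text \<open>The quotient of the root by \<open>exp (\<phi> u / n)\<close> is continuous with values
  among the \<open>n\<close>-th roots of unity, hence constant on \<open>dom_U\<close>, and it is 1
  at the origin.\<close>

lemma transform_root_eq_exp:
  assumes N: "N \<in> space (prob_algebra borel_D)" and n: "n \<ge> 1"
    and \<phi>: "continuous_on dom_U \<phi>" "\<phi> 0 = 0"
    and pow: "\<And>u. u \<in> dom_U \<Longrightarrow> transform N u ^ n = exp (\<phi> u)" and u: "u \<in> dom_U"
  shows "transform N u = exp (\<phi> u / of_nat n)"
proof -
  define g where "g u = transform N u * exp (- (\<phi> u / of_nat n))" for u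
  have n0: "of_nat n \<noteq> (0 :: complex)" using n by simp
  have "continuous_on dom_U (transform N)" using N by (intro continuous_on_transform) (auto dest: prob_algebra_D)
  then have g: "continuous_on dom_U g" unfolding g_def using n0 by (intro continuous_intros \<phi>) auto
  have "g u ^ n = 1" if "u \<in> dom_U" for u
  proof -
    have "exp (- (\<phi> u / of_nat n)) ^ n = exp (- \<phi> u)"
      using n0 by (simp add: exp_of_nat_mult[symmetric])
    then show ?thesis using pow[OF that] by (simp add: g_def power_mult_distrib exp_minus)
  qed
  then have "g ` dom_U \<subseteq> {z. z ^ n = 1}" by blast
  moreover have "finite {z :: complex. z ^ n = 1}" using n by (rule finite_roots_unity)
  ultimately have "finite (g ` dom_U)" by (rule finite_subset)
  then have "g constant_on dom_U" using g by (intro continuous_finite_range_constant connected_dom_U)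
  then have "g u = g 0" using u zero_in_dom_U(1) unfolding constant_on_def by metis
  also have "g 0 = 1" using transform_0[OF N] \<phi>(2) by (simp add: g_def)
  finally show ?thesis by (simp add: g_def exp_minus field_simps)
qed

lemma integral_density_indicator_neq:
  assumes "sets m = sets borel_D"
  shows "f \<in> borel_measurable m \<Longrightarrow> f 0 = 0 \<Longrightarrow>
    (\<integral>\<xi>. f \<xi> \<partial>density m (indicator (-{0}))) = (\<integral>\<xi>. f \<xi> \<partial>m :: complex)"
proof -
  assume f: "f \<in> borel_measurable m" "f 0 = 0"
  have "(\<lambda>\<xi>. indicator (-{0}) \<xi> :: real) \<in> borel_measurable m"
    by (rule borel_measurable_on_D[OF assms]) (auto intro!: borel_measurable_indicator)
  then have "(\<integral>\<xi>. f \<xi> \<partial>density m (\<lambda>\<xi>. ennreal (indicator (-{0}) \<xi>))) = (\<integral>\<xi>. indicator (-{0}) \<xi> *\<^sub>R f \<xi> \<partial>m)"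
    using f by (intro integral_density) auto
  also have "\<dots> = (\<integral>\<xi>. f \<xi> \<partial>m)"
    using f(2) by (intro Bochner_Integration.integral_cong) (auto split: split_indicator)
  finally show ?thesis by (simp add: ennreal_indicator)
qed

section \<open>Action of the kernels on Levy measures\<close>

context affine_semigroup
begin

lemma levy_\<mu>: "t \<ge> 0 \<Longrightarrow> levy_measure (\<mu> t)"
  using params LK_triple_levy by (auto simp: HA_parameters_def)

lemma continuous_on_psi: "t \<ge> 0 \<Longrightarrow> continuous_on dom_U (\<psi> t)"
  using regular by (simp add: regular_HA_semigroup_def HA_semigroup_def)

text \<open>Truncated moments are controlled by one minus the transform
  \<open>exp (pairing (\<psi> t u) x)\<close>. The first component of \<open>\<psi>\<close> enters
  through \<open>exp z - 1\<close>, of order \<open>chi (fst x)\<close>. The second is imaginary and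
  linear in \<open>snd u\<close>, so it enters the real part through \<open>1 - cos \<tau>\<close>,
  of order \<open>(chi (snd x))\<^sup>2\<close>.\<close>

lemma kernel_weight_bound:
  assumes t: "t \<ge> 0"
  obtains K where "\<And>x. x \<in> state_D \<Longrightarrow> (\<integral>\<eta>. chi (fst \<eta>) \<partial>Q t x) \<le> K * weight x"
    "\<And>x. x \<in> state_D \<Longrightarrow> (\<integral>\<eta>. (chi (snd \<eta>))\<^sup>2 \<partial>Q t x) \<le> K * weight x" "0 \<le> K"
proof -
  have U1: "(- 1, 0) \<in> dom_U" by (auto intro: dom_UI)
  have U2: "(0, \<i> * of_real \<theta>) \<in> dom_U" for \<theta> by (auto intro: dom_UI)
  define K1 where "K1 = 2 * (2 + norm (fst (\<psi> t (- 1, 0))))"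
  \<comment> \<open>The bound has to be uniform over the frequencies \<open>\<theta>\<close> in
    \<open>[0, 1]\<close> that \<open>integral_chi_snd_sq_le\<close> averages.\<close>
  obtain K2 where K2: "\<And>\<theta>. 0 \<le> \<theta> \<Longrightarrow> \<theta> \<le> 1 \<Longrightarrow> norm (fst (\<psi> t (0, \<i> * of_real \<theta>))) \<le> K2"
  proof -
    have "continuous_on {0..1::real} (\<lambda>\<theta>. \<psi> t (0, \<i> * of_real \<theta>))"
      using U2 by (intro continuous_on_compose2[OF continuous_on_psi[OF t]] continuous_intros) auto
    then have "bounded ((\<lambda>\<theta>. fst (\<psi> t (0, \<i> * of_real \<theta>))) ` {0..1})"
      by (intro compact_imp_bounded compact_continuous_image continuous_intros) auto
    then show thesis using that unfolding bounded_iff by force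
  qed
  have K2_nn: "0 \<le> K2" using K2[of 0] norm_ge_zero order_trans by (meson order_refl zero_le_one)
  define b where "b = 2 + \<bar>\<beta>22 t\<bar> + (\<beta>22 t)\<^sup>2"
  have b_nn: "0 \<le> b" by (simp add: b_def)
  define K where "K = K1 + 8 * ((2 + K2) + b)"
  have K1_nn: "0 \<le> K1" by (simp add: K1_def)
  have 1: "(\<integral>\<eta>. chi (fst \<eta>) \<partial>Q t x) \<le> K * weight x" if x: "x \<in> state_D" for x
  proof -
    have x0: "0 \<le> fst x" using x by (auto simp: state_D_def)
    have p: "pairing (\<psi> t (- 1, 0)) x = fst (\<psi> t (- 1, 0)) * of_real (fst x)"
      using snd_psi[OF t U1] by (simp add: pairing_def)
    have "(\<integral>\<eta>. chi (1 * fst \<eta>) \<partial>Q t x) \<le> 2 * norm (1 - transform (Q t x) (of_real (- 1), 0))"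
      by (intro integral_chi_fst_le kernel_in t x) simp
    also have "transform (Q t x) (of_real (- 1), 0) = exp (fst (\<psi> t (- 1, 0)) * of_real (fst x))"
      using transform_kernel[OF t x U1] p by simp
    also have "norm (1 - exp (fst (\<psi> t (- 1, 0)) * of_real (fst x))) \<le> (2 + norm (fst (\<psi> t (- 1, 0)))) * chi (fst x)"
      using norm_exp_minus_1_le_chi[OF dom_UD(1)[OF psi_in_dom_U[OF t U1]] x0] by (simp add: norm_minus_commute)
    finally have "(\<integral>\<eta>. chi (fst \<eta>) \<partial>Q t x) \<le> K1 * chi (fst x)" by (simp add: K1_def algebra_simps)
    also have "\<dots> \<le> K * weight x"
      using chi_fst_le_weight[OF x] chi_fst_nonneg[OF x] K1_nn K2_nn b_nn by (intro mult_mono) (auto simp: K_def)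
    finally show ?thesis .
  qed
  have 2: "(\<integral>\<eta>. (chi (snd \<eta>))\<^sup>2 \<partial>Q t x) \<le> K * weight x" if x: "x \<in> state_D" for x
  proof -
    have x0: "0 \<le> fst x" using x by (auto simp: state_D_def)
    have "(\<integral>\<eta>. (chi (1 * snd \<eta>))\<^sup>2 \<partial>Q t x) \<le> 8 * (((2 + K2) + b) * weight x)"
    proof (rule integral_chi_snd_sq_le[OF kernel_in[OF t x]])
      fix \<theta> :: real assume \<theta>: "0 \<le> \<theta>" "\<theta> \<le> 1"
      define z where "z = fst (\<psi> t (0, \<i> * of_real \<theta>)) * of_real (fst x)"
      define \<tau> where "\<tau> = (\<theta> * \<beta>22 t) * snd x"
      have "pairing (\<psi> t (0, \<i> * of_real \<theta>)) x = z + \<i> * of_real \<tau>"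
        using snd_psi[OF t U2] by (simp add: pairing_def z_def \<tau>_def algebra_simps)
      then have "transform (Q t x) (0, \<i> * of_real \<theta>) = exp z * iexp \<tau>"
        using transform_kernel[OF t x U2] by (simp add: exp_add)
      then have "1 - transform (Q t x) (0, \<i> * of_real \<theta>) = (1 - iexp \<tau>) + iexp \<tau> * (1 - exp z)" by (simp add: algebra_simps)
      then have "Re (1 - transform (Q t x) (0, \<i> * of_real \<theta>)) = (1 - cos \<tau>) + Re (iexp \<tau> * (1 - exp z))"
        by (simp only: plus_complex.sel) (simp add: Re_exp)
      also have "\<dots> \<le> b * (chi (snd x))\<^sup>2 + (2 + K2) * chi (fst x)"
      proof (intro add_mono)
        have "1 - cos \<tau> \<le> (2 + \<bar>\<theta> * \<beta>22 t\<bar> + (\<theta> * \<beta>22 t)\<^sup>2) * (chi (snd x))\<^sup>2"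
          unfolding \<tau>_def by (rule one_minus_cos_le_chi_sq)
        also have "\<dots> \<le> b * (chi (snd x))\<^sup>2"
          using \<theta> by (intro mult_right_mono) (auto simp: b_def abs_mult power_mult_distrib mult_left_le_one_le power_le_one intro!: add_mono)
        finally show "1 - cos \<tau> \<le> b * (chi (snd x))\<^sup>2" .
        have "Re (iexp \<tau> * (1 - exp z)) \<le> norm (iexp \<tau> * (1 - exp z))" by (rule complex_Re_le_cmod)
        also have "\<dots> = norm (exp z - 1)" by (simp add: norm_mult norm_minus_commute)
        also have "\<dots> \<le> (2 + norm (fst (\<psi> t (0, \<i> * of_real \<theta>)))) * chi (fst x)"
          unfolding z_def by (rule norm_exp_minus_1_le_chi[OF dom_UD(1)[OF psi_in_dom_U[OF t U2]] x0])
        also have "\<dots> \<le> (2 + K2) * chi (fst x)"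
          using K2[OF \<theta>] chi_fst_nonneg[OF x] by (intro mult_right_mono) auto
        finally show "Re (iexp \<tau> * (1 - exp z)) \<le> (2 + K2) * chi (fst x)" .
      qed
      also have "\<dots> \<le> b * weight x + (2 + K2) * weight x"
        using chi_snd_le_weight[OF x] chi_fst_le_weight[OF x] K2_nn b_nn by (intro add_mono mult_left_mono) auto
      finally show "Re (1 - transform (Q t x) (0, \<i> * of_real \<theta>)) \<le> ((2 + K2) + b) * weight x" by (simp add: algebra_simps)
    qed simp
    also have "\<dots> \<le> K * weight x"
      using K1_nn weight_nonneg[OF x] unfolding K_def by (simp add: algebra_simps)
    finally show ?thesis by simp
  qed
  have "0 \<le> K" using K1_nn K2_nn b_nn by (simp add: K_def)
  then show thesis using 1 2 by (intro that)
qed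

lemma kernel_integrable:
  fixes f :: "real \<times> real \<Rightarrow> 'b::{banach, second_countable_topology}"
  assumes "t \<ge> 0" "x \<in> state_D" "continuous_on state_D f" "\<And>\<eta>. \<eta> \<in> state_D \<Longrightarrow> norm (f \<eta>) \<le> B"
  shows "integrable (Q t x) f"
  using kernel_in[OF assms(1,2)] assms(3,4)
  by (intro integrable_bounded_on_D[where B=B] continuous_on_D_measurable) (auto dest: prob_algebra_D)

text \<open>This makes the integral in the relation for \<open>b2\<close> converge. Replacing the
  truncation by \<open>sin\<close> costs a multiple of its square. The integral of
  \<open>sin\<close> is the imaginary part of the transform at \<open>(0, \<i>)\<close>, which is
  compared first with \<open>sin (\<beta>22 t * snd x)\<close> and then with
  \<open>\<beta>22 t * chi (snd x)\<close>.\<close>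

lemma Q_chi2_bound:
  assumes t: "t \<ge> 0"
  obtains K where "\<And>x. x \<in> state_D \<Longrightarrow> \<bar>Q_chi2 Q t x - \<beta>22 t * chi (snd x)\<bar> \<le> K * weight x"
proof -
  obtain K0 where K0: "\<And>x. x \<in> state_D \<Longrightarrow> (\<integral>\<eta>. (chi (snd \<eta>))\<^sup>2 \<partial>Q t x) \<le> K0 * weight x" "0 \<le> K0"
    using kernel_weight_bound[OF t] by metis
  have U: "(0, \<i>) \<in> dom_U" by (auto intro: dom_UI)
  define b where "b = 2 + \<bar>\<beta>22 t\<bar> + (\<beta>22 t)\<^sup>2"
  have b_nn: "0 \<le> b" by (simp add: b_def)
  define K where "K = 4 * K0 + (2 + norm (fst (\<psi> t (0, \<i>)))) + b"
  have "\<bar>Q_chi2 Q t x - \<beta>22 t * chi (snd x)\<bar> \<le> K * weight x" if x: "x \<in> state_D" for x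
  proof -
    have x0: "0 \<le> fst x" using x by (auto simp: state_D_def)
    define z where "z = fst (\<psi> t (0, \<i>)) * of_real (fst x)"
    define \<tau> where "\<tau> = \<beta>22 t * snd x"
    have i: "integrable (Q t x) (\<lambda>\<eta>. chi (snd \<eta>))" "integrable (Q t x) (\<lambda>\<eta>. sin (snd \<eta>))" "integrable (Q t x) (\<lambda>\<eta>. (chi (snd \<eta>))\<^sup>2)"
      using abs_chi_le_1 chi_sq_le_1 by (auto intro!: kernel_integrable[OF t x, where B=1] continuous_intros)
    have ie: "integrable (Q t x) (\<lambda>\<eta>. exp (pairing (0, \<i>) \<eta>))"
      using norm_exp_pairing_le[OF U] by (intro kernel_integrable[OF t x, where B=1] continuous_intros) auto
    have "(\<integral>\<eta>. sin (snd \<eta>) \<partial>Q t x) = Im (transform (Q t x) (0, \<i>))"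
      unfolding transform_def by (subst integral_Im[OF ie, symmetric]) (simp add: pairing_def Im_exp)
    also have "transform (Q t x) (0, \<i>) = exp z * iexp \<tau>"
      using transform_kernel[OF t x U] snd_psi[OF t U] by (simp add: pairing_def z_def \<tau>_def exp_add algebra_simps)
    finally have s: "(\<integral>\<eta>. sin (snd \<eta>) \<partial>Q t x) = Im (exp z * iexp \<tau>)" .
    \<comment> \<open>The constant 4 is \<open>2 + \<bar>s\<bar> + s\<^sup>2\<close> at
      \<open>s = 1\<close> in \<open>abs_sin_minus_chi_le\<close>.\<close>
    have 1: "\<bar>Q_chi2 Q t x - (\<integral>\<eta>. sin (snd \<eta>) \<partial>Q t x)\<bar> \<le> 4 * (K0 * weight x)"
    proof -
      have "\<bar>Q_chi2 Q t x - (\<integral>\<eta>. sin (snd \<eta>) \<partial>Q t x)\<bar> = norm (\<integral>\<eta>. chi (snd \<eta>) - sin (snd \<eta>) \<partial>Q t x)"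
        unfolding Q_chi2_def using i by simp
      also have "\<dots> \<le> (\<integral>\<eta>. norm (chi (snd \<eta>) - sin (snd \<eta>)) \<partial>Q t x)" by (rule integral_norm_bound)
      also have "\<dots> \<le> (\<integral>\<eta>. 4 * (chi (snd \<eta>))\<^sup>2 \<partial>Q t x)"
        using i abs_sin_minus_chi_le[of 1] by (intro integral_mono) (auto simp: abs_minus_commute)
      also have "\<dots> \<le> 4 * (K0 * weight x)" using K0(1)[OF x] by simp
      finally show ?thesis .
    qed
    have 2: "\<bar>Im (exp z * iexp \<tau>) - sin \<tau>\<bar> \<le> (2 + norm (fst (\<psi> t (0, \<i>)))) * chi (fst x)"
    proof -
      have "Im (exp z * iexp \<tau>) - sin \<tau> = Im ((exp z - 1) * iexp \<tau>)" by (simp add: Im_exp algebra_simps)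
      also have "\<bar>\<dots>\<bar> \<le> norm ((exp z - 1) * iexp \<tau>)" by (rule abs_Im_le_cmod)
      also have "\<dots> = norm (exp z - 1)" by (simp add: norm_mult)
      also have "\<dots> \<le> (2 + norm (fst (\<psi> t (0, \<i>)))) * chi (fst x)"
        unfolding z_def by (rule norm_exp_minus_1_le_chi[OF dom_UD(1)[OF psi_in_dom_U[OF t U]] x0])
      finally show ?thesis .
    qed
    have 3: "\<bar>sin \<tau> - \<beta>22 t * chi (snd x)\<bar> \<le> b * (chi (snd x))\<^sup>2"
      unfolding \<tau>_def b_def by (rule abs_sin_minus_chi_le)
    have "\<bar>Q_chi2 Q t x - \<beta>22 t * chi (snd x)\<bar> \<le> 4 * (K0 * weight x) + (2 + norm (fst (\<psi> t (0, \<i>)))) * chi (fst x) + b * (chi (snd x))\<^sup>2"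
      using 1 2 3 s by linarith
    also have "\<dots> \<le> 4 * (K0 * weight x) + (2 + norm (fst (\<psi> t (0, \<i>)))) * weight x + b * weight x"
      using chi_snd_le_weight[OF x] chi_fst_le_weight[OF x] b_nn by (intro add_mono mult_left_mono order_refl) auto
    finally show ?thesis by (simp add: K_def algebra_simps)
  qed
  then show thesis by (rule that)
qed

text \<open>\<open>m\<close> may be infinite, but by \<open>kernel_weight_bound\<close> the weighted
  mass of the mixture is at most \<open>2 * K\<close> times that of \<open>m\<close>.\<close>

lemma bind_levy:
  assumes t: "t \<ge> 0" and m: "levy_measure m"
  shows "sets (bind m (Q t)) = sets borel_D" "(\<integral>\<^sup>+\<eta>. ennreal (weight \<eta>) \<partial>bind m (Q t)) < \<infinity>"
proof -
  note \<kappa> = kernel_subprob[OF levy_measureD(1)[OF m] kernel[OF t]]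
  have "space m \<noteq> {}" using levy_measureD(2)[OF m] zero_in_state_D by auto
  then show "sets (bind m (Q t)) = sets borel_D"
    using kernel_in[OF t] levy_measureD(2)[OF m] by (intro sets_bind) (auto dest: prob_algebra_D)
  obtain K where K: "\<And>x. x \<in> state_D \<Longrightarrow> (\<integral>\<eta>. chi (fst \<eta>) \<partial>Q t x) \<le> K * weight x"
    "\<And>x. x \<in> state_D \<Longrightarrow> (\<integral>\<eta>. (chi (snd \<eta>))\<^sup>2 \<partial>Q t x) \<le> K * weight x" "0 \<le> K"
    using kernel_weight_bound[OF t] by metis
  have wm: "weight \<in> borel_measurable borel_D" by (rule continuous_on_D_measurable[OF refl continuous_on_weight])
  have "(\<integral>\<^sup>+\<eta>. ennreal (weight \<eta>) \<partial>bind m (Q t)) = (\<integral>\<^sup>+x. \<integral>\<^sup>+\<eta>. ennreal (weight \<eta>) \<partial>Q t x \<partial>m)"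
    using wm by (intro nn_integral_bind[OF _ \<kappa>]) auto
  also have "\<dots> \<le> (\<integral>\<^sup>+x. ennreal (2 * K * weight x) \<partial>m)"
  proof (intro nn_integral_mono)
    fix x assume "x \<in> space m"
    then have x: "x \<in> state_D" by (simp add: levy_measureD(2)[OF m])
    have sp: "space (Q t x) = state_D" using kernel_in[OF t x] by (intro space_of_sets_borel_D) (auto dest: prob_algebra_D)
    have i: "integrable (Q t x) (\<lambda>\<eta>. chi (fst \<eta>))" "integrable (Q t x) (\<lambda>\<eta>. (chi (snd \<eta>))\<^sup>2)" 
      using abs_chi_le_1 chi_sq_le_1 by (auto intro!: kernel_integrable[OF t x, where B=1] continuous_intros)
    then have iw: "integrable (Q t x) weight" unfolding weight_def[abs_def] by simp
    have "(\<integral>\<^sup>+\<eta>. ennreal (weight \<eta>) \<partial>Q t x) = ennreal (\<integral>\<eta>. weight \<eta> \<partial>Q t x)"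
      using iw weight_nonneg by (intro nn_integral_eq_integral) (auto simp: sp)
    also have "(\<integral>\<eta>. weight \<eta> \<partial>Q t x) \<le> 2 * K * weight x"
      unfolding weight_def[of "_ :: real \<times> real", abs_def] using i K(1,2)[OF x] by (simp add: weight_def)
    finally show "(\<integral>\<^sup>+\<eta>. ennreal (weight \<eta>) \<partial>Q t x) \<le> ennreal (2 * K * weight x)" by (simp add: ennreal_leI)
  qed
  also have "\<dots> < \<infinity>"
  proof -
    have "integrable m (\<lambda>x. 2 * K * weight x)" using levy_measureD(4)[OF m] by simp
    then have "(\<integral>\<^sup>+x. ennreal (2 * K * weight x) \<partial>m) \<noteq> \<infinity>" unfolding real_integrable_def by blast
    then show ?thesis unfolding infinity_ennreal_def less_top .
  qed
  finally show "(\<integral>\<^sup>+\<eta>. ennreal (weight \<eta>) \<partial>bind m (Q t)) < \<infinity>" .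
qed

text \<open>The mass that the mixture \<open>\<integral> m(d\<xi>) Q(t, \<xi>, \<cdot>)\<close> puts at the origin may be infinite and is removed.\<close>

definition pushed :: "real \<Rightarrow> (real \<times> real) measure \<Rightarrow> (real \<times> real) measure" where
  "pushed t m = density (bind m (Q t)) (indicator (-{0}))"

lemma emeasure_pushed:
  assumes t: "t \<ge> 0" and m: "levy_measure m" and B: "B \<in> sets borel_D"
  shows "0 \<notin> B \<Longrightarrow> emeasure (pushed t m) B = (\<integral>\<^sup>+\<xi>. emeasure (Q t \<xi>) B \<partial>m)"
    and "emeasure (pushed t m) {0} = 0"
proof -
  note \<kappa> = kernel_subprob[OF levy_measureD(1)[OF m] kernel[OF t]]
  note sb = bind_levy(1)[OF t m]
  have ne: "space m \<noteq> {}" using levy_measureD(2)[OF m] zero_in_state_D by auto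
  have im: "(indicator (-{0}) :: _ \<Rightarrow> ennreal) \<in> borel_measurable (bind m (Q t))"
    by (rule borel_measurable_on_D[OF sb]) (auto intro!: borel_measurable_indicator)
  have *: "emeasure (pushed t m) C = (\<integral>\<^sup>+\<xi>. indicator (-{0}) \<xi> * indicator C \<xi> \<partial>bind m (Q t))" if "C \<in> sets borel_D" for C
    unfolding pushed_def using that sb im by (intro emeasure_density) auto
  have "emeasure (pushed t m) {0} = (\<integral>\<^sup>+\<xi>. 0 \<partial>bind m (Q t))"
    unfolding *[OF zero_sets_borel_D] by (intro nn_integral_cong) (auto split: split_indicator)
  then show "emeasure (pushed t m) {0} = 0" by simp
  assume "0 \<notin> B"
  then have "emeasure (pushed t m) B = (\<integral>\<^sup>+\<xi>. indicator B \<xi> \<partial>bind m (Q t))"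
    unfolding *[OF B] by (intro nn_integral_cong) (auto split: split_indicator)
  also have "\<dots> = emeasure (bind m (Q t)) B" using B sb by simp
  also have "\<dots> = (\<integral>\<^sup>+\<xi>. emeasure (Q t \<xi>) B \<partial>m)" by (rule emeasure_bind[OF ne \<kappa> B])
  finally show "emeasure (pushed t m) B = (\<integral>\<^sup>+\<xi>. emeasure (Q t \<xi>) B \<partial>m)" .
qed

lemma levy_pushed:
  assumes t: "t \<ge> 0" and m: "levy_measure m"
  shows "levy_measure (pushed t m)"
  unfolding levy_measure_def
proof (intro conjI)
  note sb = bind_levy(1)[OF t m]
  show "sets (pushed t m) = sets borel_D" by (simp add: pushed_def sb)
  show "emeasure (pushed t m) {0} = 0" by (rule emeasure_pushed(2)[OF t m zero_sets_borel_D])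
  have "(indicator (-{0}) :: _ \<Rightarrow> ennreal) \<in> borel_measurable (bind m (Q t))"
    by (rule borel_measurable_on_D[OF sb]) (auto intro!: borel_measurable_indicator)
  then have "(\<integral>\<^sup>+\<xi>. ennreal (weight \<xi>) \<partial>pushed t m) = (\<integral>\<^sup>+\<xi>. indicator (-{0}) \<xi> * ennreal (weight \<xi>) \<partial>bind m (Q t))"
    unfolding pushed_def using continuous_on_D_measurable[OF sb continuous_on_weight] by (intro nn_integral_density) auto
  also have "\<dots> \<le> (\<integral>\<^sup>+\<xi>. ennreal (weight \<xi>) \<partial>bind m (Q t))"
    by (intro nn_integral_mono) (auto split: split_indicator)
  also have "\<dots> < \<infinity>" by (rule bind_levy(2)[OF t m])
  finally show "(\<integral>\<^sup>+\<xi>. ennreal (weight \<xi>) \<partial>pushed t m) < \<infinity>" .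
qed

lemma integrable_Q_chi2_diff:
  assumes t: "t \<ge> 0" and m: "levy_measure m"
  shows "integrable m (\<lambda>\<xi>. Q_chi2 Q t \<xi> - \<beta>22 t * chi (snd \<xi>))"
proof -
  note sm = levy_measureD(1)[OF m]
  obtain K where K: "\<And>x. x \<in> state_D \<Longrightarrow> \<bar>Q_chi2 Q t x - \<beta>22 t * chi (snd x)\<bar> \<le> K * weight x"
    using Q_chi2_bound[OF t] by metis
  have c: "(\<lambda>\<eta> :: real \<times> real. chi (snd \<eta>)) \<in> borel_measurable l" if "sets l = sets borel_D" for l
    by (intro continuous_on_D_measurable[OF that] continuous_intros)
  have "Q_chi2 Q t \<in> borel_measurable m"
    unfolding Q_chi2_def[abs_def]
    using measurable_compose[OF kernel_subprob[OF sm kernel[OF t]] integral_measurable_subprob_algebra[OF c[OF refl]]] .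
  then show ?thesis
    using K c[OF sm] by (intro levy_integrable[OF m]) auto
qed

text \<open>Integrating the integrand for \<open>u\<close> over \<open>Q t \<xi>\<close> reproduces
  the one for \<open>\<psi> t u\<close>, except that the compensator is
  \<open>Q_chi2 Q t \<xi>\<close> in place of \<open>\<beta>22 t * chi (snd \<xi>)\<close>. This
  discrepancy is the source of the integral in the relation for \<open>b2\<close>.\<close>

lemma LK_exponent_psi:
  assumes t: "t \<ge> 0" and m: "levy_measure m" and u: "u \<in> dom_U"
  shows "(\<integral>\<xi>. LK_integrand (\<psi> t u) \<xi> \<partial>m) =
    (\<integral>\<xi>. LK_integrand u \<xi> \<partial>pushed t m) + snd u * of_real (\<integral>\<xi>. Q_chi2 Q t \<xi> - \<beta>22 t * chi (snd \<xi>) \<partial>m)"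
proof -
  note \<kappa> = kernel_subprob[OF levy_measureD(1)[OF m] kernel[OF t]]
  note sb = bind_levy(1)[OF t m]
  have Lm: "LK_integrand u \<in> borel_measurable borel_D" by (rule continuous_on_D_measurable[OF refl continuous_on_LK_integrand])
  have Lb: "norm (LK_integrand u \<xi>) \<le> LK_const u * 2" if "\<xi> \<in> state_D" for \<xi>
  proof -
    have "norm (LK_integrand u \<xi>) \<le> LK_const u * weight \<xi>" by (rule norm_LK_integrand_le[OF u that])
    also have "\<dots> \<le> LK_const u * 2" using weight_le_2[OF that] by (intro mult_left_mono) (auto simp: LK_const_def)
    finally show ?thesis .
  qed
  have int: "integrable (bind m (Q t)) (LK_integrand u)"
  proof (rule Bochner_Integration.integrable_bound)
    have spb: "space (bind m (Q t)) = state_D" by (rule space_of_sets_borel_D[OF sb])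
    have wb: "weight \<in> borel_measurable (bind m (Q t))" by (rule continuous_on_D_measurable[OF sb continuous_on_weight])
    have "(\<integral>\<^sup>+\<xi>. ennreal (norm (weight \<xi>)) \<partial>bind m (Q t)) = (\<integral>\<^sup>+\<xi>. ennreal (weight \<xi>) \<partial>bind m (Q t))"
      using weight_nonneg by (intro nn_integral_cong) (simp add: spb)
    then have "integrable (bind m (Q t)) weight"
      using bind_levy(2)[OF t m] wb by (simp add: integrable_iff_bounded)
    then show "integrable (bind m (Q t)) (\<lambda>\<xi>. LK_const u * weight \<xi>)" by simp
    show "LK_integrand u \<in> borel_measurable (bind m (Q t))" by (rule continuous_on_D_measurable[OF sb continuous_on_LK_integrand])
    show "AE \<xi> in bind m (Q t). norm (LK_integrand u \<xi>) \<le> norm (LK_const u * weight \<xi>)"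
      using norm_LK_integrand_le[OF u] spb by (intro AE_I2) (fastforce intro: order_trans)
  qed
  have inner: "(\<integral>\<eta>. LK_integrand u \<eta> \<partial>Q t \<xi>) = LK_integrand (\<psi> t u) \<xi> - snd u * of_real (Q_chi2 Q t \<xi> - \<beta>22 t * chi (snd \<xi>))"
    if \<xi>: "\<xi> \<in> state_D" for \<xi>
  proof -
    interpret prob_space "Q t \<xi>" using prob_algebra_D(1)[OF kernel_in[OF t \<xi>]] .
    have i: "integrable (Q t \<xi>) (\<lambda>\<eta>. exp (pairing u \<eta>))" "integrable (Q t \<xi>) (\<lambda>\<eta>. complex_of_real (chi (snd \<eta>)))"
      using norm_exp_pairing_le[OF u] abs_chi_le_1 by (intro kernel_integrable[OF t \<xi>, where B=1] continuous_intros; simp)+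
    have "(\<integral>\<eta>. LK_integrand u \<eta> \<partial>Q t \<xi>) = transform (Q t \<xi>) u - 1 - snd u * of_real (Q_chi2 Q t \<xi>)"
      unfolding LK_integrand_def transform_def Q_chi2_def using i prob_space by simp
    then show ?thesis
      by (simp add: transform_kernel[OF t \<xi> u] LK_integrand_def snd_psi[OF t u] algebra_simps)
  qed
  \<comment> \<open>The integrand vanishes at the origin, so the removed mass does not matter even
    if it is infinite.\<close>
  have "(\<integral>\<xi>. LK_integrand u \<xi> \<partial>pushed t m) = (\<integral>\<xi>. LK_integrand u \<xi> \<partial>bind m (Q t))"
    unfolding pushed_def
    by (rule integral_density_indicator_neq[OF sb continuous_on_D_measurable[OF sb continuous_on_LK_integrand] LK_integrand_0])
  also have "\<dots> = (\<integral>\<xi>. \<integral>\<eta>. LK_integrand u \<eta> \<partial>Q t \<xi> \<partial>m)"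
    by (rule integral_bind_complex[OF \<kappa> Lm _ int]) (use Lb in \<open>simp add: space_restrict_space\<close>)
  also have "\<dots> = (\<integral>\<xi>. LK_integrand (\<psi> t u) \<xi> - snd u * of_real (Q_chi2 Q t \<xi> - \<beta>22 t * chi (snd \<xi>)) \<partial>m)"
    using inner levy_measureD(2)[OF m] by (intro Bochner_Integration.integral_cong) auto
  also have "\<dots> = (\<integral>\<xi>. LK_integrand (\<psi> t u) \<xi> \<partial>m) - (\<integral>\<xi>. snd u * of_real (Q_chi2 Q t \<xi> - \<beta>22 t * chi (snd \<xi>)) \<partial>m)"
    by (intro Bochner_Integration.integral_diff integrable_LK_integrand m psi_in_dom_U t u
        integrable_mult_right integrable_of_real integrable_Q_chi2_diff)
  also have "(\<integral>\<xi>. snd u * of_real (Q_chi2 Q t \<xi> - \<beta>22 t * chi (snd \<xi>)) \<partial>m) = snd u * of_real (\<integral>\<xi>. Q_chi2 Q t \<xi> - \<beta>22 t * chi (snd \<xi>) \<partial>m)"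
    by (simp only: integral_mult_right_zero integral_complex_of_real)
  finally show ?thesis by simp
qed

end

section \<open>Relations between the exponents, and their existence\<close>

context skew_semigroup
begin

lemma SC_parameters_relation:
  assumes par: "SC_parameters \<gamma> b1 b2 a m" and r: "r \<ge> 0" and t: "t \<ge> 0"
  shows "b1 (r + t) = b1 r * \<beta>11 t + b1 t"
    and "b2 (r + t) = b1 r * \<beta>12 t + b2 r * \<beta>22 t + b2 t + (\<integral>\<xi>. (Q_chi2 Q t \<xi> - \<beta>22 t * chi (snd \<xi>)) \<partial>m r)"
    and "a (r + t) = b1 r * \<alpha> t + a r * (\<beta>22 t)\<^sup>2 + a t"
    and "B \<in> sets borel_D \<Longrightarrow> 0 \<notin> B \<Longrightarrow> emeasure (m (r + t)) B =
      (\<integral>\<^sup>+\<xi>. emeasure (Q t \<xi>) B \<partial>m r) + ennreal (b1 r) * emeasure (\<mu> t) B + emeasure (m t) B"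
proof -
  have tri: "LK_triple (b1 s) (b2 s) (a s) (m s)" if "s \<ge> 0" for s using par that by (simp add: SC_parameters_def)
  have levy: "levy_measure (m s)" if "s \<ge> 0" for s using LK_triple_levy[OF tri[OF that]] .
  have nn: "0 \<le> b1 s" "0 \<le> a s" if "s \<ge> 0" for s using tri[OF that] by (auto simp: LK_triple_def state_D_def)
  have nn_par: "0 \<le> \<beta>11 t" "0 \<le> \<alpha> t" using params t by (auto simp: HA_parameters_def LK_triple_def state_D_def)
  have tr: "transform (\<gamma> s) u = exp (LK_exponent (b1 s) (b2 s) (a s) (m s) u)" if "s \<ge> 0" "u \<in> dom_U" for s u
    using par that by (simp add: SC_parameters_def transform_def)
  have rt: "r + t \<ge> 0" using r t by simp
  \<comment> \<open>The relation between transforms only says \<open>exp (F u) = 1\<close>;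
    continuity and \<open>F 0 = 0\<close> exclude the nonzero multiples of 2 pi i.\<close>
  define F where "F u = LK_exponent (b1 (r + t)) (b2 (r + t)) (a (r + t)) (m (r + t)) u
      - LK_exponent (b1 r) (b2 r) (a r) (m r) (\<psi> t u) - LK_exponent (b1 t) (b2 t) (a t) (m t) u" for u
  have F0: "F u = 0" if u: "u \<in> dom_U" for u
  proof (rule eq_0_of_exp_eq_1[OF connected_dom_U _ _ zero_in_dom_U(1) _ u])
    show "continuous_on dom_U F"
      unfolding F_def using psi_in_dom_U[OF t]
      by (intro continuous_intros continuous_on_LK_exponent levy r t rt
          continuous_on_compose2[OF continuous_on_LK_exponent continuous_on_psi]) auto
    show "exp (F v) = 1" if v: "v \<in> dom_U" for v
      using transform_\<gamma>_add[OF r t v] unfolding tr[OF rt v] tr[OF t v] tr[OF r psi_in_dom_U[OF t v]]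
      by (simp add: F_def exp_diff)
    show "F 0 = 0" by (simp add: F_def psi_0[OF t])
  qed
  define \<mu>' where "\<mu>' = density (\<mu> t) (\<lambda>_. ennreal (b1 r))"
  define m' where "m' = add_measure (add_measure (pushed t (m r)) \<mu>') (m t)"
  note lp = levy_pushed[OF t levy[OF r]] and l\<mu> = levy_\<mu>[OF t] and lt = levy[OF t]
  have s: "sets (pushed t (m r)) = sets borel_D" "sets \<mu>' = sets borel_D" "sets (m t) = sets borel_D"
    using levy_measureD(1)[OF lp] levy_measureD(1)[OF l\<mu>] levy_measureD(1)[OF lt] by (simp_all add: \<mu>'_def)
  have e\<mu>: "emeasure \<mu>' B = ennreal (b1 r) * emeasure (\<mu> t) B" if "B \<in> sets borel_D" for B
    unfolding \<mu>'_def using that levy_measureD(1)[OF l\<mu>] by (intro emeasure_density_const) auto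
  have em': "emeasure m' B = emeasure (pushed t (m r)) B + ennreal (b1 r) * emeasure (\<mu> t) B + emeasure (m t) B" if "B \<in> sets borel_D" for B
    unfolding m'_def using that s by (simp add: emeasure_add_measure e\<mu>)
  have nn\<mu>: "(\<integral>\<^sup>+\<xi>. ennreal (weight \<xi>) \<partial>\<mu>') = ennreal (b1 r) * (\<integral>\<^sup>+\<xi>. ennreal (weight \<xi>) \<partial>\<mu> t)"
  proof -
    have "weight \<in> borel_measurable (\<mu> t)" by (rule continuous_on_D_measurable[OF levy_measureD(1)[OF l\<mu>] continuous_on_weight])
    then show ?thesis unfolding \<mu>'_def by (subst nn_integral_density) (auto simp: nn_integral_cmult)
  qed
  have l\<mu>': "levy_measure \<mu>'"
    using s(2) e\<mu>[OF zero_sets_borel_D] levy_measureD(3)[OF l\<mu>] nn\<mu> l\<mu>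
    by (auto simp: levy_measure_def ennreal_mult_less_top)
  have lm': "levy_measure m'"
    unfolding levy_measure_def
  proof (intro conjI)
    show "sets m' = sets borel_D" by (simp add: m'_def s)
    show "emeasure m' {0} = 0"
      using em'[OF zero_sets_borel_D] levy_measureD(3)[OF lp] levy_measureD(3)[OF l\<mu>] levy_measureD(3)[OF lt] by simp
    have w: "(\<lambda>\<xi>. ennreal (weight \<xi>)) \<in> borel_measurable l" if "sets l = sets borel_D" for l
      using continuous_on_D_measurable[OF that continuous_on_weight] by simp
    have "(\<integral>\<^sup>+\<xi>. ennreal (weight \<xi>) \<partial>m') = (\<integral>\<^sup>+\<xi>. ennreal (weight \<xi>) \<partial>pushed t (m r)) +
        (\<integral>\<^sup>+\<xi>. ennreal (weight \<xi>) \<partial>\<mu>') + (\<integral>\<^sup>+\<xi>. ennreal (weight \<xi>) \<partial>m t)"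
      unfolding m'_def using s w by (simp add: nn_integral_add_measure)
    then show "(\<integral>\<^sup>+\<xi>. ennreal (weight \<xi>) \<partial>m') < \<infinity>"
      using lp l\<mu>' lt by (simp add: levy_measure_def)
  qed
  have int_m': "(\<integral>\<xi>. LK_integrand u \<xi> \<partial>m') = (\<integral>\<xi>. LK_integrand u \<xi> \<partial>pushed t (m r)) + of_real (b1 r) * (\<integral>\<xi>. LK_integrand u \<xi> \<partial>\<mu> t) + (\<integral>\<xi>. LK_integrand u \<xi> \<partial>m t)"
    if u: "u \<in> dom_U" for u
  proof -
    note i = integrable_LK_integrand[OF lp u] integrable_LK_integrand[OF l\<mu>' u] integrable_LK_integrand[OF lt u]
    have i12: "integrable (add_measure (pushed t (m r)) \<mu>') (LK_integrand u)"
      using i s by (simp add: integrable_add_measure_iff)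
    have "(\<integral>\<xi>. LK_integrand u \<xi> \<partial>\<mu>') = (\<integral>\<xi>. b1 r *\<^sub>R LK_integrand u \<xi> \<partial>\<mu> t)"
      unfolding \<mu>'_def using nn(1)[OF r] continuous_on_D_measurable[OF levy_measureD(1)[OF l\<mu>] continuous_on_LK_integrand]
      by (intro integral_density) auto
    then have "(\<integral>\<xi>. LK_integrand u \<xi> \<partial>\<mu>') = of_real (b1 r) * (\<integral>\<xi>. LK_integrand u \<xi> \<partial>\<mu> t)"
      by (simp add: scaleR_conv_of_real)
    moreover have "(\<integral>\<xi>. LK_integrand u \<xi> \<partial>m') = (\<integral>\<xi>. LK_integrand u \<xi> \<partial>add_measure (pushed t (m r)) \<mu>') + (\<integral>\<xi>. LK_integrand u \<xi> \<partial>m t)"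
      unfolding m'_def using s i i12 by (intro integral_add_measure) auto
    moreover have "(\<integral>\<xi>. LK_integrand u \<xi> \<partial>add_measure (pushed t (m r)) \<mu>') = (\<integral>\<xi>. LK_integrand u \<xi> \<partial>pushed t (m r)) + (\<integral>\<xi>. LK_integrand u \<xi> \<partial>\<mu>')"
      using s i by (intro integral_add_measure) auto
    ultimately show ?thesis by simp
  qed
  define h where "h = (\<integral>\<xi>. (Q_chi2 Q t \<xi> - \<beta>22 t * chi (snd \<xi>)) \<partial>m r)"
  have eq: "LK_exponent (b1 (r + t)) (b2 (r + t)) (a (r + t)) (m (r + t)) u =
      LK_exponent (b1 r * \<beta>11 t + b1 t) (b1 r * \<beta>12 t + b2 r * \<beta>22 t + b2 t + h) (b1 r * \<alpha> t + a r * (\<beta>22 t)\<^sup>2 + a t) m' u"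
    if u: "u \<in> dom_U" for u
  proof -
    have psi1: "fst (\<psi> t u) = LK_exponent (\<beta>11 t) (\<beta>12 t) (\<alpha> t) (\<mu> t) u"
      using params t u by (simp add: HA_parameters_def)
    have "LK_exponent (b1 (r + t)) (b2 (r + t)) (a (r + t)) (m (r + t)) u =
        LK_exponent (b1 r) (b2 r) (a r) (m r) (\<psi> t u) + LK_exponent (b1 t) (b2 t) (a t) (m t) u"
      using F0[OF u] by (simp add: F_def algebra_simps)
    \<comment> \<open>At \<open>\<psi> t u\<close> the coefficient \<open>b1 r\<close> multiplies a
      whole Levy-Khintchine exponent, with parameters \<open>\<beta>11\<close>,
      \<open>\<beta>12\<close>, \<open>\<alpha>\<close>, \<open>\<mu>\<close> at time
      \<open>t\<close>, while \<open>b2 r\<close> and \<open>a r\<close> meet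
      \<open>\<beta>22 t * snd u\<close> and its square.\<close>
    also have "\<dots> = LK_exponent (b1 r * \<beta>11 t + b1 t) (b1 r * \<beta>12 t + b2 r * \<beta>22 t + b2 t + h) (b1 r * \<alpha> t + a r * (\<beta>22 t)\<^sup>2 + a t) m' u"
      unfolding LK_exponent_alt int_m'[OF u] LK_exponent_psi[OF t levy[OF r] u] snd_psi[OF t u] psi1 h_def[symmetric]
      by (simp add: algebra_simps power_mult_distrib)
    finally show ?thesis .
  qed
  note U = LK_unique[OF levy[OF rt] lm' nn(1)[OF rt] _ nn(2)[OF rt] _ eq]
  have p: "0 \<le> b1 r * \<beta>11 t + b1 t" "0 \<le> b1 r * \<alpha> t + a r * (\<beta>22 t)\<^sup>2 + a t"
    using nn[OF r] nn[OF t] nn_par by auto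
  show "b1 (r + t) = b1 r * \<beta>11 t + b1 t" by (rule U(1)[OF p])
  show "a (r + t) = b1 r * \<alpha> t + a r * (\<beta>22 t)\<^sup>2 + a t" by (rule U(3)[OF p])
  show "b2 (r + t) = b1 r * \<beta>12 t + b2 r * \<beta>22 t + b2 t + (\<integral>\<xi>. (Q_chi2 Q t \<xi> - \<beta>22 t * chi (snd \<xi>)) \<partial>m r)"
    using U(2)[OF p] by (simp add: h_def)
  assume B: "B \<in> sets borel_D" "0 \<notin> B"
  show "emeasure (m (r + t)) B = (\<integral>\<^sup>+\<xi>. emeasure (Q t \<xi>) B \<partial>m r) + ennreal (b1 r) * emeasure (\<mu> t) B + emeasure (m t) B"
    using U(4)[OF p _ B(1)] em'[OF B(1)] emeasure_pushed(1)[OF t levy[OF r] B] by simp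
qed

lemma \<gamma>_0: "\<gamma> 0 = return borel_D 0"
  by (rule prob_algebra_D_eqI) (auto simp: \<gamma>_in return_in_prob_algebra transform_\<gamma>_0 transform_return zero_in_state_D)

text \<open>The path \<open>\<psi>([0, t], u)\<close> is bounded, so all factors of the product formula for a fine partition are
  close to \<open>1\<close>.\<close>

lemma transform_\<gamma>_nonzero:
  assumes t: "t \<ge> 0" and u: "u \<in> dom_U"
  shows "transform (\<gamma> t) u \<noteq> 0"
proof -
  have "compact ((\<lambda>s. \<psi> s u) ` {0..t})"
    by (intro compact_continuous_image continuous_on_subset[OF continuous_on_psi_time[OF u]]) auto
  then have "bounded ((\<lambda>s. \<psi> s u) ` {0..t})" by (rule compact_imp_bounded)
  then obtain R where R: "\<And>s. 0 \<le> s \<Longrightarrow> s \<le> t \<Longrightarrow> norm (\<psi> s u) \<le> R"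
    unfolding bounded_iff by force
  define f where "f \<xi> = min 2 (R * (\<bar>fst \<xi>\<bar> + \<bar>snd \<xi>\<bar>))" for \<xi> :: "real \<times> real"
  have R0: "0 \<le> R" using R[of 0] t norm_ge_zero order_trans by (metis order_refl)
  have f_c: "continuous_on state_D f" unfolding f_def by (intro continuous_intros)
  have f_b: "\<bar>f \<xi>\<bar> \<le> 2" for \<xi>
  proof -
    have "0 \<le> R * (\<bar>fst \<xi>\<bar> + \<bar>snd \<xi>\<bar>)" using R0 by simp
    then show ?thesis unfolding f_def by simp
  qed
  have "bounded (f ` state_D)" using f_b by (intro boundedI[of _ 2]) auto
  then have "continuous_on {0..} (\<lambda>s. \<integral>\<xi>. f \<xi> \<partial>\<gamma> s)"
    using \<gamma>_cont f_c unfolding weakly_continuous_def by blast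
  moreover have "(\<integral>\<xi>. f \<xi> \<partial>\<gamma> 0) = 0"
    unfolding \<gamma>_0 using continuous_on_D_measurable[OF refl f_c]
    by (subst integral_return) (auto simp: f_def space_restrict_space zero_in_state_D)
  ultimately have "\<exists>\<delta>>0. \<forall>s\<in>{0..}. dist s 0 < \<delta> \<longrightarrow> dist (\<integral>\<xi>. f \<xi> \<partial>\<gamma> s) 0 < 1"
    unfolding continuous_on_iff by (metis atLeast_iff order_refl zero_less_one)
  then obtain \<delta> where \<delta>: "\<delta> > 0" "\<And>s. 0 \<le> s \<Longrightarrow> s < \<delta> \<Longrightarrow> \<bar>\<integral>\<xi>. f \<xi> \<partial>\<gamma> s\<bar> < 1"
    by (force simp: dist_real_def)
  have near: "transform (\<gamma> s) v \<noteq> 0" if s: "0 \<le> s" "s < \<delta>" and v: "v \<in> dom_U" "norm v \<le> R" for s v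
  proof -
    interpret prob_space "\<gamma> s" using prob_algebra_D(1)[OF \<gamma>_in[OF s(1)]] .
    note sg = prob_algebra_D(2)[OF \<gamma>_in[OF s(1)]]
    have ie: "integrable (\<gamma> s) (\<lambda>\<xi>. exp (pairing v \<xi>))" by (rule integrable_exp_pairing[OF finite_measure_axioms sg v(1)])
    have "norm (transform (\<gamma> s) v - 1) = norm (\<integral>\<xi>. exp (pairing v \<xi>) - 1 \<partial>\<gamma> s)"
      unfolding transform_def using ie prob_space by simp
    also have "\<dots> \<le> (\<integral>\<xi>. norm (exp (pairing v \<xi>) - 1) \<partial>\<gamma> s)" by (rule integral_norm_bound)
    also have "\<dots> \<le> (\<integral>\<xi>. f \<xi> \<partial>\<gamma> s)"
    proof (rule integral_mono)
      show "integrable (\<gamma> s) (\<lambda>\<xi>. norm (exp (pairing v \<xi>) - 1))" using ie by simp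
      show "integrable (\<gamma> s) f"
        using f_b by (intro integrable_bounded_on_D[OF finite_measure_axioms sg, where B=2] continuous_on_D_measurable[OF sg] f_c) auto
      fix \<xi> assume "\<xi> \<in> space (\<gamma> s)"
      then have \<xi>: "\<xi> \<in> state_D" by (simp add: space_of_sets_borel_D[OF sg])
      have "norm (pairing v \<xi>) \<le> norm (fst v) * \<bar>fst \<xi>\<bar> + norm (snd v) * \<bar>snd \<xi>\<bar>"
        unfolding pairing_def by (rule order_trans[OF norm_triangle_ineq]) (simp add: norm_mult)
      also have "\<dots> \<le> R * \<bar>fst \<xi>\<bar> + R * \<bar>snd \<xi>\<bar>"
        using v(2) dist_fst_le[of v 0] dist_snd_le[of v 0] by (intro add_mono mult_right_mono) (auto simp: dist_norm)
      finally have "norm (pairing v \<xi>) \<le> R * (\<bar>fst \<xi>\<bar> + \<bar>snd \<xi>\<bar>)" by (simp add: distrib_left)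
      then show "norm (exp (pairing v \<xi>) - 1) \<le> f \<xi>"
        using norm_exp_diff_le[of "pairing v \<xi>" 0] Re_pairing_nonpos[OF v(1) \<xi>] by (simp add: f_def)
    qed
    also have "\<dots> < 1" using \<delta>(2)[OF s] by linarith
    finally show ?thesis by auto
  qed
  obtain n where n: "t / \<delta> < real n" using reals_Archimedean2 by blast
  have n0: "n > 0"
  proof (rule ccontr)
    assume "\<not> n > 0"
    then show False using n t \<delta>(1) by (simp add: divide_less_0_iff)
  qed
  define s where "s = t / real n"
  have s: "0 \<le> s" "s < \<delta>" using t n n0 \<delta>(1) by (auto simp: s_def field_simps)
  have ns: "real n * s = t" using n0 by (simp add: s_def)
  have "transform (\<gamma> t) u = (\<Prod>k<n. transform (\<gamma> s) (\<psi> (real k * s) u))"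
    using transform_\<gamma>_prod[OF s(1) u, of n] unfolding ns .
  also have "\<dots> \<noteq> 0"
  proof -
    have "transform (\<gamma> s) (\<psi> (real k * s) u) \<noteq> 0" if "k < n" for k
    proof (rule near[OF s])
      show "\<psi> (real k * s) u \<in> dom_U" using s u by (intro psi_in_dom_U) auto
      have "real k * s \<le> real n * s" using that s by (intro mult_right_mono) auto
      then show "norm (\<psi> (real k * s) u) \<le> R" using s ns by (intro R) auto
    qed
    then show ?thesis by (simp add: prod_zero_iff)
  qed
  finally show ?thesis .
qed

text \<open>A continuous function without zeros on the contractible set \<open>dom_U\<close> has a
  continuous logarithm. Subtracting its value at the origin gives the normalization that
  \<open>transform_root_eq_exp\<close> needs, and transforms of modulus at most 1 give
  \<open>Re (\<phi> u) \<le> 0\<close>.\<close>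

lemma SC_parameters_exist_at:
  assumes t: "t \<ge> 0"
  shows "\<exists>b1 b2 a m. LK_triple b1 b2 a m \<and> (\<forall>u\<in>dom_U. transform (\<gamma> t) u = exp (LK_exponent b1 b2 a m u))"
proof -
  note \<gamma>t = \<gamma>_in[OF t]
  have ct: "continuous_on dom_U (transform (\<gamma> t))" using \<gamma>t by (intro continuous_on_transform) (auto dest: prob_algebra_D)
  obtain g where g: "continuous_on dom_U g" "\<And>u. u \<in> dom_U \<Longrightarrow> transform (\<gamma> t) u = exp (g u)"
    by (rule continuous_logarithm_on_contractible[OF ct convex_imp_contractible[OF convex_dom_U] transform_\<gamma>_nonzero[OF t]]) (assumption, rule that)
  define \<phi> where "\<phi> u = g u - g 0" for u
  have "exp (g 0) = 1" using g(2)[of 0] transform_0[OF \<gamma>t] by simp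
  then have exp_\<phi>: "transform (\<gamma> t) u = exp (\<phi> u)" if "u \<in> dom_U" for u
    using g(2)[OF that] by (simp add: \<phi>_def exp_diff)
  have \<phi>: "continuous_on dom_U \<phi>" "\<phi> 0 = 0" unfolding \<phi>_def using g(1) by (auto intro!: continuous_intros)
  have \<phi>_Re: "Re (\<phi> u) \<le> 0" if "u \<in> dom_U" for u
    using norm_transform_le_1[OF \<gamma>t that] unfolding exp_\<phi>[OF that] by simp
  have "\<exists>N. N \<in> space (prob_algebra borel_D) \<and> (\<forall>u\<in>dom_U. transform (\<gamma> t) u = transform N u ^ Suc n)" for n
    by (rule root_exists[OF t, of "Suc n"]) auto
  then obtain N where N: "\<And>n. N n \<in> space (prob_algebra borel_D)"
    "\<And>n u. u \<in> dom_U \<Longrightarrow> transform (\<gamma> t) u = transform (N n) u ^ Suc n" by metis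
  have trN: "transform (N n) u = exp (\<phi> u / of_nat (Suc n))" if u: "u \<in> dom_U" for n u
    by (rule transform_root_eq_exp[OF N(1) _ \<phi> _ u]) (simp_all add: N(2)[symmetric] exp_\<phi> del: power_Suc of_nat_Suc)
  show ?thesis
    using LK_exists[OF \<phi> \<phi>_Re N(1) trN] exp_\<phi> by metis
qed

lemma SC_parameters_exist: "\<exists>b1 b2 a m. SC_parameters \<gamma> b1 b2 a m"
proof -
  have "\<forall>t. \<exists>b1 b2 a m. t \<ge> 0 \<longrightarrow> LK_triple b1 b2 a m \<and> (\<forall>u\<in>dom_U. transform (\<gamma> t) u = exp (LK_exponent b1 b2 a m u))"
    using SC_parameters_exist_at by blast
  then show ?thesis unfolding SC_parameters_def transform_def by metis
qed

end

theorem proposition3p1: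
  fixes Q :: "real \<Rightarrow> real \<times> real \<Rightarrow> (real \<times> real) measure"
    and \<psi> :: "real \<Rightarrow> complex \<times> complex \<Rightarrow> complex \<times> complex"
    and \<beta>11 \<beta>12 \<beta>22 \<alpha> :: "real \<Rightarrow> real"
    and \<mu> \<gamma> :: "real \<Rightarrow> (real \<times> real) measure"
  assumes "regular_HA_semigroup Q \<psi>"
    and "HA_parameters \<psi> \<beta>11 \<beta>12 \<beta>22 \<alpha> \<mu>"
    and "SC_semigroup Q \<gamma>"
    and "weakly_continuous \<gamma>"
  shows "(\<forall>t\<ge>0. infinitely_divisible_D (\<gamma> t)) \<and>
         (\<exists>b1 b2 a m. SC_parameters \<gamma> b1 b2 a m) \<and>
         (\<forall>b1 b2 a m. SC_parameters \<gamma> b1 b2 a m \<longrightarrow>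
            (\<forall>r\<ge>0. \<forall>t\<ge>0.
               b1 (r + t) = b1 r * \<beta>11 t + b1 t \<and>
               integrable (m r) (\<lambda>\<xi>. Q_chi2 Q t \<xi> - \<beta>22 t * chi (snd \<xi>)) \<and>
               b2 (r + t) = b1 r * \<beta>12 t + b2 r * \<beta>22 t + b2 t +
                 (\<integral>\<xi>. (Q_chi2 Q t \<xi> - \<beta>22 t * chi (snd \<xi>)) \<partial>m r) \<and>
               a (r + t) = b1 r * \<alpha> t + a r * (\<beta>22 t)\<^sup>2 + a t \<and>
               (\<forall>B\<in>sets borel_D. 0 \<notin> B \<longrightarrow>
                  emeasure (m (r + t)) B =
                    (\<integral>\<^sup>+\<xi>. emeasure (Q t \<xi>) B \<partial>m r) +
                    ennreal (b1 r) * emeasure (\<mu> t) B + emeasure (m t) B)))"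
proof -
  interpret skew_semigroup Q \<psi> \<beta>11 \<beta>12 \<beta>22 \<alpha> \<mu> \<gamma>
    using assms by unfold_locales
  have int: "integrable (m r) (\<lambda>\<xi>. Q_chi2 Q t \<xi> - \<beta>22 t * chi (snd \<xi>))"
    if "SC_parameters \<gamma> b1 b2 a m" "r \<ge> 0" "t \<ge> 0" for b1 b2 a m r t
    using that by (intro integrable_Q_chi2_diff LK_triple_levy[of "b1 r" "b2 r" "a r"]) (auto simp: SC_parameters_def)
  show ?thesis
    by (intro conjI allI impI ballI infinitely_divisible_\<gamma> SC_parameters_exist SC_parameters_relation int)
qed

end
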